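(* Let $\mathcal H$ be an arbitrary complex Hilbert space. The following statements hold. (i) For all $p>0$ and all $X,Y\in\mathcal B^p(\mathcal H)$ one has $X^*(\cdot)Y\in\mathcal B^p(\mathcal B^2(\mathcal H))$ with $\|X^*(\cdot)Y\|_p=\|X\|_p\|Y\|_p$. (ii) For all $\Phi\in\mathcal B(\mathcal B^1(\mathcal H))$ and $B\in\mathcal B^2(\mathcal H)$ one has $\Phi(B^*(\cdot)B)\in\mathcal B^2(\mathcal B^2(\mathcal H))$. (iii) For all $\Phi\in\mathcal B(\mathcal B^1(\mathcal H))$ and $B\in\mathcal B^1(\mathcal H)$ one has $\Phi(B^*(\cdot)B)\in\mathcal B^1(\mathcal B^2(\mathcal H))$. (iv) For all $K_1,K_2\in\mathcal B(\mathcal H)$ and $B\in\mathcal B^1(\mathcal H)$ the map $X\mapsto K_1B^*XBK_2$ is in $\mathcal B^1(\mathcal B^2(\mathcal H))$, and its trace is given by $\mathrm{tr}(K_1B^* )\,\mathrm{tr}(BK_2)$.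
   Context: For a complex (possibly non-separable) Hilbert space $\mathcal K$ and $p>0$, the Schatten class $\mathcal B^p(\mathcal K)$ is the set of compact operators $X$ on $\mathcal K$ whose singular values satisfy $\sum_j s_j(X)^p<\infty$, and $\|X\|_p:=(\sum_j s_j(X)^p)^{1/p}$. $\mathcal B(\mathcal H)$ is the space of bounded operators on $\mathcal H$, and $\mathcal B(\mathcal B^1(\mathcal H))$ the space of bounded linear maps on the Banach space $(\mathcal B^1(\mathcal H),\|\cdot\|_1)$. The Hilbert-Schmidt class $\mathcal B^2(\mathcal H)$ is itself a Hilbert space under $\langle X,Y\rangle_{\mathsf{HS}}=\mathrm{tr}(X^*Y)$, so $\mathcal B^p(\mathcal B^2(\mathcal H))$ is the Schatten class of operators acting on the Hilbert space $\mathcal B^2(\mathcal H)$. $X^*(\cdot)Y$ denotes the map $Z\mapsto X^*ZY$ on $\mathcal B^2(\mathcal H)$, and $\Phi(B^*(\cdot)B)$ the map $Z\mapsto\Phi(B^*ZB)$ on $\mathcal B^2(\mathcal H)$ (note that $B^*ZB\in\mathcal B^1(\mathcal H)$ and $\mathcal B^1(\mathcal H)\subseteq\mathcal B^2(\mathcal H)$). *)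

theory Defs
  imports "HOL-Analysis.Analysis"
begin

text \<open>
  The operations of a complex Hilbert space, without axioms. The operator-theoretic notions below
  refer to these operations only, so that they apply both to a given Hilbert space and to the
  Hilbert-Schmidt operators on it. The inner product is conjugate-linear in its first argument.
\<close>

class chilbert_ops = plus + minus + zero +
  fixes scaleC :: "complex \<Rightarrow> 'a \<Rightarrow> 'a"  (infixr "*\<^sub>C" 75)
    and cinner :: "'a \<Rightarrow> 'a \<Rightarrow> complex"

class chilbert_space = chilbert_ops + banach +
  assumes scaleC_add_right: "c *\<^sub>C (x + y) = c *\<^sub>C x + c *\<^sub>C y"
    and scaleC_add_left: "(c + d) *\<^sub>C x = c *\<^sub>C x + d *\<^sub>C x"
    and scaleC_scaleC: "c *\<^sub>C d *\<^sub>C x = (c * d) *\<^sub>C x"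
    and scaleR_scaleC: "r *\<^sub>R x = complex_of_real r *\<^sub>C x"
    and cinner_commute: "cinner x y = cnj (cinner y x)"
    and cinner_add_right: "cinner x (y + z) = cinner x y + cinner x z"
    and cinner_scaleC_right: "cinner x (c *\<^sub>C y) = c * cinner x y"
    and cinner_self: "cinner x x = complex_of_real ((norm x)\<^sup>2)"


section \<open>Operators\<close>

definition cnorm :: "'a::chilbert_ops \<Rightarrow> real" where
  "cnorm x = sqrt (Re (cinner x x))"

lemma cnorm_eq_norm: "cnorm (x :: 'a::chilbert_space) = norm x"
  by (simp add: cnorm_def cinner_self)

definition clinear_op :: "('a::chilbert_ops \<Rightarrow> 'a) \<Rightarrow> bool" where
  "clinear_op X \<longleftrightarrow> (\<forall>u v. X (u + v) = X u + X v) \<and> (\<forall>c v. X (c *\<^sub>C v) = c *\<^sub>C X v)"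

definition bounded_ops :: "('a::chilbert_ops \<Rightarrow> 'a) set" where
  "bounded_ops = {X. clinear_op X \<and> (\<exists>C. \<forall>v. cnorm (X v) \<le> C * cnorm v)}"

definition cadjoint :: "('a::chilbert_ops \<Rightarrow> 'a) \<Rightarrow> 'a \<Rightarrow> 'a" where
  "cadjoint X = (THE Y. \<forall>u v. cinner (Y u) v = cinner u (X v))"

definition compact_ops :: "('a::chilbert_ops \<Rightarrow> 'a) set" where
  "compact_ops = {X \<in> bounded_ops. \<forall>v :: nat \<Rightarrow> 'a. (\<exists>C. \<forall>n. cnorm (v n) \<le> C) \<longrightarrow>
     (\<exists>l r. strict_mono (r :: nat \<Rightarrow> nat) \<and> (\<lambda>n. cnorm (X (v (r n)) - l)) \<longlonglongrightarrow> 0)}"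


section \<open>Schatten classes\<close>

definition orthonormal :: "'a::chilbert_ops set \<Rightarrow> bool" where
  "orthonormal E \<longleftrightarrow> (\<forall>u\<in>E. \<forall>v\<in>E. cinner u v = (if u = v then 1 else 0))"

definition orthonormal_basis :: "'a::chilbert_ops set \<Rightarrow> bool" where
  "orthonormal_basis E \<longleftrightarrow> orthonormal E \<and> (\<forall>v. (\<forall>e\<in>E. cinner e v = 0) \<longrightarrow> v = 0)"

text \<open>The dimension of a subspace, all infinite values being identified.\<close>

definition hilbert_dim :: "'a::chilbert_ops set \<Rightarrow> enat" where
  "hilbert_dim V = (SUP E\<in>{E. finite E \<and> E \<subseteq> V \<and> orthonormal E}. enat (card E))"

text \<open>
  The non-zero singular values of \<open>X\<close>, i.e. the square roots \<open>s\<close> of the non-zero eigenvalues of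
  \<open>X\<^sup>* X\<close>. To count them with multiplicity, \<open>s\<close> occurs once for every
  \<open>k < dim (ker (X\<^sup>* X - s\<^sup>2))\<close>. Vanishing singular values do not contribute to \<open>\<Sum> s\<^sup>p\<close>.
\<close>

definition singular_values :: "('a::chilbert_ops \<Rightarrow> 'a) \<Rightarrow> (real \<times> nat) set" where
  "singular_values X =
     {(s, k). s > 0 \<and> enat k < hilbert_dim {v. cadjoint X (X v) = complex_of_real (s\<^sup>2) *\<^sub>C v}}"

definition schatten :: "real \<Rightarrow> ('a::chilbert_ops \<Rightarrow> 'a) set" where
  "schatten p = {X \<in> compact_ops. (\<lambda>(s, k). s powr p) summable_on singular_values X}"

definition schatten_norm :: "real \<Rightarrow> ('a::chilbert_ops \<Rightarrow> 'a) \<Rightarrow> real" where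
  "schatten_norm p X = (\<Sum>\<^sub>\<infinity>(s, k)\<in>singular_values X. s powr p) powr (1 / p)"

text \<open>For a trace class operator the sum exists and does not depend on the orthonormal basis.\<close>

definition op_trace :: "('a::chilbert_ops \<Rightarrow> 'a) \<Rightarrow> complex" where
  "op_trace X = (THE t. \<forall>E. orthonormal_basis E \<longrightarrow> ((\<lambda>e. cinner e (X e)) has_sum t) E)"

text \<open>
  The bounded linear maps on the trace class; the values of \<open>\<Phi>\<close> outside the trace class are
  irrelevant.
\<close>

definition bounded_maps_trace_class ::
    "(('a::chilbert_ops \<Rightarrow> 'a) \<Rightarrow> ('a \<Rightarrow> 'a)) set" where
  "bounded_maps_trace_class = {\<Phi>.
     (\<forall>X\<in>schatten 1. \<Phi> X \<in> schatten 1) \<and>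
     (\<forall>X\<in>schatten 1. \<forall>Y\<in>schatten 1. \<Phi> (\<lambda>v. X v + Y v) = (\<lambda>v. \<Phi> X v + \<Phi> Y v)) \<and>
     (\<forall>c. \<forall>X\<in>schatten 1. \<Phi> (\<lambda>v. c *\<^sub>C X v) = (\<lambda>v. c *\<^sub>C \<Phi> X v)) \<and>
     (\<exists>C. \<forall>X\<in>schatten 1. schatten_norm 1 (\<Phi> X) \<le> C * schatten_norm 1 X)}"


section \<open>The Hilbert space of Hilbert-Schmidt operators\<close>

lemma zero_in_schatten: "(\<lambda>_. 0) \<in> (schatten p :: ('a::chilbert_space \<Rightarrow> 'a) set)"
proof -
  have scaleC_0: "c *\<^sub>C (0::'a) = 0" for c
    using scaleC_add_right[of c 0 "0::'a"] by simp
  have cinner_0: "cinner x (0::'a) = 0" for x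
    using cinner_add_right[of x 0 0] by simp
  have cinner_0': "cinner (0::'a) x = 0" for x
    using cinner_commute[of 0 x] by (simp add: cinner_0)
  have eq_0: "x = 0" if "\<And>y. cinner x y = 0" for x :: 'a
    using that[of x] by (simp add: cinner_self)
  have adj: "cadjoint (\<lambda>_. 0::'a) = (\<lambda>_. 0)"
    unfolding cadjoint_def by (rule the_equality) (auto simp: cinner_0 cinner_0' intro!: eq_0)
  have bounded: "(\<lambda>_. 0::'a) \<in> bounded_ops"
    by (auto simp: bounded_ops_def clinear_op_def scaleC_0 cnorm_eq_norm intro!: exI[of _ 0])
  have compact: "(\<lambda>_. 0::'a) \<in> compact_ops"
    using bounded strict_mono_id
    by (auto simp: compact_ops_def cnorm_eq_norm intro!: exI[of _ "0::'a"] exI[of _ "id :: nat \<Rightarrow> nat"])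
  have "singular_values (\<lambda>_. 0::'a) = {}"
  proof -
    have "hilbert_dim {v. (0::'a) = complex_of_real (s\<^sup>2) *\<^sub>C v} = 0" if "s > 0" for s
    proof -
      have "v = 0" if "0 = complex_of_real (s\<^sup>2) *\<^sub>C v" for v :: 'a
        using that \<open>s > 0\<close> scaleR_scaleC[of "s\<^sup>2" v] by simp
      hence ker: "{v. (0::'a) = complex_of_real (s\<^sup>2) *\<^sub>C v} = {0}"
        by (auto simp: scaleC_0)
      have "E = {}" if "E \<subseteq> {0}" "orthonormal E" for E :: "'a set"
        using that by (fastforce simp: orthonormal_def cinner_0)
      hence "{E. finite E \<and> E \<subseteq> {0::'a} \<and> orthonormal E} = {{}}"
        by (auto simp del: subset_singleton_iff) (simp add: orthonormal_def)
      thus ?thesis unfolding ker hilbert_dim_def by (simp add: zero_enat_def)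
    qed
    thus ?thesis by (auto simp: singular_values_def adj)
  qed
  thus ?thesis using compact by (simp add: schatten_def)
qed

typedef (overloaded) ('a::chilbert_space) hs = "schatten 2 :: ('a \<Rightarrow> 'a) set"
  using zero_in_schatten by blast

text \<open>
  The operations are the pointwise ones, with \<open>\<langle>X, Y\<rangle> = tr (X\<^sup>* Y)\<close>. The arguments of \<open>Abs_hs\<close> are
  Hilbert-Schmidt since these form a linear space, and \<open>hs\<close> is a Hilbert space; no proof of these
  classical facts is needed to state anything below.
\<close>

instantiation hs :: (chilbert_space) chilbert_ops
begin

definition "0 = Abs_hs (\<lambda>_. 0)"
definition "X + Y = Abs_hs (\<lambda>v. Rep_hs X v + Rep_hs Y v)"
definition "X - Y = Abs_hs (\<lambda>v. Rep_hs X v - Rep_hs Y v)"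
definition "c *\<^sub>C X = Abs_hs (\<lambda>v. c *\<^sub>C Rep_hs X v)"
definition "cinner X Y = op_trace (cadjoint (Rep_hs X) \<circ> Rep_hs Y)"

instance ..

end

definition on_hs :: "(('a \<Rightarrow> 'a) \<Rightarrow> ('a \<Rightarrow> 'a)) \<Rightarrow> 'a::chilbert_space hs \<Rightarrow> 'a hs" where
  "on_hs F Z = Abs_hs (F (Rep_hs Z))"

text \<open>
  The maps \<open>F\<close> on operators that restrict to a Schatten class operator on the Hilbert space of
  Hilbert-Schmidt operators. The first condition is what makes \<open>on_hs F\<close> this restriction.
\<close>

definition schatten_on_hs :: "real \<Rightarrow> (('a::chilbert_space \<Rightarrow> 'a) \<Rightarrow> ('a \<Rightarrow> 'a)) set" where
  "schatten_on_hs p = {F. (\<forall>Z\<in>schatten 2. F Z \<in> schatten 2) \<and> on_hs F \<in> schatten p}"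

end

theory Submission
  imports Defs "HOL-Library.Diagonal_Subsequence"
begin

text \<open>
  Both factors of \<open>Z \<mapsto> A Z C\<close> act separately on rank one operators, \<open>|a\<rangle>\<langle>b|\<close> being sent to
  \<open>|A a\<rangle>\<langle>C\<^sup>* b|\<close>. Hence products of right singular vectors of \<open>X\<^sup>*\<close> and \<open>Y\<^sup>*\<close> are right singular
  vectors of \<open>X\<^sup>*(\<cdot>)Y\<close>, whose singular values are therefore the products \<open>s\<^sub>i(X) s\<^sub>j(Y)\<close>; this gives (i).
  For (ii), \<open>\<parallel>\<Phi>(B\<^sup>*|e\<rangle>\<langle>f|B)\<parallel>\<^sub>2 \<le> \<parallel>\<Phi>\<parallel> \<parallel>B\<^sup>* e\<parallel> \<parallel>B\<^sup>* f\<parallel>\<close> is square summable over the orthonormal basis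
  of all \<open>|e\<rangle>\<langle>f|\<close>. For (iii) and (iv), an operator is trace class if and only if it is a sum of rank one
  operators \<open>|a\<^sub>i\<rangle>\<langle>b\<^sub>i|\<close> with \<open>\<Sum> \<parallel>a\<^sub>i\<parallel> \<parallel>b\<^sub>i\<parallel> < \<infinity>\<close>, and its trace is then \<open>\<Sum> \<langle>b\<^sub>i, a\<^sub>i\<rangle>\<close>. Such a representation
  \<open>B = \<Sum> |B k\<rangle>\<langle>k|\<close> over right singular vectors yields
  \<open>B\<^sup>* Z B = \<Sum> \<langle>|B k\<rangle>\<langle>B l|, Z\<rangle> |k\<rangle>\<langle>l|\<close>, which converges in trace norm, and applying \<open>\<Phi>\<close> or multiplying by
  \<open>K\<^sub>1\<close> and \<open>K\<^sub>2\<close> gives representations of the same kind on the Hilbert-Schmidt operators.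
\<close>

section \<open>Inner product and orthonormal bases\<close>

text \<open>The definitions count singular values by dimensions of eigenspaces, which supplies no
  vectors to compute with. The counting is therefore traded for sums over an orthonormal system of
  eigenvectors, obtained from compactness by Zorn's lemma and a maximization argument. As the space
  may be non-separable, all series are unordered sums over arbitrary index sets.

  Everything up to the Hilbert-Schmidt class is proved for an arbitrary type of class
  \<open>chilbert_space\<close>. Once \<open>hs\<close> is an instance, completeness included, the
  same lemmas speak about operators on the Hilbert-Schmidt operators.

  Singular vectors of a map built from a general \<open>\<Phi>\<close> are out of reach, and
  \<open>\<Phi>\<close> is linear and bounded on the trace class only. An infinite sum passes
  through it when the remainders tend to zero in trace norm; in (iii) the absolute summability of
  the coefficients \<open>cinner (B k) (Z (B l))\<close> provides this.\<close>

lemma scaleC_one [simp]: "1 *\<^sub>C x = (x :: 'a::chilbert_space)"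
  using scaleR_scaleC[of 1 x] by simp

declare scaleC_scaleC [simp]

lemma scaleC_scaleR_commute: "c *\<^sub>C (r *\<^sub>R x) = r *\<^sub>R (c *\<^sub>C (x :: 'a::chilbert_space))"
  by (simp add: scaleR_scaleC mult.commute)

lemma cinner_add_left: "cinner (x + y) z = cinner x z + cinner y (z :: 'a::chilbert_space)"
  by (metis cinner_commute cinner_add_right complex_cnj_add)

lemma cinner_scaleC_left: "cinner (c *\<^sub>C x) y = cnj c * cinner x (y :: 'a::chilbert_space)"
  by (metis cinner_commute cinner_scaleC_right complex_cnj_mult)

lemma norm_scaleC: "norm (c *\<^sub>C x) = cmod c * norm (x :: 'a::chilbert_space)"
proof -
  have "complex_of_real ((norm (c *\<^sub>C x))\<^sup>2) = complex_of_real ((cmod c * norm x)\<^sup>2)"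
    using cinner_scaleC_left[of c x "c *\<^sub>C x"] cinner_scaleC_right[of x c x]
      complex_norm_square[of c, symmetric]
    by (simp add: cinner_self power_mult_distrib mult.assoc[symmetric] mult.commute[of "cnj c"])
  then have "(norm (c *\<^sub>C x))\<^sup>2 = (cmod c * norm x)\<^sup>2"
    using of_real_eq_iff by blast
  then show ?thesis
    by (simp add: power2_eq_iff_nonneg)
qed

lemma cinner_zero_left [simp]: "cinner 0 (x :: 'a::chilbert_space) = 0"
  using cinner_add_left[of 0 0 x] by simp

lemma cinner_zero_right [simp]: "cinner (x :: 'a::chilbert_space) 0 = 0"
  using cinner_add_right[of x 0 0] by simp

lemma cinner_eq_zero_imp: "cinner x x = 0 \<Longrightarrow> (x :: 'a::chilbert_space) = 0"
  by (simp add: cinner_self)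

lemma norm_add_sq:
  "(norm (x + y))\<^sup>2 = (norm x)\<^sup>2 + (norm y)\<^sup>2 + 2 * Re (cinner x (y :: 'a::chilbert_space))"
proof -
  have "cinner (x + y) (x + y) = cinner x x + cinner y y + (cinner x y + cnj (cinner x y))"
    by (simp add: cinner_add_left cinner_add_right cinner_commute[of y x])
  then have "complex_of_real ((norm (x + y))\<^sup>2) =
      complex_of_real ((norm x)\<^sup>2 + (norm y)\<^sup>2 + 2 * Re (cinner x y))"
    by (simp add: cinner_self complex_add_cnj)
  then show ?thesis using of_real_eq_iff by blast
qed

lemma Cauchy_Schwarz_cinner: "cmod (cinner x y) \<le> norm x * norm (y :: 'a::chilbert_space)"
proof (cases "y = 0")
  case False
  define c where "c = cinner x y"
  define s where "s = (norm y)\<^sup>2"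
  have s: "s > 0" using False by (simp add: s_def)
  \<comment> \<open>\<open>x - (\<langle>y, x\<rangle> / |y|\<^sup>2) y\<close> is the projection of \<open>x\<close> to the complement of \<open>y\<close>\<close>
  define d where "d = - cnj c / complex_of_real s"
  have "0 \<le> (norm (x + d *\<^sub>C y))\<^sup>2" by simp
  also have "\<dots> = (norm x)\<^sup>2 + (cmod d * norm y)\<^sup>2 + 2 * Re (d * c)"
    by (simp only: norm_add_sq norm_scaleC cinner_scaleC_right c_def)
  also have "(cmod d * norm y)\<^sup>2 = (cmod c)\<^sup>2 / s"
    using s by (simp add: d_def norm_divide power_mult_distrib power_divide s_def[symmetric])
       (simp add: power2_eq_square)
  also have "d * c = - complex_of_real ((cmod c)\<^sup>2 / s)"
    unfolding d_def by (simp add: complex_norm_square[symmetric] mult.commute flip: of_real_power)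
  finally have "(cmod c)\<^sup>2 / s \<le> (norm x)\<^sup>2" by simp
  then have "(cmod c)\<^sup>2 \<le> (norm x * norm y)\<^sup>2"
    using s by (simp add: divide_simps power_mult_distrib s_def)
  then show ?thesis unfolding c_def
    by (meson mult_nonneg_nonneg norm_ge_zero power2_le_imp_le)
qed simp

text \<open>\<open>bounded_bilinear\<close> refers to real scalars, so conjugate-linearity in the
  first argument is harmless. The interpretations below supply the limit, sum and difference rules
  for \<open>cinner\<close> and \<open>scaleC\<close>.\<close>

lemma bounded_bilinear_cinner: "bounded_bilinear (cinner :: 'a::chilbert_space \<Rightarrow> 'a \<Rightarrow> complex)"
proof
  show "\<exists>K. \<forall>a b. norm (cinner a (b::'a)) \<le> norm a * norm b * K"
    by (intro exI[of _ 1]) (simp add: Cauchy_Schwarz_cinner)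
qed (simp_all add: cinner_add_left cinner_add_right scaleR_scaleC cinner_scaleC_left
    cinner_scaleC_right scaleR_conv_of_real)

lemma bounded_bilinear_scaleC: "bounded_bilinear (scaleC :: complex \<Rightarrow> 'a::chilbert_space \<Rightarrow> 'a)"
proof
  show "\<exists>K. \<forall>a b. norm (a *\<^sub>C (b::'a)) \<le> norm a * norm b * K"
    by (intro exI[of _ 1]) (simp add: norm_scaleC)
  show "(r *\<^sub>R c) *\<^sub>C x = r *\<^sub>R (c *\<^sub>C x)" for r c and x :: 'a
    unfolding scaleR_scaleC[of r "c *\<^sub>C x"] by (simp add: scaleR_conv_of_real)
  show "c *\<^sub>C (r *\<^sub>R x) = r *\<^sub>R (c *\<^sub>C x)" for r c and x :: 'a
    by (rule scaleC_scaleR_commute)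
qed (simp_all add: scaleC_add_left scaleC_add_right)

interpretation cinner: bounded_bilinear "cinner :: 'a::chilbert_space \<Rightarrow> 'a \<Rightarrow> complex"
  by (rule bounded_bilinear_cinner)

interpretation scaleC: bounded_bilinear "scaleC :: complex \<Rightarrow> 'a::chilbert_space \<Rightarrow> 'a"
  by (rule bounded_bilinear_scaleC)

lemma scaleC_zero_left [simp]: "0 *\<^sub>C x = (0 :: 'a::chilbert_space)"
  by (rule scaleC.zero_left)

lemma scaleC_zero_right [simp]: "c *\<^sub>C 0 = (0 :: 'a::chilbert_space)"
  by (rule scaleC.zero_right)

lemma scaleC_eq_0_iff [simp]: "c *\<^sub>C x = (0 :: 'a::chilbert_space) \<longleftrightarrow> c = 0 \<or> x = 0"
  by (metis mult_eq_0_iff norm_eq_zero norm_scaleC)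

lemma cinner_ext:
  assumes "\<And>v. cinner v x = cinner v (y :: 'a::chilbert_space)"
  shows "x = y"
  using cinner_eq_zero_imp[of "x - y"] assms by (simp add: cinner.diff_right)

text \<open>Convergence facts about sums of squared norms, basis independence included, carry over
  to sums of inner products through this fixed combination of four squared norms.\<close>

lemma polarization:
  "4 * cinner x (y :: 'a::chilbert_space) =
    complex_of_real ((norm (x + y))\<^sup>2) - complex_of_real ((norm (x + (-1) *\<^sub>C y))\<^sup>2)
    - \<i> * complex_of_real ((norm (x + \<i> *\<^sub>C y))\<^sup>2) + \<i> * complex_of_real ((norm (x + (-\<i>) *\<^sub>C y))\<^sup>2)"
  unfolding norm_add_sq norm_scaleC cinner_scaleC_right
  by (auto simp: complex_eq_iff)

section \<open>Orthonormal sets and the existence of bases\<close>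

lemma orthonormal_subset: "orthonormal E \<Longrightarrow> F \<subseteq> E \<Longrightarrow> orthonormal F"
  unfolding orthonormal_def by blast

lemma orthonormal_norm: "orthonormal E \<Longrightarrow> e \<in> E \<Longrightarrow> norm (e :: 'a::chilbert_space) = 1"
  using cinner_self[of e] of_real_eq_iff[of "(norm e)\<^sup>2" 1, where 'a = complex]
  by (simp add: orthonormal_def power2_eq_1_iff) (metis abs_norm_cancel abs_minus one_neq_neg_one norm_ge_zero zero_le_one abs_of_nonneg)

lemma orthonormal_neq: "orthonormal E \<Longrightarrow> e \<in> E \<Longrightarrow> f \<in> E \<Longrightarrow> e \<noteq> f \<Longrightarrow> cinner e f = 0"
  by (simp add: orthonormal_def)

lemma orthonormal_insert:
  assumes "orthonormal E" "norm v = 1" "\<And>e. e \<in> E \<Longrightarrow> cinner e v = 0"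
  shows "orthonormal (insert (v :: 'a::chilbert_space) E)"
proof -
  have "cinner v e = 0" if "e \<in> E" for e
    by (subst cinner_commute) (simp add: assms(3)[OF that])
  then show ?thesis
    using assms cinner_self[of v] by (auto simp: orthonormal_def)
qed

text \<open>Zorn's lemma with a side condition \<open>Q\<close> on the members: the trivial
  \<open>Q\<close> yields bases, and the \<open>Q\<close> selecting eigenvectors with non-zero image
  yields singular systems. The last conclusion is maximality in usable form, since a unit vector as
  described could be added to \<open>M\<close>.\<close>

lemma maximal_orthonormal:
  assumes "orthonormal E" "E \<subseteq> Collect Q"
  obtains M where "orthonormal M" "E \<subseteq> M" "M \<subseteq> Collect Q"
    "\<And>v :: 'a::chilbert_space. norm v = 1 \<Longrightarrow> Q v \<Longrightarrow> \<forall>e\<in>M. cinner e v = 0 \<Longrightarrow> False"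
proof -
  define A where "A = {F. orthonormal F \<and> E \<subseteq> F \<and> F \<subseteq> Collect Q}"
  have "\<exists>U\<in>A. \<forall>X\<in>C. X \<subseteq> U" if C: "subset.chain A C" for C
  proof (cases "C = {}")
    case True
    then show ?thesis using assms by (auto simp: A_def)
  next
    case False
    have "orthonormal (\<Union>C)"
      unfolding orthonormal_def
    proof (intro ballI)
      fix u v assume "u \<in> \<Union>C" "v \<in> \<Union>C"
      then obtain U V where "U \<in> C" "V \<in> C" "u \<in> U" "v \<in> V" by blast
      moreover have "U \<subseteq> V \<or> V \<subseteq> U"
        using C \<open>U \<in> C\<close> \<open>V \<in> C\<close> by (auto simp: subset_chain_def)
      ultimately obtain W where "W \<in> C" "u \<in> W" "v \<in> W" by blast
      then show "cinner u v = (if u = v then 1 else 0)"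
        using C by (auto simp: subset_chain_def A_def orthonormal_def)
    qed
    moreover have "E \<subseteq> \<Union>C" "\<Union>C \<subseteq> Collect Q"
      using False C by (fastforce simp: subset_chain_def A_def)+
    ultimately show ?thesis by (intro bexI[of _ "\<Union>C"]) (auto simp: A_def)
  qed
  then obtain M where M: "M \<in> A" "\<And>X. X \<in> A \<Longrightarrow> M \<subseteq> X \<Longrightarrow> X = M"
    using subset_Zorn[of A] by metis
  show ?thesis
  proof (rule that[of M])
    fix v assume v: "norm v = 1" "Q v" "\<forall>e\<in>M. cinner e v = 0"
    then have "insert v M \<in> A"
      using M(1) orthonormal_insert[of M v] by (auto simp: A_def)
    then have "v \<in> M" using M(2)[of "insert v M"] by blast
    then show False using v cinner_self[of v] by auto
  qed (use M(1) in \<open>auto simp: A_def\<close>)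
qed

lemma unit_vector: "v \<noteq> 0 \<Longrightarrow> norm (complex_of_real (inverse (norm v)) *\<^sub>C (v :: 'a::chilbert_space)) = 1"
  by (simp add: norm_scaleC norm_inverse)

lemma orthonormal_basis_extend:
  assumes "orthonormal (E :: 'a::chilbert_space set)"
  obtains M where "orthonormal_basis M" "E \<subseteq> M"
proof -
  obtain M where M: "orthonormal M" "E \<subseteq> M"
    "\<And>v :: 'a. norm v = 1 \<Longrightarrow> \<forall>e\<in>M. cinner e v = 0 \<Longrightarrow> False"
    using maximal_orthonormal[OF assms, of "\<lambda>_. True"] by auto
  have "v = 0" if "\<forall>e\<in>M. cinner e v = 0" for v
  proof (rule ccontr)
    assume "v \<noteq> 0"
    then show False
      using M(3)[OF unit_vector[of v]] that by (simp add: cinner_scaleC_right)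
  qed
  then show ?thesis using that[of M] M by (simp add: orthonormal_basis_def)
qed

lemma orthonormal_empty: "orthonormal {}"
  by (simp add: orthonormal_def)

lemma orthonormal_basis_exists: obtains E where "orthonormal_basis (E :: 'a::chilbert_space set)"
  using orthonormal_basis_extend[OF orthonormal_empty] by blast

lemma orthonormal_basisD: "orthonormal_basis E \<Longrightarrow> orthonormal E"
  by (simp add: orthonormal_basis_def)

section \<open>Bessel's inequality and unordered orthogonal series\<close>

lemma norm_sum_orthogonal:
  assumes "finite F" "\<And>i j. i \<in> F \<Longrightarrow> j \<in> F \<Longrightarrow> i \<noteq> j \<Longrightarrow> cinner (g i) (g j) = 0"
  shows "(norm (\<Sum>i\<in>F. g i :: 'a::chilbert_space))\<^sup>2 = (\<Sum>i\<in>F. (norm (g i))\<^sup>2)"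
  using assms
proof (induction F rule: finite_induct)
  case (insert x F)
  have "cinner (g x) (\<Sum>i\<in>F. g i) = 0"
    using insert by (auto simp: cinner.sum_right intro!: sum.neutral)
  then show ?case using insert by (simp add: norm_add_sq)
qed simp

lemma bessel_finite:
  assumes "orthonormal E" "finite F" "F \<subseteq> E"
  shows "(\<Sum>e\<in>F. (cmod (cinner e v))\<^sup>2) \<le> (norm (v :: 'a::chilbert_space))\<^sup>2"
    and "(norm (v - (\<Sum>e\<in>F. cinner e v *\<^sub>C e)))\<^sup>2 = (norm v)\<^sup>2 - (\<Sum>e\<in>F. (cmod (cinner e v))\<^sup>2)"
proof -
  define p where "p = (\<Sum>e\<in>F. cinner e v *\<^sub>C e)"
  have p: "(norm p)\<^sup>2 = (\<Sum>e\<in>F. (cmod (cinner e v))\<^sup>2)"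
    unfolding p_def using assms
    by (subst norm_sum_orthogonal)
       (auto simp: cinner_scaleC_left cinner_scaleC_right norm_scaleC orthonormal_norm
         orthonormal_neq subset_iff intro!: sum.cong)
  have "cinner v p = complex_of_real (\<Sum>e\<in>F. (cmod (cinner e v))\<^sup>2)"
    unfolding p_def cinner.sum_right cinner_scaleC_right of_real_sum
    by (intro sum.cong refl) (metis cinner_commute complex_norm_square)
  then have "Re (cinner v p) = (norm p)\<^sup>2" using p by simp
  moreover have "(norm (v + - p))\<^sup>2 = (norm v)\<^sup>2 + (norm p)\<^sup>2 - 2 * Re (cinner v p)"
    unfolding norm_add_sq cinner.minus_right by simp
  ultimately have *: "(norm (v - p))\<^sup>2 = (norm v)\<^sup>2 - (norm p)\<^sup>2" by simp
  then show "(norm (v - (\<Sum>e\<in>F. cinner e v *\<^sub>C e)))\<^sup>2 = (norm v)\<^sup>2 - (\<Sum>e\<in>F. (cmod (cinner e v))\<^sup>2)"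
    unfolding p by (simp only: p_def[symmetric])
  show "(\<Sum>e\<in>F. (cmod (cinner e v))\<^sup>2) \<le> (norm v)\<^sup>2"
    using * p zero_le_power2[of "norm (v - p)"] by linarith
qed

lemma bessel:
  assumes "orthonormal E"
  shows "(\<lambda>e. (cmod (cinner e v))\<^sup>2) summable_on E"
    and "(\<Sum>\<^sub>\<infinity>e\<in>E. (cmod (cinner e v))\<^sup>2) \<le> (norm (v :: 'a::chilbert_space))\<^sup>2"
proof -
  show "(\<lambda>e. (cmod (cinner e v))\<^sup>2) summable_on E"
    using bessel_finite(1)[OF assms]
    by (intro nonneg_bdd_above_summable_on bdd_aboveI[of _ "(norm v)\<^sup>2"]) auto
  then show "(\<Sum>\<^sub>\<infinity>e\<in>E. (cmod (cinner e v))\<^sup>2) \<le> (norm v)\<^sup>2"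
    by (rule infsum_le_finite_sums) (use bessel_finite(1)[OF assms] in blast)
qed

text \<open>Cauchy criterion for unordered sums. Orthogonal series call for it: they converge
  unconditionally although their norms need not be summable.\<close>

lemma summable_on_Cauchy:
  fixes f :: "'i \<Rightarrow> 'a::banach"
  assumes "\<And>\<epsilon>. \<epsilon> > 0 \<Longrightarrow> \<exists>F. finite F \<and> F \<subseteq> A \<and> (\<forall>G. finite G \<and> G \<subseteq> A \<and> G \<inter> F = {} \<longrightarrow> norm (sum f G) < \<epsilon>)"
  shows "f summable_on A"
proof -
  have "\<exists>P. eventually P (finite_subsets_at_top A) \<and>
              (\<forall>F F'. P F \<and> P F' \<longrightarrow> dist (sum f F) (sum f F') < e)" if e: "e > 0" for e
  proof -
    obtain F0 where F0: "finite F0" "F0 \<subseteq> A"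
      "\<And>G. finite G \<Longrightarrow> G \<subseteq> A \<Longrightarrow> G \<inter> F0 = {} \<Longrightarrow> norm (sum f G) < e / 2"
      using assms[OF half_gt_zero[OF e]] by metis
    define P where "P F \<longleftrightarrow> finite F \<and> F0 \<subseteq> F \<and> F \<subseteq> A" for F
    have ev: "eventually P (finite_subsets_at_top A)"
      unfolding eventually_finite_subsets_at_top P_def using F0 by blast
    have d: "dist (sum f F) (sum f F0) < e / 2" if "P F" for F
    proof -
      have "sum f F - sum f F0 = sum f (F - F0)"
        using that by (simp add: P_def sum_diff)
      then show ?thesis using F0(3)[of "F - F0"] that by (auto simp: P_def dist_norm)
    qed
    have "dist (sum f F) (sum f F') < e" if "P F" "P F'" for F F'
      by (rule dist_triangle_half_l[OF d[OF that(1)] d[OF that(2)]])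
    then show ?thesis using ev by blast
  qed
  then have "cauchy_filter (filtermap (sum f) (finite_subsets_at_top A))"
    by (simp add: cauchy_filter_metric_filtermap)
  moreover have "complete (UNIV::'a set)"
    by (meson Cauchy_convergent UNIV_I complete_def convergent_def)
  ultimately obtain L' where "(sum f \<longlongrightarrow> L') (finite_subsets_at_top A)"
    using complete_uniform[where S=UNIV] by (force simp add: filterlim_def)
  then show ?thesis
    using summable_on_def has_sum_def by blast
qed

lemma summable_on_tail:
  fixes f :: "'i \<Rightarrow> real"
  assumes "f summable_on A" "\<And>x. x \<in> A \<Longrightarrow> f x \<ge> 0" "\<epsilon> > 0"
  obtains F where "finite F" "F \<subseteq> A" "f summable_on (A - F)" "infsum f (A - F) < \<epsilon>"
    "\<And>G. finite G \<Longrightarrow> G \<subseteq> A \<Longrightarrow> G \<inter> F = {} \<Longrightarrow> sum f G < \<epsilon>"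
proof -
  obtain F where F: "finite F" "F \<subseteq> A" "dist (sum f F) (infsum f A) \<le> \<epsilon> / 2"
    using infsum_finite_approximation[OF assms(1), of "\<epsilon> / 2"] assms(3) by auto
  have s: "f summable_on (A - F)"
    using assms(1) by (rule summable_on_subset_banach) auto
  have "infsum f A = infsum f F + infsum f (A - F)"
    using F s by (subst infsum_Un_disjoint[symmetric]) (auto simp: Un_absorb1)
  then have lt: "infsum f (A - F) < \<epsilon>"
    using F assms(3) by (simp add: dist_real_def)
  show ?thesis
  proof (rule that[OF F(1,2) s lt])
    fix G assume "finite G" "G \<subseteq> A" "G \<inter> F = {}"
    then have "sum f G \<le> infsum f (A - F)"
      using assms(2) s by (intro finite_sum_le_infsum) auto
    then show "sum f G < \<epsilon>" using lt by simp
  qed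
qed

lemma summable_on_orthogonal:
  fixes g :: "'i \<Rightarrow> 'a::chilbert_space"
  assumes "\<And>i j. i \<in> I \<Longrightarrow> j \<in> I \<Longrightarrow> i \<noteq> j \<Longrightarrow> cinner (g i) (g j) = 0"
    and "(\<lambda>i. (norm (g i))\<^sup>2) summable_on I"
  shows "g summable_on I"
proof (rule summable_on_Cauchy)
  fix \<epsilon> :: real assume "\<epsilon> > 0"
  then obtain F where F: "finite F" "F \<subseteq> I"
    "\<And>G. finite G \<Longrightarrow> G \<subseteq> I \<Longrightarrow> G \<inter> F = {} \<Longrightarrow> (\<Sum>i\<in>G. (norm (g i))\<^sup>2) < \<epsilon>\<^sup>2"
    using summable_on_tail[OF assms(2) zero_le_power2, of "\<epsilon>\<^sup>2"] by (metis zero_less_power)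
  have "norm (sum g G) < \<epsilon>" if G: "finite G" "G \<subseteq> I" "G \<inter> F = {}" for G
  proof -
    have "(norm (sum g G))\<^sup>2 = (\<Sum>i\<in>G. (norm (g i))\<^sup>2)"
      by (intro norm_sum_orthogonal assms(1)) (use G in blast)+
    also have "\<dots> < \<epsilon>\<^sup>2" using F(3) G by simp
    finally show ?thesis
      using \<open>\<epsilon> > 0\<close> by (meson less_eq_real_def power2_less_imp_less)
  qed
  then show "\<exists>F. finite F \<and> F \<subseteq> I \<and> (\<forall>G. finite G \<and> G \<subseteq> I \<and> G \<inter> F = {} \<longrightarrow> norm (sum g G) < \<epsilon>)"
    using F by blast
qed

lemma has_sum_cinner_right:
  "(f has_sum s) A \<Longrightarrow> ((\<lambda>i. cinner (u :: 'a::chilbert_space) (f i)) has_sum cinner u s) A"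
  by (rule has_sum_bounded_linear[OF cinner.bounded_linear_right, unfolded o_def])

lemma has_sum_cinner_left:
  "(f has_sum s) A \<Longrightarrow> ((\<lambda>i. cinner (f i) (u :: 'a::chilbert_space)) has_sum cinner s u) A"
  by (rule has_sum_bounded_linear[OF cinner.bounded_linear_left, unfolded o_def])

lemma has_sum_orthogonal_norm:
  fixes g :: "'i \<Rightarrow> 'a::chilbert_space"
  assumes "\<And>i j. i \<in> I \<Longrightarrow> j \<in> I \<Longrightarrow> i \<noteq> j \<Longrightarrow> cinner (g i) (g j) = 0"
    and "(g has_sum s) I"
  shows "((\<lambda>i. (norm (g i))\<^sup>2) has_sum (norm s)\<^sup>2) I"
proof -
  have "((\<lambda>F. (norm (sum g F))\<^sup>2) \<longlongrightarrow> (norm s)\<^sup>2) (finite_subsets_at_top I)"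
    using assms(2) unfolding has_sum_def by (intro tendsto_intros)
  moreover have "\<forall>\<^sub>F F in finite_subsets_at_top I. (norm (sum g F))\<^sup>2 = (\<Sum>i\<in>F. (norm (g i))\<^sup>2)"
    by (rule eventually_finite_subsets_at_top_weakI) (auto intro!: norm_sum_orthogonal assms(1))
  ultimately show ?thesis unfolding has_sum_def by (rule Lim_transform_eventually)
qed

lemma orthonormal_projection:
  assumes "orthonormal (E :: 'a::chilbert_space set)"
  obtains p where "((\<lambda>e. cinner e v *\<^sub>C e) has_sum p) E" "\<And>e. e \<in> E \<Longrightarrow> cinner e (v - p) = 0"
proof -
  have "(\<lambda>e. cinner e v *\<^sub>C e) summable_on E"
  proof (rule summable_on_orthogonal)
    show "(\<lambda>i. (norm (cinner i v *\<^sub>C i))\<^sup>2) summable_on E"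
      using bessel(1)[OF assms, of v]
      by (rule summable_on_cong[THEN iffD1, rotated]) (simp add: norm_scaleC orthonormal_norm[OF assms])
  qed (simp add: cinner_scaleC_left cinner_scaleC_right orthonormal_neq[OF assms])
  then obtain p where p: "((\<lambda>e. cinner e v *\<^sub>C e) has_sum p) E"
    by (auto simp: summable_on_def)
  have "cinner f (v - p) = 0" if "f \<in> E" for f
  proof -
    have "((\<lambda>e. cinner f (cinner e v *\<^sub>C e)) has_sum cinner f p) E"
      by (rule has_sum_cinner_right[OF p])
    moreover have "((\<lambda>e. cinner f (cinner e v *\<^sub>C e)) has_sum cinner f v) E"
    proof (rule has_sum_finite_neutralI[of "{f}"])
      show "cinner f v = (\<Sum>e\<in>{f}. cinner f (cinner e v *\<^sub>C e))"
        using assms that by (simp add: cinner_scaleC_right orthonormal_def)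
    qed (use assms that in \<open>auto simp: cinner_scaleC_right orthonormal_def\<close>)
    ultimately show ?thesis by (simp add: cinner.diff_right has_sum_unique)
  qed
  then show ?thesis using that p by blast
qed

text \<open>The hypothesis puts \<open>v\<close> into the double orthogonal complement of
  \<open>E\<close>. So \<open>v - p\<close> is orthogonal to \<open>v\<close> and, being orthogonal
  to \<open>E\<close>, also to \<open>p\<close>; hence it is zero. Besides bases this covers
  eigenspaces, where \<open>E\<close> spans only part of the space.\<close>

lemma orthonormal_expansion:
  assumes "orthonormal E" "\<And>w. (\<And>e. e \<in> E \<Longrightarrow> cinner e w = 0) \<Longrightarrow> cinner w (v :: 'a::chilbert_space) = 0"
  shows "((\<lambda>e. cinner e v *\<^sub>C e) has_sum v) E"
proof -
  obtain p where p: "((\<lambda>e. cinner e v *\<^sub>C e) has_sum p) E" "\<And>e. e \<in> E \<Longrightarrow> cinner e (v - p) = 0"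
    using orthonormal_projection[OF assms(1), of v] by blast
  have "((\<lambda>e. cinner (v - p) (cinner e v *\<^sub>C e)) has_sum cinner (v - p) p) E"
    by (rule has_sum_cinner_right[OF p(1)])
  moreover have "cinner (v - p) (cinner e v *\<^sub>C e) = 0" if "e \<in> E" for e
    using p(2)[OF that] cinner_commute[of "v - p" e] by (simp add: cinner_scaleC_right)
  ultimately have "cinner (v - p) p = 0"
    by (metis (no_types, lifting) has_sum_0 has_sum_unique)
  moreover have "cinner (v - p) v = 0" using assms(2) p(2) by blast
  ultimately have "cinner (v - p) (v - p) = 0" by (simp add: cinner.diff_right)
  then show ?thesis using p(1) cinner_eq_zero_imp by fastforce
qed

lemma basis_expansion:
  assumes "orthonormal_basis E"
  shows "((\<lambda>e. cinner e v *\<^sub>C e) has_sum (v :: 'a::chilbert_space)) E"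
proof (rule orthonormal_expansion)
  fix w assume "\<And>e. e \<in> E \<Longrightarrow> cinner e w = 0"
  then have "w = 0" using assms by (simp add: orthonormal_basis_def)
  then show "cinner w v = 0" by simp
qed (use assms orthonormal_basis_def in blast)

lemma parseval_norm:
  assumes "orthonormal E" "((\<lambda>e. cinner e v *\<^sub>C e) has_sum (v :: 'a::chilbert_space)) E"
  shows "((\<lambda>e. (cmod (cinner e v))\<^sup>2) has_sum (norm v)\<^sup>2) E"
proof -
  have "((\<lambda>e. (norm (cinner e v *\<^sub>C e))\<^sup>2) has_sum (norm v)\<^sup>2) E"
    by (rule has_sum_orthogonal_norm[OF _ assms(2)])
       (simp add: cinner_scaleC_left cinner_scaleC_right orthonormal_neq[OF assms(1)])
  then show ?thesis
    by (rule has_sum_cong[THEN iffD1, rotated]) (simp add: norm_scaleC orthonormal_norm[OF assms(1)])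
qed

lemma basis_parseval:
  assumes "orthonormal_basis E"
  shows "((\<lambda>e. (cmod (cinner e v))\<^sup>2) has_sum (norm (v :: 'a::chilbert_space))\<^sup>2) E"
  using assms by (intro parseval_norm basis_expansion orthonormal_basisD)

section \<open>Bounded and compact operators\<close>

lemma bounded_opsD_scaleC: "X \<in> bounded_ops \<Longrightarrow> X (c *\<^sub>C v) = c *\<^sub>C X v"
  by (simp add: bounded_ops_def clinear_op_def)

lemma bounded_opsD:
  fixes X :: "'a::chilbert_space \<Rightarrow> 'a"
  assumes "X \<in> bounded_ops"
  shows "bounded_linear X"
proof -
  obtain C where "clinear_op X" "\<And>v. norm (X v) \<le> C * norm v"
    using assms by (auto simp: bounded_ops_def cnorm_eq_norm)
  then show ?thesis
    by (intro bounded_linear_intro[where K = C])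
       (auto simp: clinear_op_def scaleR_scaleC mult.commute)
qed

lemma bounded_opsI:
  fixes X :: "'a::chilbert_space \<Rightarrow> 'a"
  assumes "\<And>u v. X (u + v) = X u + X v" "\<And>c v. X (c *\<^sub>C v) = c *\<^sub>C X v"
    and "\<And>v. norm (X v) \<le> C * norm v"
  shows "X \<in> bounded_ops"
  using assms by (auto simp: bounded_ops_def clinear_op_def cnorm_eq_norm)

lemma bounded_ops_bounded_linearI:
  fixes X :: "'a::chilbert_space \<Rightarrow> 'a"
  assumes "bounded_linear X" "\<And>c v. X (c *\<^sub>C v) = c *\<^sub>C X v"
  shows "X \<in> bounded_ops"
  using assms onorm[OF assms(1)]
  by (intro bounded_opsI[where C = "onorm X"]) (auto simp: bounded_linear.linear linear_add)

lemma bounded_ops_comp: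
  "X \<in> bounded_ops \<Longrightarrow> Y \<in> bounded_ops \<Longrightarrow> X \<circ> Y \<in> (bounded_ops :: ('a::chilbert_space \<Rightarrow> 'a) set)"
  by (intro bounded_ops_bounded_linearI) (auto simp: o_def bounded_opsD_scaleC
        intro: bounded_linear_compose bounded_opsD)

lemma bounded_ops_add:
  "X \<in> bounded_ops \<Longrightarrow> Y \<in> bounded_ops \<Longrightarrow> (\<lambda>v. X v + Y v) \<in> (bounded_ops :: ('a::chilbert_space \<Rightarrow> 'a) set)"
  by (rule bounded_ops_bounded_linearI)
     (simp_all add: bounded_opsD_scaleC scaleC_add_right bounded_linear_add bounded_opsD)

lemma bounded_ops_diff:
  "X \<in> bounded_ops \<Longrightarrow> Y \<in> bounded_ops \<Longrightarrow> (\<lambda>v. X v - Y v) \<in> (bounded_ops :: ('a::chilbert_space \<Rightarrow> 'a) set)"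
  by (rule bounded_ops_bounded_linearI)
     (simp_all add: bounded_opsD_scaleC scaleC.diff_right bounded_linear_sub bounded_opsD)

lemma bounded_ops_rank_one:
  "(\<lambda>v. cinner b v *\<^sub>C a) \<in> (bounded_ops :: ('a::chilbert_space \<Rightarrow> 'a) set)"
  by (intro bounded_ops_bounded_linearI)
     (auto simp: cinner_scaleC_right intro!: bounded_linear_compose[OF scaleC.bounded_linear_left]
        cinner.bounded_linear_right)

lemma bounded_opsD_zero: "X \<in> bounded_ops \<Longrightarrow> X 0 = (0 :: 'a::chilbert_space)"
  by (simp add: bounded_opsD linear_simps)

lemma has_sum_bounded_ops:
  "X \<in> bounded_ops \<Longrightarrow> (f has_sum s) A \<Longrightarrow> ((\<lambda>i. X (f i)) has_sum X (s :: 'a::chilbert_space)) A"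
  by (rule has_sum_bounded_linear[OF bounded_opsD, unfolded o_def])

lemma bounded_ops_norm:
  fixes X :: "'a::chilbert_space \<Rightarrow> 'a"
  assumes "X \<in> bounded_ops"
  obtains C where "C > 0" "\<And>v. norm (X v) \<le> C * norm v"
  using bounded_linear.pos_bounded[OF bounded_opsD[OF assms]] by (metis mult.commute)

section \<open>Riesz representation and adjoints\<close>

text \<open>The representing vector is forced to have the coefficients \<open>cnj (f e)\<close>.
  Boundedness of \<open>f\<close> makes them square summable, and expanding \<open>v\<close> then
  identifies \<open>f\<close>.\<close>

lemma riesz_representation:
  fixes f :: "'a::chilbert_space \<Rightarrow> complex"
  assumes f: "bounded_linear f" and scale: "\<And>c v. f (c *\<^sub>C v) = c * f v"
  obtains y where "\<And>v. f v = cinner y v"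
proof -
  obtain E where E: "orthonormal_basis (E :: 'a set)" by (rule orthonormal_basis_exists)
  note oE = orthonormal_basisD[OF E]
  obtain C where C: "C > 0" "\<And>v. cmod (f v) \<le> C * norm v"
    using bounded_linear.pos_bounded[OF f] by (metis mult.commute)
  have "(\<Sum>e\<in>F. (cmod (f e))\<^sup>2) \<le> C\<^sup>2" if F: "finite F" "F \<subseteq> E" for F
  proof -
    define S where "S = (\<Sum>e\<in>F. (cmod (f e))\<^sup>2)"
    have S0: "S \<ge> 0" unfolding S_def by (simp add: sum_nonneg)
    \<comment> \<open>Testing \<open>f\<close> on the truncated candidate gives
      \<open>S \<le> C * sqrt S\<close>, hence \<open>S \<le> C\<^sup>2\<close>.\<close>
    define y where "y = (\<Sum>e\<in>F. cnj (f e) *\<^sub>C e)"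
    have "(norm y)\<^sup>2 = (\<Sum>e\<in>F. (norm (cnj (f e) *\<^sub>C e))\<^sup>2)"
      unfolding y_def using F oE
      by (intro norm_sum_orthogonal)
         (auto simp: cinner_scaleC_left cinner_scaleC_right orthonormal_neq subset_iff)
    also have "\<dots> = S"
      unfolding S_def using F oE by (intro sum.cong) (auto simp: norm_scaleC orthonormal_norm subset_iff)
    finally have y: "(norm y)\<^sup>2 = S" .
    have "f y = (\<Sum>e\<in>F. cnj (f e) * f e)"
      unfolding y_def using f by (simp add: linear_sum bounded_linear.linear scale)
    also have "\<dots> = complex_of_real S"
      unfolding S_def of_real_sum by (intro sum.cong refl) (metis complex_norm_square mult.commute)
    finally have "S \<le> C * norm y" using C(2)[of y] S0 by simp
    then have "S\<^sup>2 \<le> C\<^sup>2 * S" using S0 y by (metis power_mono power_mult_distrib)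
    then show ?thesis using S0 unfolding S_def[symmetric]
      by (cases "S = 0") (auto simp: power2_eq_square)
  qed
  then have "(\<lambda>e. (cmod (f e))\<^sup>2) summable_on E"
    by (intro nonneg_bdd_above_summable_on bdd_aboveI[of _ "C\<^sup>2"]) auto
  then have "(\<lambda>e. (norm (cnj (f e) *\<^sub>C e))\<^sup>2) summable_on E"
    by (rule summable_on_cong[THEN iffD1, rotated]) (simp add: norm_scaleC orthonormal_norm[OF oE])
  then have "(\<lambda>e. cnj (f e) *\<^sub>C e) summable_on E"
    by (intro summable_on_orthogonal)
       (auto simp: cinner_scaleC_left cinner_scaleC_right orthonormal_neq[OF oE])
  then obtain y where y: "((\<lambda>e. cnj (f e) *\<^sub>C e) has_sum y) E" by (auto simp: summable_on_def)
  have "f v = cinner y v" for v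
  proof -
    have "((\<lambda>e. f (cinner e v *\<^sub>C e)) has_sum f v) E"
      by (rule has_sum_bounded_linear[OF f basis_expansion[OF E], unfolded o_def])
    moreover have "((\<lambda>e. cinner (cnj (f e) *\<^sub>C e) v) has_sum cinner y v) E"
      by (rule has_sum_cinner_left[OF y])
    moreover have "f (cinner e v *\<^sub>C e) = cinner (cnj (f e) *\<^sub>C e) v" for e
      by (simp add: scale cinner_scaleC_left)
    ultimately show ?thesis by (metis (no_types, lifting) has_sum_cong has_sum_unique)
  qed
  then show ?thesis using that by blast
qed

lemma cadjoint_unique:
  fixes X :: "'a::chilbert_space \<Rightarrow> 'a"
  assumes "\<And>u v. cinner (Y u) v = cinner u (X v)"
  shows "cadjoint X = Y"
  unfolding cadjoint_def
proof (rule the_equality)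
  fix Z assume Z: "\<forall>u v. cinner (Z u) v = cinner u (X v)"
  show "Z = Y"
  proof (intro ext cinner_ext)
    fix u v
    show "cinner v (Z u) = cinner v (Y u)"
      using Z assms cinner_commute by metis
  qed
qed (use assms in blast)

text \<open>\<open>cadjoint\<close> is a definite description, so an adjoint has to be exhibited
  first. Its value at \<open>u\<close> represents the functional sending \<open>v\<close> to
  \<open>cinner u (X v)\<close>.\<close>

lemma cinner_cadjoint_left:
  fixes X :: "'a::chilbert_space \<Rightarrow> 'a"
  assumes X: "X \<in> bounded_ops"
  shows "cinner (cadjoint X u) v = cinner u (X v)"
proof -
  have "\<exists>y. \<forall>v. cinner u (X v) = cinner y v" for u
    using riesz_representation[of "\<lambda>v. cinner u (X v)"] X
    by (metis bounded_linear_compose[OF cinner.bounded_linear_right bounded_opsD]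
        bounded_opsD_scaleC cinner_scaleC_right)
  then obtain Y where "\<And>u v. cinner u (X v) = cinner (Y u) v" by metis
  then show ?thesis using cadjoint_unique[of Y X] by metis
qed

lemma cinner_cadjoint_right:
  "X \<in> bounded_ops \<Longrightarrow> cinner u (cadjoint X v) = cinner (X u) (v :: 'a::chilbert_space)"
  using cinner_cadjoint_left cinner_commute by metis

lemma cadjoint_bounded:
  fixes X :: "'a::chilbert_space \<Rightarrow> 'a"
  assumes X: "X \<in> bounded_ops"
  shows "cadjoint X \<in> bounded_ops"
proof -
  obtain C where C: "C > 0" "\<And>v. norm (X v) \<le> C * norm v"
    using bounded_ops_norm[OF X] by blast
  have "norm (cadjoint X v) \<le> C * norm v" for v
  proof -
    define w where "w = cadjoint X v"
    have "(norm w)\<^sup>2 = cmod (cinner w (cadjoint X v))"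
      by (simp add: w_def cinner_self norm_power)
    also have "\<dots> = cmod (cinner (X w) v)" by (simp add: cinner_cadjoint_right[OF X])
    also have "\<dots> \<le> norm (X w) * norm v" by (rule Cauchy_Schwarz_cinner)
    also have "\<dots> \<le> C * norm w * norm v" using C by (intro mult_right_mono) auto
    finally have "norm w * norm w \<le> norm w * (C * norm v)" by (simp add: power2_eq_square ac_simps)
    then show ?thesis using C(1) unfolding w_def[symmetric]
      by (cases "w = 0") (auto simp: mult_le_cancel_left)
  qed
  then show ?thesis
    by (intro bounded_opsI[where C = C] cinner_ext)
       (auto simp: cinner_cadjoint_right[OF X] cinner_add_right cinner_scaleC_right)
qed

lemma cadjoint_cadjoint [simp]:
  "X \<in> bounded_ops \<Longrightarrow> cadjoint (cadjoint X) = (X :: 'a::chilbert_space \<Rightarrow> 'a)"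
  by (rule cadjoint_unique) (simp add: cinner_cadjoint_right)

lemma cadjoint_comp:
  fixes X :: "'a::chilbert_space \<Rightarrow> 'a"
  assumes "X \<in> bounded_ops" "Y \<in> bounded_ops"
  shows "cadjoint (X \<circ> Y) = cadjoint Y \<circ> cadjoint X"
  by (rule cadjoint_unique) (simp add: assms cinner_cadjoint_left)

lemma has_sum_norm_le:
  fixes f :: "'i \<Rightarrow> 'a::real_normed_vector"
  assumes "(f has_sum s) A" "\<And>F. finite F \<Longrightarrow> F \<subseteq> A \<Longrightarrow> norm (sum f F) \<le> B"
  shows "norm s \<le> B"
proof (rule tendsto_upperbound)
  show "((\<lambda>F. norm (sum f F)) \<longlongrightarrow> norm s) (finite_subsets_at_top A)"
    using assms(1) unfolding has_sum_def by (rule tendsto_norm)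
  show "\<forall>\<^sub>F F in finite_subsets_at_top A. norm (sum f F) \<le> B"
    by (rule eventually_finite_subsets_at_top_weakI) (use assms(2) in blast)
qed simp

section \<open>Compactness criteria\<close>

lemma compact_ops_iff:
  "X \<in> compact_ops \<longleftrightarrow> X \<in> bounded_ops \<and> (\<forall>v :: nat \<Rightarrow> 'a::chilbert_space. (\<exists>C. \<forall>n. norm (v n) \<le> C) \<longrightarrow>
     (\<exists>l r. strict_mono (r :: nat \<Rightarrow> nat) \<and> (\<lambda>n. X (v (r n))) \<longlonglongrightarrow> l))"
  unfolding compact_ops_def by (simp add: cnorm_eq_norm LIM_zero_iff tendsto_norm_zero_iff)

lemma compact_ops_bounded: "X \<in> compact_ops \<Longrightarrow> X \<in> bounded_ops"
  by (simp add: compact_ops_def)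

lemma compact_opsE:
  fixes v :: "nat \<Rightarrow> 'a::chilbert_space"
  assumes "X \<in> compact_ops" "\<And>n. norm (v n) \<le> C"
  obtains l r where "strict_mono (r :: nat \<Rightarrow> nat)" "(\<lambda>n. X (v (r n))) \<longlonglongrightarrow> l"
  using assms unfolding compact_ops_iff by blast

lemma compact_ops_add:
  fixes X :: "'a::chilbert_space \<Rightarrow> 'a"
  assumes X: "X \<in> compact_ops" and Y: "Y \<in> compact_ops"
  shows "(\<lambda>v. X v + Y v) \<in> compact_ops"
  unfolding compact_ops_iff
proof (intro conjI allI impI)
  fix v :: "nat \<Rightarrow> 'a" assume "\<exists>C. \<forall>n. norm (v n) \<le> C"
  then obtain C where C: "\<And>n. norm (v n) \<le> C" by blast
  obtain l r where r: "strict_mono (r :: nat \<Rightarrow> nat)" "(\<lambda>n. X (v (r n))) \<longlonglongrightarrow> l"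
    using compact_opsE[OF X, of v] C by blast
  obtain l' r' where r': "strict_mono (r' :: nat \<Rightarrow> nat)" "(\<lambda>n. Y (v (r (r' n)))) \<longlonglongrightarrow> l'"
    using compact_opsE[OF Y, of "\<lambda>n. v (r n)"] C by blast
  have "(\<lambda>n. X (v (r (r' n)))) \<longlonglongrightarrow> l"
    using LIMSEQ_subseq_LIMSEQ[OF r(2) r'(1)] by (simp add: o_def)
  then have "(\<lambda>n. X (v ((r \<circ> r') n)) + Y (v ((r \<circ> r') n))) \<longlonglongrightarrow> l + l'"
    using r'(2) by (auto intro: tendsto_add)
  then show "\<exists>l r. strict_mono (r :: nat \<Rightarrow> nat) \<and> (\<lambda>n. X (v (r n)) + Y (v (r n))) \<longlonglongrightarrow> l"
    using strict_mono_o[OF r(1) r'(1)] by blast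
qed (use assms compact_ops_bounded bounded_ops_add in blast)

lemma compact_ops_rank_one:
  fixes a b :: "'a::chilbert_space"
  shows "(\<lambda>v. cinner b v *\<^sub>C a) \<in> compact_ops"
  unfolding compact_ops_iff
proof (intro conjI allI impI bounded_ops_rank_one)
  fix v :: "nat \<Rightarrow> 'a" assume "\<exists>C. \<forall>n. norm (v n) \<le> C"
  then obtain C where C: "\<And>n. norm (v n) \<le> C" by blast
  have "cinner b (v n) \<in> cball 0 (norm b * C)" for n
    using Cauchy_Schwarz_cinner[of b "v n"] mult_left_mono[OF C, of "norm b" n] by simp
  then obtain l r where r: "strict_mono (r :: nat \<Rightarrow> nat)" "((\<lambda>n. cinner b (v n)) \<circ> r) \<longlonglongrightarrow> l"
    using seq_compactE[of "cball 0 (norm b * C) :: complex set" "\<lambda>n. cinner b (v n)"]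
    by (metis compact_cball compact_imp_seq_compact)
  then have "(\<lambda>n. cinner b (v (r n)) *\<^sub>C a) \<longlonglongrightarrow> l *\<^sub>C a"
    by (auto simp: o_def intro!: scaleC.tendsto tendsto_const)
  then show "\<exists>l r. strict_mono (r :: nat \<Rightarrow> nat) \<and> (\<lambda>n. cinner b (v (r n)) *\<^sub>C a) \<longlonglongrightarrow> l"
    using r(1) by blast
qed

lemma compact_ops_zero: "(\<lambda>_. 0) \<in> (compact_ops :: ('a::chilbert_space \<Rightarrow> 'a) set)"
  using compact_ops_rank_one[of "0 :: 'a" 0] by simp

lemma compact_ops_finite_rank:
  fixes a b :: "'i \<Rightarrow> 'a::chilbert_space"
  shows "finite F \<Longrightarrow> (\<lambda>v. \<Sum>i\<in>F. cinner (b i) v *\<^sub>C a i) \<in> compact_ops"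
proof (induction F rule: finite_induct)
  case (insert i F)
  then show ?case using compact_ops_add[OF compact_ops_rank_one insert(3), of "b i" "a i"] by simp
qed (simp add: compact_ops_zero)

text \<open>Approximants \<open>K\<close> for different \<open>\<epsilon>\<close> ask for different
  subsequences, so a diagonal subsequence is taken.\<close>

lemma compact_ops_limit:
  fixes X :: "'a::chilbert_space \<Rightarrow> 'a"
  assumes X: "X \<in> bounded_ops"
    and K: "\<And>\<epsilon>. \<epsilon> > 0 \<Longrightarrow> \<exists>K\<in>compact_ops. \<forall>v. norm (X v - K v) \<le> \<epsilon> * norm v"
  shows "X \<in> compact_ops"
  unfolding compact_ops_iff
proof (intro conjI allI impI X)
  fix v :: "nat \<Rightarrow> 'a" assume "\<exists>C. \<forall>n. norm (v n) \<le> C"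
  then obtain C0 where "\<And>n. norm (v n) \<le> C0" by blast
  then obtain C where C: "C > 0" "\<And>n. norm (v n) \<le> C"
    by (meson le_less_trans less_add_one norm_ge_zero order_less_imp_le order_trans)
  \<comment> \<open>\<open>P n s\<close> says that along \<open>s\<close> the images under
    \<open>X\<close> stay within \<open>1 / Suc n\<close> of each other. Quantifying over all
    indices, and not just over large ones, makes the property stable under passing to subsequences,
    as the diagonal argument requires.\<close>
  define P where "P n s \<longleftrightarrow> (\<forall>i j. dist (X (v (s i))) (X (v (s j))) < 1 / real (Suc n))"
    for n and s :: "nat \<Rightarrow> nat"
  interpret subseqs P
  proof
    fix n and s :: "nat \<Rightarrow> nat" assume s: "strict_mono s"
    \<comment> \<open>A quarter of the tolerance: each image under \<open>X\<close> is at most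
      \<open>d\<close> away from the image under \<open>K\<close>, which is eventually less than
      \<open>d\<close> away from \<open>l\<close>, so two images under \<open>X\<close> differ by
      less than \<open>4 * d\<close>.\<close>
    define d where "d = 1 / real (Suc n) / 4"
    have d: "d > 0" and d4: "2 * d + 2 * d = 1 / real (Suc n)"
      unfolding d_def by (simp, linarith)
    obtain K where K: "K \<in> compact_ops" "\<And>v. norm (X v - K v) \<le> d / C * norm v"
      using K[of "d / C"] d C by auto
    have close: "dist (X (v i)) (K (v i)) \<le> d" for i
      using order_trans[OF K(2)[of "v i"] mult_left_mono[OF C(2)[of i], of "d / C"]] d C
      by (simp add: dist_norm)
    obtain l r where r: "strict_mono (r :: nat \<Rightarrow> nat)" "(\<lambda>n. K (v (s (r n)))) \<longlonglongrightarrow> l"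
      using compact_opsE[OF K(1), of "\<lambda>n. v (s n)" C] C(2) by blast
    then obtain N where N: "\<And>m. m \<ge> N \<Longrightarrow> dist (K (v (s (r m)))) l < d"
      using d unfolding lim_sequentially by blast
    have "dist (X (v (s (r (i + N))))) l < 2 * d" for i
      using dist_triangle[of "X (v (s (r (i + N))))" l "K (v (s (r (i + N))))"] close N[of "i + N"]
      by (smt (verit) le_add2)
    then have "dist (X (v (s (r (i + N))))) (X (v (s (r (j + N))))) < 2 * d + 2 * d" for i j
      using dist_triangle2[of "X (v (s (r (i + N))))" "X (v (s (r (j + N))))" l]
      by (smt (verit))
    then have "P n (s \<circ> (\<lambda>i. r (i + N)))"
      unfolding P_def o_def using d4 by simp
    moreover have "strict_mono (\<lambda>i. r (i + N))"
      using r(1) by (simp add: strict_mono_def)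
    ultimately show "\<exists>r'. strict_mono r' \<and> P n (s \<circ> r')" by blast
  qed
  have PD: "P k (diagseq \<circ> ((+) (Suc k)))" for k
    by (rule diagseq_holds) (auto simp: P_def)
  have "Cauchy (\<lambda>n. X (v (diagseq n)))"
    unfolding Cauchy_def
  proof (intro allI impI)
    fix e :: real assume "e > 0"
    then obtain k where k: "1 / real (Suc k) < e" using nat_approx_posE by blast
    have "dist (X (v (diagseq m))) (X (v (diagseq n))) < e" if "m \<ge> Suc k" "n \<ge> Suc k" for m n
    proof -
      obtain i j where ij: "m = Suc k + i" "n = Suc k + j" using \<open>m \<ge> Suc k\<close> \<open>n \<ge> Suc k\<close> le_Suc_ex by meson
      have "dist (X (v (diagseq m))) (X (v (diagseq n))) < 1 / real (Suc k)"
        unfolding ij using PD[of k] unfolding P_def[of k] o_def by blast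
      then show ?thesis using k by (rule order_less_trans)
    qed
    then show "\<exists>M. \<forall>m\<ge>M. \<forall>n\<ge>M. dist (X (v (diagseq m))) (X (v (diagseq n))) < e" by blast
  qed
  then obtain l where "(\<lambda>n. X (v (diagseq n))) \<longlonglongrightarrow> l"
    using Cauchy_convergent convergent_def by blast
  then show "\<exists>l r. strict_mono (r :: nat \<Rightarrow> nat) \<and> (\<lambda>n. X (v (r n))) \<longlonglongrightarrow> l"
    using subseq_diagseq by blast
qed

text \<open>The finite partial sums approximate \<open>X\<close> in norm because the tails are small
  uniformly in \<open>v\<close>. The compactness criteria built on this differ only in how they
  bound the tails: orthogonality, square summability, or summability of norms.\<close>

lemma compact_ops_rank_one_sum:
  fixes X :: "'a::chilbert_space \<Rightarrow> 'a"
  assumes X: "X \<in> bounded_ops"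
    and sum: "\<And>v. ((\<lambda>i. cinner (b i) v *\<^sub>C a i) has_sum X v) I"
    and tail: "\<And>\<epsilon>. \<epsilon> > 0 \<Longrightarrow> \<exists>F. finite F \<and> F \<subseteq> I \<and> (\<forall>G v. finite G \<and> G \<subseteq> I - F \<longrightarrow>
        norm (\<Sum>i\<in>G. cinner (b i) v *\<^sub>C a i) \<le> \<epsilon> * norm v)"
  shows "X \<in> compact_ops"
proof (rule compact_ops_limit[OF X])
  fix \<epsilon> :: real assume "\<epsilon> > 0"
  then obtain F where F: "finite F" "F \<subseteq> I"
    "\<And>G v. finite G \<Longrightarrow> G \<subseteq> I - F \<Longrightarrow> norm (\<Sum>i\<in>G. cinner (b i) v *\<^sub>C a i) \<le> \<epsilon> * norm v"
    using tail by meson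
  define K where "K v = (\<Sum>i\<in>F. cinner (b i) v *\<^sub>C a i)" for v
  have "norm (X v - K v) \<le> \<epsilon> * norm v" for v
  proof (rule has_sum_norm_le)
    show "((\<lambda>i. cinner (b i) v *\<^sub>C a i) has_sum (X v - K v)) (I - F)"
      unfolding K_def using F by (intro has_sum_Diff sum has_sum_finite) auto
  qed (use F in blast)
  moreover have "K \<in> compact_ops"
    unfolding K_def[abs_def] by (rule compact_ops_finite_rank[OF F(1)])
  ultimately show "\<exists>K\<in>compact_ops. \<forall>v. norm (X v - K v) \<le> \<epsilon> * norm v" by blast
qed

lemma bounded_ops_expansion:
  fixes X :: "'a::chilbert_space \<Rightarrow> 'a"
  assumes X: "X \<in> bounded_ops" and E: "orthonormal E"
    and "\<And>w. (\<And>e. e \<in> E \<Longrightarrow> cinner e w = 0) \<Longrightarrow> X w = 0"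
  shows "((\<lambda>e. cinner e v *\<^sub>C X e) has_sum X v) E"
proof -
  obtain p where p: "((\<lambda>e. cinner e v *\<^sub>C e) has_sum p) E" "\<And>e. e \<in> E \<Longrightarrow> cinner e (v - p) = 0"
    using orthonormal_projection[OF E, of v] by blast
  have "X (v - p) = 0" using assms(3) p(2) by blast
  then have "X v = X p" using bounded_opsD[OF X] by (simp add: linear_simps)
  then show ?thesis using has_sum_bounded_ops[OF X p(1)] by (simp add: bounded_opsD_scaleC[OF X])
qed

text \<open>Orthogonality of the images and Bessel bound a tail by the largest
  \<open>norm (X e)\<close> in it times \<open>norm v\<close>. Removing the finitely many
  \<open>e\<close> with image of norm at least \<open>\<epsilon>\<close> makes this small.\<close>

lemma compact_ops_orthogonal:
  fixes X :: "'a::chilbert_space \<Rightarrow> 'a"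
  assumes X: "X \<in> bounded_ops" and E: "orthonormal E"
    and vanish: "\<And>w. (\<And>e. e \<in> E \<Longrightarrow> cinner e w = 0) \<Longrightarrow> X w = 0"
    and orth: "\<And>e f. e \<in> E \<Longrightarrow> f \<in> E \<Longrightarrow> e \<noteq> f \<Longrightarrow> cinner (X e) (X f) = 0"
    and fin: "\<And>\<delta>. \<delta> > 0 \<Longrightarrow> finite {e \<in> E. norm (X e) \<ge> \<delta>}"
  shows "X \<in> compact_ops"
proof (rule compact_ops_rank_one_sum[OF X bounded_ops_expansion[OF X E vanish]])
  fix \<epsilon> :: real assume \<epsilon>: "\<epsilon> > 0"
  have "norm (\<Sum>e\<in>G. cinner e v *\<^sub>C X e) \<le> \<epsilon> * norm v"
    if G: "finite G" "G \<subseteq> E - {e \<in> E. norm (X e) \<ge> \<epsilon>}" for G v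
  proof -
    have "(norm (\<Sum>e\<in>G. cinner e v *\<^sub>C X e))\<^sup>2 = (\<Sum>e\<in>G. (norm (cinner e v *\<^sub>C X e))\<^sup>2)"
      using G orth by (intro norm_sum_orthogonal) (auto simp: cinner_scaleC_left cinner_scaleC_right subset_iff)
    also have "\<dots> \<le> (\<Sum>e\<in>G. \<epsilon>\<^sup>2 * (cmod (cinner e v))\<^sup>2)"
      unfolding norm_scaleC power_mult_distrib mult.commute[of "\<epsilon>\<^sup>2"]
      using G \<epsilon> by (intro sum_mono mult_left_mono power_mono) auto
    also have "\<dots> \<le> \<epsilon>\<^sup>2 * (norm v)\<^sup>2"
      unfolding sum_distrib_left[symmetric] using bessel_finite(1)[OF E, of G v] G
      by (intro mult_left_mono) auto
    finally show ?thesis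
      using \<epsilon> power2_le_imp_le[of "norm (\<Sum>e\<in>G. cinner e v *\<^sub>C X e)" "\<epsilon> * norm v"]
      by (simp add: power_mult_distrib)
  qed
  then show "\<exists>F. finite F \<and> F \<subseteq> E \<and> (\<forall>G v. finite G \<and> G \<subseteq> E - F \<longrightarrow>
      norm (\<Sum>e\<in>G. cinner e v *\<^sub>C X e) \<le> \<epsilon> * norm v)"
    using fin[OF \<epsilon>] by (intro exI[of _ "{e \<in> E. norm (X e) \<ge> \<epsilon>}"]) blast
qed

text \<open>The images \<open>X e\<close> may fail to be orthogonal here. Cauchy-Schwarz bounds a
  tail by the l2 norm of its images, and Bessel takes care of the coefficients.\<close>

lemma compact_ops_square_summable:
  fixes X :: "'a::chilbert_space \<Rightarrow> 'a"
  assumes X: "X \<in> bounded_ops" and E: "orthonormal_basis E"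
    and s: "(\<lambda>e. (norm (X e))\<^sup>2) summable_on E"
  shows "X \<in> compact_ops"
proof (rule compact_ops_rank_one_sum[OF X])
  note oE = orthonormal_basisD[OF E]
  show "((\<lambda>e. cinner e v *\<^sub>C X e) has_sum X v) E" for v
    using has_sum_bounded_ops[OF X basis_expansion[OF E, of v]] by (simp add: bounded_opsD_scaleC[OF X])
  fix \<epsilon> :: real assume \<epsilon>: "\<epsilon> > 0"
  obtain F where F: "finite F" "F \<subseteq> E"
    "\<And>G. finite G \<Longrightarrow> G \<subseteq> E \<Longrightarrow> G \<inter> F = {} \<Longrightarrow> (\<Sum>e\<in>G. (norm (X e))\<^sup>2) < \<epsilon>\<^sup>2"
    using summable_on_tail[OF s zero_le_power2, of "\<epsilon>\<^sup>2"] \<epsilon> by (metis zero_less_power)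
  have "norm (\<Sum>e\<in>G. cinner e v *\<^sub>C X e) \<le> \<epsilon> * norm v"
    if G: "finite G" "G \<subseteq> E - F" for G v
  proof -
    have "norm (\<Sum>e\<in>G. cinner e v *\<^sub>C X e) \<le> (\<Sum>e\<in>G. cmod (cinner e v) * norm (X e))"
      by (rule sum_norm_le) (simp add: norm_scaleC)
    also have "\<dots> \<le> L2_set (\<lambda>e. cmod (cinner e v)) G * L2_set (\<lambda>e. norm (X e)) G"
      using L2_set_mult_ineq[of "\<lambda>e. cmod (cinner e v)" "\<lambda>e. norm (X e)" G] by simp
    also have "\<dots> \<le> norm v * \<epsilon>"
    proof (intro mult_mono)
      have "(\<Sum>e\<in>G. (norm (X e))\<^sup>2) < \<epsilon>\<^sup>2" using G F(3)[of G] by blast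
      then show "L2_set (\<lambda>e. norm (X e)) G \<le> \<epsilon>"
        unfolding L2_set_def using \<epsilon> by (intro real_le_lsqrt) (auto simp: sum_nonneg)
      show "L2_set (\<lambda>e. cmod (cinner e v)) G \<le> norm v"
        unfolding L2_set_def using bessel_finite(1)[OF oE, of G v] G
        by (intro real_le_lsqrt) (auto simp: sum_nonneg)
    qed auto
    finally show ?thesis by (simp add: mult.commute)
  qed
  then show "\<exists>F. finite F \<and> F \<subseteq> E \<and> (\<forall>G v. finite G \<and> G \<subseteq> E - F \<longrightarrow>
      norm (\<Sum>e\<in>G. cinner e v *\<^sub>C X e) \<le> \<epsilon> * norm v)"
    using F(1,2) by (intro exI[of _ F]) simp
qed

section \<open>Singular value decomposition\<close>

lemma cinner_eq_0_commute: "cinner x y = 0 \<longleftrightarrow> cinner y x = (0 :: complex)"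
  for x y :: "'a::chilbert_space"
  by (metis cinner_commute complex_cnj_zero)

text \<open>
  A right singular system of \<open>X\<close>: an orthonormal basis of the complement of \<open>ker X\<close> consisting of
  eigenvectors of \<open>X\<^sup>* X\<close>. The singular value belonging to \<open>e\<close> is \<open>norm (X e)\<close>.
\<close>

definition sv_system :: "('a::chilbert_space \<Rightarrow> 'a) \<Rightarrow> 'a set \<Rightarrow> bool" where
  "sv_system X E \<longleftrightarrow> orthonormal E \<and>
     (\<forall>e\<in>E. X e \<noteq> 0 \<and> cadjoint X (X e) = complex_of_real ((norm (X e))\<^sup>2) *\<^sub>C e) \<and>
     (\<forall>w. (\<forall>e\<in>E. cinner e w = 0) \<longrightarrow> X w = 0)"

lemma sv_system_orthonormal: "sv_system X E \<Longrightarrow> orthonormal E"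
  by (simp add: sv_system_def)

lemma sv_system_nonzero: "sv_system X E \<Longrightarrow> e \<in> E \<Longrightarrow> X e \<noteq> 0"
  by (simp add: sv_system_def)

lemma sv_system_eigen:
  "sv_system X E \<Longrightarrow> e \<in> E \<Longrightarrow> cadjoint X (X e) = complex_of_real ((norm (X e))\<^sup>2) *\<^sub>C e"
  by (simp add: sv_system_def)

lemma sv_system_vanish: "sv_system X E \<Longrightarrow> (\<And>e. e \<in> E \<Longrightarrow> cinner e w = 0) \<Longrightarrow> X w = 0"
  by (simp add: sv_system_def)

lemma sv_system_cinner_image:
  assumes X: "X \<in> bounded_ops" and E: "sv_system X E" and e: "e \<in> E"
  shows "cinner (X e) (X w) = complex_of_real ((norm (X e))\<^sup>2) * cinner e w"
proof -
  have "cinner (X e) (X w) = cinner (cadjoint X (X e)) w" by (simp add: cinner_cadjoint_left[OF X])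
  then show ?thesis by (simp add: sv_system_eigen[OF E e] cinner_scaleC_left)
qed

lemma sv_system_image_orthogonal:
  assumes "X \<in> bounded_ops" "sv_system X E" "e \<in> E" "f \<in> E" "e \<noteq> f"
  shows "cinner (X e) (X f) = 0"
  using assms by (simp add: sv_system_cinner_image orthonormal_neq[OF sv_system_orthonormal])

lemma sv_system_expansion:
  assumes "X \<in> bounded_ops" "sv_system X E"
  shows "((\<lambda>e. cinner e v *\<^sub>C X e) has_sum X v) E"
  using assms by (intro bounded_ops_expansion sv_system_orthonormal sv_system_vanish[of X E])

section \<open>Existence of singular systems and passage to the adjoint\<close>

text \<open>A maximal orthonormal set \<open>M\<close> of eigenvectors with non-zero image is the
  system. If \<open>X\<close> did not vanish on the complement of \<open>M\<close>, then
  \<open>norm (X w)\<close> over unit vectors \<open>w\<close> there would have a positive supremum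
  \<open>m\<close>. Compactness makes it attained, and a maximizer satisfies \<open>Q\<close> with
  eigenvalue \<open>m\<^sup>2\<close>, against maximality.\<close>

lemma sv_system_exists:
  fixes X :: "'a::chilbert_space \<Rightarrow> 'a"
  assumes X: "X \<in> compact_ops"
  obtains E where "sv_system X E"
proof -
  note bX = compact_ops_bounded[OF X]
  define Q where "Q v \<longleftrightarrow> X v \<noteq> 0 \<and> cadjoint X (X v) = complex_of_real ((norm (X v))\<^sup>2) *\<^sub>C v" for v
  obtain M where M: "orthonormal M" "M \<subseteq> Collect Q"
    "\<And>v. norm v = 1 \<Longrightarrow> Q v \<Longrightarrow> \<forall>e\<in>M. cinner e v = 0 \<Longrightarrow> False"
    using maximal_orthonormal[OF orthonormal_empty, of Q] by auto
  have "X w0 = 0" if w0: "\<forall>e\<in>M. cinner e w0 = 0" for w0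
  proof (rule ccontr)
    assume nz: "X w0 \<noteq> 0"
    define W where "W = {w. \<forall>e\<in>M. cinner e w = 0}"
    define S where "S = (\<lambda>w. norm (X w)) ` {w \<in> W. norm w = 1}"
    define m where "m = Sup S"
    define A where "A w = cadjoint X (X w)" for w
    have cA: "cadjoint X \<in> bounded_ops" by (rule cadjoint_bounded[OF bX])
    obtain C where C: "C > 0" "\<And>v. norm (X v) \<le> C * norm v" using bounded_ops_norm[OF bX] by blast
    have bdd: "bdd_above S" unfolding S_def using C by (intro bdd_aboveI[of _ C]) (auto, metis mult.right_neutral)
    have W_scale: "c *\<^sub>C w \<in> W" if "w \<in> W" for c w
      using that by (simp add: W_def cinner_scaleC_right)
    have le_m: "norm (X w) \<le> m * norm w" if "w \<in> W" for w
    proof (cases "w = 0")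
      case True
      then show ?thesis using bounded_opsD_zero[OF bX] by simp
    next
      case False
      define u where "u = complex_of_real (inverse (norm w)) *\<^sub>C w"
      have "norm (X u) \<in> S" using unit_vector[OF False] W_scale[OF that] by (auto simp: S_def u_def)
      then have "norm (X u) \<le> m" unfolding m_def by (rule cSup_upper[OF _ bdd])
      also have "norm (X u) = inverse (norm w) * norm (X w)"
        by (simp add: u_def bounded_opsD_scaleC[OF bX] norm_scaleC norm_inverse)
      finally show ?thesis using False by (simp add: field_simps)
    qed
    have "w0 \<in> W" using w0 by (simp add: W_def)
    have "w0 \<noteq> 0" using nz bounded_opsD_zero[OF bX] by auto
    have "0 < norm (X w0)" using nz by simp
    then have m0: "m > 0"
      using le_m[OF \<open>w0 \<in> W\<close>] \<open>w0 \<noteq> 0\<close>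
      by (smt (verit) mult_nonpos_nonneg norm_ge_zero)
    have ne: "S \<noteq> {}"
      using unit_vector[OF \<open>w0 \<noteq> 0\<close>] W_scale[OF \<open>w0 \<in> W\<close>] by (auto simp: S_def)
    have "\<exists>w\<in>W. norm w = 1 \<and> norm (X w) > m - 1 / real (Suc n)" for n
    proof -
      have "m - 1 / real (Suc n) < Sup S" by (simp add: m_def)
      then show ?thesis using less_cSup_iff[OF ne bdd] unfolding S_def by auto
    qed
    then obtain w where w: "\<And>n. w n \<in> W" "\<And>n. norm (w n) = 1"
      "\<And>n. norm (X (w n)) > m - 1 / real (Suc n)" by metis
    obtain l r where r: "strict_mono (r :: nat \<Rightarrow> nat)" "(\<lambda>n. X (w (r n))) \<longlonglongrightarrow> l"
      using compact_opsE[OF X, of w 1] w(2) by (metis order_refl)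
    have Alim: "(\<lambda>n. A (w (r n))) \<longlonglongrightarrow> cadjoint X l"
      unfolding A_def by (rule bounded_linear.tendsto[OF bounded_opsD[OF cA] r(2)])
    \<comment> \<open>The complement of a set of eigenvectors is invariant under the self-adjoint
      \<open>A\<close>, so \<open>le_m\<close> also applies to \<open>A v\<close> in the next
      bound.\<close>
    have A_W: "A v \<in> W" if "v \<in> W" for v
      unfolding W_def
    proof (safe)
      fix e assume e: "e \<in> M"
      have "cinner e (A v) = cinner (X e) (X v)" unfolding A_def by (simp add: cinner_cadjoint_right[OF bX])
      also have "\<dots> = cinner (cadjoint X (X e)) v" by (simp add: cinner_cadjoint_left[OF bX])
      also have "\<dots> = 0" using M(2) e that by (auto simp: Q_def W_def cinner_scaleC_left)
      finally show "cinner e (A v) = 0" .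
    qed
    have A_le: "norm (A v) \<le> m\<^sup>2 * norm v" if "v \<in> W" for v
    proof -
      have "norm (A v) * norm (A v) = cmod (cinner (A v) (A v))"
        by (simp add: cinner_self norm_power power2_eq_square norm_mult)
      also have "\<dots> = cmod (cinner (X (A v)) (X v))"
        using cinner_cadjoint_right[OF bX, of "A v" "X v"] by (simp add: A_def)
      also have "\<dots> \<le> norm (X (A v)) * norm (X v)" by (rule Cauchy_Schwarz_cinner)
      also have "\<dots> \<le> (m * norm (A v)) * (m * norm v)"
        using le_m[OF that] le_m[OF A_W[OF that]] m0 by (intro mult_mono) auto
      finally have "norm (A v) * norm (A v) \<le> norm (A v) * (m\<^sup>2 * norm v)"
        by (simp add: power2_eq_square ac_simps)
      then show ?thesis by (cases "A v = 0") (auto simp: mult_le_cancel_left)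
    qed
    \<comment> \<open>The maximizing sequence consists of approximate eigenvectors for the eigenvalue \<open>m\<^sup>2\<close>.\<close>
    have approx: "(norm (A (w n) - complex_of_real (m\<^sup>2) *\<^sub>C w n))\<^sup>2 \<le> 2 * m ^ 4 - 2 * m\<^sup>2 * (norm (X (w n)))\<^sup>2" for n
    proof -
      have "cinner (A (w n)) (w n) = complex_of_real ((norm (X (w n)))\<^sup>2)"
        unfolding A_def by (simp add: cinner_cadjoint_left[OF bX] cinner_self)
      moreover have "(norm (A (w n)))\<^sup>2 \<le> m ^ 4"
        using power_mono[OF A_le[OF w(1)[of n]], of 2] w(2)[of n] by simp
      moreover have "(norm (A (w n) + complex_of_real (- (m\<^sup>2)) *\<^sub>C w n))\<^sup>2 =
          (norm (A (w n)))\<^sup>2 + m ^ 4 + 2 * Re (complex_of_real (- (m\<^sup>2)) * cinner (A (w n)) (w n))"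
        unfolding norm_add_sq norm_scaleC cinner_scaleC_right using w(2)[of n]
        by (simp add: norm_power power_mult_distrib flip: power_mult)
      ultimately show ?thesis by (simp add: scaleC.minus_left)
    qed
    have "(\<lambda>n. norm (X (w n))) \<longlonglongrightarrow> m"
    proof (rule tendsto_sandwich)
      show "\<forall>\<^sub>F n in sequentially. m - 1 / real (Suc n) \<le> norm (X (w n))"
        using w(3) by (intro always_eventually allI less_imp_le)
      show "\<forall>\<^sub>F n in sequentially. norm (X (w n)) \<le> m"
        using le_m[OF w(1)] w(2) by simp
      show "(\<lambda>n. m - 1 / real (Suc n)) \<longlonglongrightarrow> m"
        using tendsto_diff[OF tendsto_const[of m] LIMSEQ_inverse_real_of_nat] by (simp add: inverse_eq_divide)
    qed simp
    then have "(\<lambda>n. 2 * m ^ 4 - 2 * m\<^sup>2 * (norm (X (w n)))\<^sup>2) \<longlonglongrightarrow> 2 * m ^ 4 - 2 * m\<^sup>2 * m\<^sup>2"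
      by (intro tendsto_intros)
    moreover have "2 * m ^ 4 - 2 * m\<^sup>2 * m\<^sup>2 = 0" by (simp add: power2_eq_square power4_eq_xxxx)
    ultimately have lim0: "(\<lambda>n. 2 * m ^ 4 - 2 * m\<^sup>2 * (norm (X (w n)))\<^sup>2) \<longlonglongrightarrow> 0"
      by metis
    have "(\<lambda>n. (norm (A (w n) - complex_of_real (m\<^sup>2) *\<^sub>C w n))\<^sup>2) \<longlonglongrightarrow> 0"
      by (rule tendsto_sandwich[OF _ _ tendsto_const lim0]) (use approx in auto)
    then have "(\<lambda>n. sqrt ((norm (A (w n) - complex_of_real (m\<^sup>2) *\<^sub>C w n))\<^sup>2)) \<longlonglongrightarrow> sqrt 0"
      by (rule tendsto_real_sqrt)
    then have "(\<lambda>n. A (w n) - complex_of_real (m\<^sup>2) *\<^sub>C w n) \<longlonglongrightarrow> 0"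
      by (simp add: tendsto_norm_zero_iff)
    then have "(\<lambda>n. A (w (r n)) - complex_of_real (m\<^sup>2) *\<^sub>C w (r n)) \<longlonglongrightarrow> 0"
      using LIMSEQ_subseq_LIMSEQ[OF _ r(1)] by (auto simp: o_def)
    \<comment> \<open>Compactness controls only \<open>X (w (r n))\<close>. But
      \<open>A (w (r n))\<close> converges and differs from \<open>m\<^sup>2\<close> times
      \<open>w (r n)\<close> by a null sequence, so the vectors \<open>w (r n)\<close> themselves
      converge; \<open>m > 0\<close> permits the division.\<close>
    from tendsto_diff[OF Alim this]
    have "(\<lambda>n. complex_of_real (m\<^sup>2) *\<^sub>C w (r n)) \<longlonglongrightarrow> cadjoint X l" by simp
    from scaleC.tendsto[OF tendsto_const[of "complex_of_real (inverse (m\<^sup>2))"] this]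
    have "(\<lambda>n. w (r n)) \<longlonglongrightarrow> complex_of_real (inverse (m\<^sup>2)) *\<^sub>C cadjoint X l"
      using m0 by (simp flip: of_real_mult of_real_power of_real_inverse)
    then obtain v where v: "(\<lambda>n. w (r n)) \<longlonglongrightarrow> v" "v = complex_of_real (inverse (m\<^sup>2)) *\<^sub>C cadjoint X l" by blast
    have norm_v: "norm v = 1"
      using LIMSEQ_unique[OF tendsto_norm[OF v(1)]] w(2) by simp
    have "cinner e v = 0" if "e \<in> M" for e
    proof -
      have "(\<lambda>n. cinner e (w (r n))) \<longlonglongrightarrow> cinner e v" by (intro cinner.tendsto tendsto_const v(1))
      moreover have "cinner e (w (r n)) = 0" for n using w(1)[of "r n"] that by (simp add: W_def)
      ultimately show ?thesis by (simp add: LIMSEQ_const_iff)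
    qed
    moreover have "Q v"
    proof -
      have "(\<lambda>n. A (w (r n))) \<longlonglongrightarrow> A v"
        unfolding A_def
        by (rule bounded_linear.tendsto[OF bounded_opsD[OF cA] bounded_linear.tendsto[OF bounded_opsD[OF bX] v(1)]])
      then have "A v = cadjoint X l" using Alim LIMSEQ_unique by blast
      also have "\<dots> = complex_of_real (m\<^sup>2) *\<^sub>C v"
        unfolding v(2) using m0 by (simp flip: of_real_mult of_real_power of_real_inverse)
      finally have Av: "A v = complex_of_real (m\<^sup>2) *\<^sub>C v" .
      have "complex_of_real ((norm (X v))\<^sup>2) = cinner v (A v)"
        unfolding A_def by (simp add: cinner_cadjoint_right[OF bX] cinner_self)
      then have "(norm (X v))\<^sup>2 = m\<^sup>2"
        using norm_v by (simp only: Av cinner_scaleC_right cinner_self) (simp flip: of_real_power)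
      then show ?thesis using Av m0 by (auto simp: Q_def A_def)
    qed
    ultimately show False using M(3)[OF norm_v] by blast
  qed
  then show ?thesis
    using that[of M] M(1,2) unfolding sv_system_def Q_def by blast
qed

text \<open>The vectors \<open>\<phi> e\<close> are the left singular vectors of \<open>X\<close>,
  and the adjoint maps \<open>\<phi> e\<close> back to \<open>norm (X e)\<close> times
  \<open>e\<close>. So left and right vectors exchange their roles while the singular values
  stay.\<close>

lemma sv_system_cadjoint:
  fixes X :: "'a::chilbert_space \<Rightarrow> 'a"
  assumes X: "X \<in> bounded_ops" and E: "sv_system X E"
  defines "\<phi> \<equiv> \<lambda>e. complex_of_real (inverse (norm (X e))) *\<^sub>C X e"
  shows "sv_system (cadjoint X) (\<phi> ` E)" "inj_on \<phi> E"
    "\<And>e. e \<in> E \<Longrightarrow> norm (cadjoint X (\<phi> e)) = norm (X e)"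
proof -
  note oE = sv_system_orthonormal[OF E]
  note cX = cadjoint_bounded[OF X]
  have inv: "inverse (complex_of_real r) * (complex_of_real r * complex_of_real r) = complex_of_real r" for r
    by (cases "r = 0") auto
  have orth: "cinner (\<phi> e) (\<phi> f) = (if e = f then 1 else 0)" if "e \<in> E" "f \<in> E" for e f
  proof (cases "e = f")
    case True
    have "norm (\<phi> f) = 1" unfolding \<phi>_def by (rule unit_vector[OF sv_system_nonzero[OF E that(2)]])
    then show ?thesis using True by (simp add: cinner_self)
  next
    case False
    then show ?thesis
      by (simp add: \<phi>_def cinner_scaleC_left cinner_scaleC_right sv_system_image_orthogonal[OF X E that])
  qed
  show inj: "inj_on \<phi> E"
  proof (rule inj_onI)
    fix e f assume "e \<in> E" "f \<in> E" "\<phi> e = \<phi> f"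
    then show "e = f" using orth[of e f] orth[of e e] by (auto split: if_splits)
  qed
  have adj: "cadjoint X (\<phi> e) = complex_of_real (norm (X e)) *\<^sub>C e" if "e \<in> E" for e
    unfolding \<phi>_def bounded_opsD_scaleC[OF cX] sv_system_eigen[OF E that]
    by (simp add: power2_eq_square inv)
  show norm: "norm (cadjoint X (\<phi> e)) = norm (X e)" if "e \<in> E" for e
    by (simp add: adj[OF that] norm_scaleC orthonormal_norm[OF oE that])
  have "cadjoint X w = 0" if w: "\<And>f. f \<in> \<phi> ` E \<Longrightarrow> cinner f w = 0" for w
  proof (rule cinner_ext)
    fix v
    have "((\<lambda>e. cinner w (cinner e v *\<^sub>C X e)) has_sum cinner w (X v)) E"
      by (rule has_sum_cinner_right[OF sv_system_expansion[OF X E]])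
    moreover have "cinner w (cinner e v *\<^sub>C X e) = 0" if "e \<in> E" for e
    proof -
      have "cinner (X e) w = 0"
        using w[of "\<phi> e"] that sv_system_nonzero[OF E that] by (simp add: \<phi>_def cinner_scaleC_left)
      then show ?thesis using cinner_eq_0_commute[of w "X e"] by (simp add: cinner_scaleC_right)
    qed
    ultimately have "cinner w (X v) = 0"
      by (metis (no_types, lifting) has_sum_0 has_sum_unique)
    then show "cinner v (cadjoint X w) = cinner v 0"
      using cinner_eq_0_commute[of w "X v"] by (simp add: cinner_cadjoint_right[OF X])
  qed
  moreover have "orthonormal (\<phi> ` E)"
    using orth inj by (auto simp: orthonormal_def inj_on_def)
  moreover have "cadjoint X (\<phi> e) \<noteq> 0" if "e \<in> E" for e
    using norm[OF that] sv_system_nonzero[OF E that] by auto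
  moreover have "cadjoint (cadjoint X) (cadjoint X (\<phi> e)) =
      complex_of_real ((norm (cadjoint X (\<phi> e)))\<^sup>2) *\<^sub>C \<phi> e" if "e \<in> E" for e
    unfolding norm[OF that] cadjoint_cadjoint[OF X]
    unfolding adj[OF that] bounded_opsD_scaleC[OF X]
    by (simp add: \<phi>_def power2_eq_square inv mult.commute)
  ultimately show "sv_system (cadjoint X) (\<phi> ` E)" unfolding sv_system_def by blast
qed

section \<open>Multiplicities: from eigenspaces to sums over a singular system\<close>

text \<open>The \<open>e\<close> in \<open>E\<close> with \<open>norm (X e) = t\<close> are an
  orthonormal basis of the eigenspace, because components along other members of \<open>E\<close>
  belong to different eigenvalues. \<open>hilbert_dim\<close> is a supremum over finite orthonormal
  sets, so it remains to see that none of them is larger than this basis.\<close>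

lemma hilbert_dim_sv_system:
  fixes X :: "'a::chilbert_space \<Rightarrow> 'a"
  assumes X: "X \<in> bounded_ops" and E: "sv_system X E" and t: "t > 0"
    and fin: "finite {e \<in> E. norm (X e) = t}"
  shows "hilbert_dim {v. cadjoint X (X v) = complex_of_real (t\<^sup>2) *\<^sub>C v} = enat (card {e \<in> E. norm (X e) = t})"
proof -
  define V where "V = {v. cadjoint X (X v) = complex_of_real (t\<^sup>2) *\<^sub>C v}"
  define Et where "Et = {e \<in> E. norm (X e) = t}"
  have oE: "orthonormal E" by (rule sv_system_orthonormal[OF E])
  have oEt: "orthonormal Et" using oE by (rule orthonormal_subset) (auto simp: Et_def)
  have sub: "Et \<subseteq> V" using sv_system_eigen[OF E] by (auto simp: Et_def V_def)
  have exp: "((\<lambda>e. cinner e f *\<^sub>C e) has_sum f) Et" if f: "f \<in> V" for f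
  proof (rule orthonormal_expansion[OF oEt])
    fix w assume w: "\<And>e. e \<in> Et \<Longrightarrow> cinner e w = 0"
    have "((\<lambda>e. cinner (X w) (cinner e f *\<^sub>C X e)) has_sum cinner (X w) (X f)) E"
      by (rule has_sum_cinner_right[OF sv_system_expansion[OF X E]])
    moreover have "cinner (X w) (cinner e f *\<^sub>C X e) = 0" if e: "e \<in> E" for e
    proof (cases "e \<in> Et")
      case True
      then have "cinner (X e) (X w) = 0" using w by (simp add: sv_system_cinner_image[OF X E e])
      then show ?thesis using cinner_eq_0_commute[of "X w" "X e"] by (simp add: cinner_scaleC_right)
    next
      case False
      then have "norm (X e) \<noteq> t" using e by (simp add: Et_def)
      then have "(norm (X e))\<^sup>2 \<noteq> t\<^sup>2" using t by (simp add: power2_eq_iff_nonneg)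
      moreover have "complex_of_real ((norm (X e))\<^sup>2) * cinner e f = complex_of_real (t\<^sup>2) * cinner e f"
        using cinner_cadjoint_right[OF X, of e "X f"] f
        by (simp only: V_def mem_Collect_eq sv_system_cinner_image[OF X E e] cinner_scaleC_right)
      ultimately have "cinner e f = 0"
        unfolding mult_cancel_right of_real_eq_iff by blast
      then show ?thesis by simp
    qed
    ultimately have "cinner (X w) (X f) = 0"
      by (metis (no_types, lifting) has_sum_0 has_sum_unique)
    then have "cinner w (cadjoint X (X f)) = 0" by (simp add: cinner_cadjoint_right[OF X])
    then show "cinner w f = 0" using f t by (simp add: V_def cinner_scaleC_right)
  qed
  \<comment> \<open>Double counting of \<open>(cmod (cinner e f))\<^sup>2\<close>: Parseval makes
    the sum over \<open>Et\<close> equal to 1 for each \<open>f\<close>, and Bessel makes the sum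
    over \<open>F\<close> at most 1 for each \<open>e\<close>.\<close>
  have le: "card F \<le> card Et" if F: "finite F" "F \<subseteq> V" "orthonormal F" for F
  proof -
    have "real (card F) = (\<Sum>f\<in>F. \<Sum>e\<in>Et. (cmod (cinner e f))\<^sup>2)"
    proof -
      have "(\<Sum>e\<in>Et. (cmod (cinner e f))\<^sup>2) = 1" if "f \<in> F" for f
      proof -
        have "((\<lambda>e. (cmod (cinner e f))\<^sup>2) has_sum (norm f)\<^sup>2) Et"
          using that F by (intro parseval_norm[OF oEt] exp) auto
        then show ?thesis
          using has_sum_unique[OF has_sum_finite[OF fin[folded Et_def]]] orthonormal_norm[OF F(3) that]
          by (metis one_power2)
      qed
      then show ?thesis by simp
    qed
    also have "\<dots> = (\<Sum>e\<in>Et. \<Sum>f\<in>F. (cmod (cinner f e))\<^sup>2)"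
      by (subst sum.swap) (intro sum.cong refl, metis cinner_commute complex_mod_cnj)
    also have "\<dots> \<le> (\<Sum>e\<in>Et. (norm e)\<^sup>2)"
      by (intro sum_mono bessel_finite(1)[OF F(3,1)]) simp
    also have "\<dots> = real (card Et)" by (simp add: orthonormal_norm[OF oEt])
    finally show ?thesis by simp
  qed
  have "(SUP F\<in>{F. finite F \<and> F \<subseteq> V \<and> orthonormal F}. enat (card F)) = enat (card Et)"
  proof (rule antisym)
    show "(SUP F\<in>{F. finite F \<and> F \<subseteq> V \<and> orthonormal F}. enat (card F)) \<le> enat (card Et)"
      using le by (intro SUP_least) auto
    show "enat (card Et) \<le> (SUP F\<in>{F. finite F \<and> F \<subseteq> V \<and> orthonormal F}. enat (card F))"
      using fin sub oEt by (intro SUP_upper) (auto simp: Et_def)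
  qed
  then show ?thesis by (simp add: hilbert_dim_def V_def Et_def)
qed

text \<open>For each \<open>t > 0\<close> the members of \<open>E\<close> with image of norm
  \<open>t\<close> are enumerated by the numbers below their cardinality, which are the
  \<open>k\<close> paired with \<open>t\<close> in \<open>singular_values\<close>. These level sets
  are disjoint, so the enumerations combine.\<close>

lemma singular_values_bij:
  fixes X :: "'a::chilbert_space \<Rightarrow> 'a"
  assumes X: "X \<in> bounded_ops" and E: "sv_system X E"
    and fin: "\<And>t. t > 0 \<Longrightarrow> finite {e \<in> E. norm (X e) = t}"
  obtains \<phi> where "bij_betw \<phi> (singular_values X) E"
    "\<And>s k. (s, k) \<in> singular_values X \<Longrightarrow> norm (X (\<phi> (s, k))) = s"
proof -
  have "\<exists>h. bij_betw h {0..<card {e \<in> E. norm (X e) = t}} {e \<in> E. norm (X e) = t}" if "t > 0" for t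
    using ex_bij_betw_nat_finite[OF fin[OF that]] .
  then obtain h where h: "\<And>t. t > 0 \<Longrightarrow> bij_betw (h t) {0..<card {e \<in> E. norm (X e) = t}} {e \<in> E. norm (X e) = t}"
    by metis
  define \<phi> where "\<phi> = (\<lambda>(s, k). h s k)"
  have sv: "singular_values X = {(s, k). s > 0 \<and> k < card {e \<in> E. norm (X e) = s}}"
    unfolding singular_values_def by (auto simp: hilbert_dim_sv_system[OF X E _ fin] simp del: of_real_power)
  have norm: "\<phi> (s, k) \<in> E \<and> norm (X (\<phi> (s, k))) = s" if "(s, k) \<in> singular_values X" for s k
    using that bij_betwE[OF h[of s]] by (auto simp: sv \<phi>_def)
  have "inj_on \<phi> (singular_values X)"
  proof (rule inj_onI, clarify)
    fix s k s' k' assume a: "(s, k) \<in> singular_values X" "(s', k') \<in> singular_values X" "\<phi> (s, k) = \<phi> (s', k')"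
    then have "s = s'" using norm by metis
    then show "s = s' \<and> k = k'"
      using a bij_betw_imp_inj_on[OF h[of s]] by (auto simp: sv \<phi>_def inj_on_def)
  qed
  moreover have "\<phi> ` singular_values X = E"
  proof (intro equalityI subsetI)
    fix e assume e: "e \<in> E"
    define s where "s = norm (X e)"
    have "s > 0" using sv_system_nonzero[OF E e] by (simp add: s_def)
    then obtain k where "k < card {e \<in> E. norm (X e) = s}" "h s k = e"
      using bij_betw_imp_surj_on[OF h[of s]] e s_def by (smt (verit) atLeastLessThan_iff image_iff mem_Collect_eq)
    then show "e \<in> \<phi> ` singular_values X"
      using \<open>s > 0\<close> by (intro image_eqI[of _ _ "(s, k)"]) (auto simp: sv \<phi>_def)
  qed (use norm in auto)
  ultimately show ?thesis using that[of \<phi>] norm by (simp add: bij_betw_def)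
qed

text \<open>The bridge from the definition to explicit vectors. An equivalence of
  \<open>has_sum\<close> carries summability and value at once, so it serves introduction and
  elimination of Schatten classes alike.\<close>

lemma singular_values_has_sum_iff:
  fixes X :: "'a::chilbert_space \<Rightarrow> 'a"
  assumes X: "X \<in> bounded_ops" and E: "sv_system X E"
    and fin: "\<And>t. t > 0 \<Longrightarrow> finite {e \<in> E. norm (X e) = t}"
  shows "((\<lambda>(s, k). f s) has_sum c) (singular_values X) \<longleftrightarrow> ((\<lambda>e. f (norm (X e))) has_sum c) E"
proof -
  obtain \<phi> where \<phi>: "bij_betw \<phi> (singular_values X) E"
    "\<And>s k. (s, k) \<in> singular_values X \<Longrightarrow> norm (X (\<phi> (s, k))) = s"
    using singular_values_bij[OF X E fin] by blast
  have "((\<lambda>(s, k). f s) has_sum c) (singular_values X) \<longleftrightarrow>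
      ((\<lambda>x. f (norm (X (\<phi> x)))) has_sum c) (singular_values X)"
    by (rule has_sum_cong) (auto simp: \<phi>(2))
  also have "\<dots> \<longleftrightarrow> ((\<lambda>e. f (norm (X e))) has_sum c) E"
    by (rule has_sum_reindex_bij_betw[OF \<phi>(1)])
  finally show ?thesis .
qed

lemma summable_on_finite_large:
  fixes f :: "'i \<Rightarrow> real"
  assumes "f summable_on A" "\<And>x. x \<in> A \<Longrightarrow> f x \<ge> 0" "\<delta> > 0"
  shows "finite {x \<in> A. f x \<ge> \<delta>}"
proof -
  obtain F where F: "finite F" "\<And>G. finite G \<Longrightarrow> G \<subseteq> A \<Longrightarrow> G \<inter> F = {} \<Longrightarrow> sum f G < \<delta>"
    using summable_on_tail[OF assms] by metis
  have "{x \<in> A. f x \<ge> \<delta>} \<subseteq> F"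
  proof safe
    fix x assume "x \<in> A" "f x \<ge> \<delta>"
    then show "x \<in> F" using F(2)[of "{x}"] by auto
  qed
  then show ?thesis using F(1) finite_subset by blast
qed

text \<open>Distinct members of \<open>E\<close> have orthogonal images, so images of norm at least
  \<open>\<delta>\<close> are at distance at least \<open>\<delta>\<close> from each other; an
  infinite supply of them would have no convergent subsequence.\<close>

lemma compact_ops_finite_large:
  fixes X :: "'a::chilbert_space \<Rightarrow> 'a"
  assumes X: "X \<in> compact_ops" and E: "sv_system X E" and \<delta>: "\<delta> > 0"
  shows "finite {e \<in> E. norm (X e) \<ge> \<delta>}"
proof (rule ccontr)
  note bX = compact_ops_bounded[OF X] and oE = sv_system_orthonormal[OF E]
  assume "infinite {e \<in> E. norm (X e) \<ge> \<delta>}"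
  then obtain g :: "nat \<Rightarrow> 'a" where g: "inj g" "range g \<subseteq> {e \<in> E. norm (X e) \<ge> \<delta>}"
    using infinite_countable_subset by blast
  have gE: "g n \<in> E" "norm (X (g n)) \<ge> \<delta>" for n using g(2) by auto
  obtain l r where r: "strict_mono (r :: nat \<Rightarrow> nat)" "(\<lambda>n. X (g (r n))) \<longlonglongrightarrow> l"
    using compact_opsE[OF X, of g 1] orthonormal_norm[OF oE gE(1)] by (metis order_refl)
  have "Cauchy (\<lambda>n. X (g (r n)))" using r(2) LIMSEQ_imp_Cauchy by blast
  then obtain N where N: "norm (X (g (r N)) - X (g (r (Suc N)))) < \<delta>"
    using \<delta> unfolding Cauchy_iff by (metis le_Suc_eq le_refl)
  have "g (r N) \<noteq> g (r (Suc N))" using strict_mono_eq[OF r(1)] by (simp add: inj_eq[OF g(1)])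
  then have "cinner (X (g (r N))) (- X (g (r (Suc N)))) = 0"
    using sv_system_image_orthogonal[OF bX E gE(1) gE(1)] by (simp add: cinner.minus_right)
  then have "(norm (X (g (r N)) + - X (g (r (Suc N)))))\<^sup>2 = (norm (X (g (r N))))\<^sup>2 + (norm (X (g (r (Suc N)))))\<^sup>2"
    by (simp only: norm_add_sq) simp
  then have "(norm (X (g (r N))))\<^sup>2 \<le> (norm (X (g (r N)) - X (g (r (Suc N)))))\<^sup>2" by simp
  then have "norm (X (g (r N))) \<le> norm (X (g (r N)) - X (g (r (Suc N))))"
    by (simp add: power2_le_iff_abs_le)
  then show False using N gE(2)[of "r N"] by simp
qed


section \<open>Schatten classes\<close>

text \<open>Compactness is a conclusion: summability of the powers leaves only finitely many
  \<open>e\<close> with \<open>norm (X e)\<close> above any positive bound, and the images are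
  orthogonal. Any singular system will do, so later proofs may choose an explicit one.\<close>

lemma schattenI:
  fixes X :: "'a::chilbert_space \<Rightarrow> 'a"
  assumes X: "X \<in> bounded_ops" and E: "sv_system X E" and p: "p > 0"
    and s: "((\<lambda>e. norm (X e) powr p) has_sum c) E"
  shows "X \<in> schatten p" "schatten_norm p X = c powr (1 / p)"
proof -
  have large: "finite {e \<in> E. norm (X e) \<ge> \<delta>}" if "\<delta> > 0" for \<delta>
  proof (rule finite_subset)
    show "finite {e \<in> E. norm (X e) powr p \<ge> \<delta> powr p}"
      using s that by (intro summable_on_finite_large) (auto simp: summable_on_def)
    show "{e \<in> E. norm (X e) \<ge> \<delta>} \<subseteq> {e \<in> E. norm (X e) powr p \<ge> \<delta> powr p}"
      using p that by (auto intro: powr_mono2)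
  qed
  have fin: "finite {e \<in> E. norm (X e) = t}" if "t > 0" for t
    by (rule finite_subset[OF _ large[OF that]]) auto
  have c: "((\<lambda>(s, k). s powr p) has_sum c) (singular_values X)"
    using singular_values_has_sum_iff[OF X E fin, of "\<lambda>s. s powr p" c] s by blast
  moreover have "X \<in> compact_ops"
    by (rule compact_ops_orthogonal[OF X sv_system_orthonormal[OF E] sv_system_vanish[OF E]
          sv_system_image_orthogonal[OF X E] large]) auto
  ultimately show "X \<in> schatten p" by (auto simp: schatten_def summable_on_def)
  show "schatten_norm p X = c powr (1 / p)" using infsumI[OF c] by (simp add: schatten_norm_def)
qed

lemma schatten_compact: "X \<in> schatten p \<Longrightarrow> X \<in> compact_ops"
  by (simp add: schatten_def)

lemma schatten_bounded: "X \<in> schatten p \<Longrightarrow> X \<in> bounded_ops"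
  using schatten_compact compact_ops_bounded by blast

lemma schattenE:
  fixes X :: "'a::chilbert_space \<Rightarrow> 'a"
  assumes X: "X \<in> schatten p" and p: "p > 0"
  obtains E c where "sv_system X E" "((\<lambda>e. norm (X e) powr p) has_sum c) E"
    "schatten_norm p X = c powr (1 / p)" "c \<ge> 0"
proof -
  have cX: "X \<in> compact_ops" and bX: "X \<in> bounded_ops"
    using schatten_compact[OF X] schatten_bounded[OF X] by auto
  obtain E where E: "sv_system X E" using sv_system_exists[OF cX] by blast
  have fin: "finite {e \<in> E. norm (X e) = t}" if "t > 0" for t
    by (rule finite_subset[OF _ compact_ops_finite_large[OF cX E that]]) auto
  obtain c where "((\<lambda>(s, k). s powr p) has_sum c) (singular_values X)"
    using X by (auto simp: schatten_def summable_on_def)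
  then have c: "((\<lambda>e. norm (X e) powr p) has_sum c) E"
    using singular_values_has_sum_iff[OF bX E fin, of "\<lambda>s. s powr p" c] by blast
  have "c \<ge> 0" using c by (rule has_sum_nonneg) simp
  then show ?thesis using that E c schattenI(2)[OF bX E p c] by blast
qed

lemma schatten_cadjoint:
  fixes X :: "'a::chilbert_space \<Rightarrow> 'a"
  assumes X: "X \<in> schatten p" and p: "p > 0"
  shows "cadjoint X \<in> schatten p" "schatten_norm p (cadjoint X) = schatten_norm p X"
proof -
  have bX: "X \<in> bounded_ops" by (rule schatten_bounded[OF X])
  obtain E c where E: "sv_system X E" "((\<lambda>e. norm (X e) powr p) has_sum c) E"
    "schatten_norm p X = c powr (1 / p)" using schattenE[OF assms] by blast
  define \<phi> where "\<phi> e = complex_of_real (inverse (norm (X e))) *\<^sub>C X e" for e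
  note sv = sv_system_cadjoint[OF bX E(1), folded \<phi>_def]
  have "((\<lambda>f. norm (cadjoint X f) powr p) has_sum c) (\<phi> ` E)"
    unfolding has_sum_reindex[OF sv(2)]
    by (rule has_sum_cong[THEN iffD1, OF _ E(2)]) (simp add: sv(3))
  from schattenI[OF cadjoint_bounded[OF bX] sv(1) p this] E(3)
  show "cadjoint X \<in> schatten p" "schatten_norm p (cadjoint X) = schatten_norm p X" by simp_all
qed

section \<open>Nuclear representations\<close>

text \<open>Fubini for unordered sums. It underlies the basis independence of the trace and of the
  Hilbert-Schmidt norm.\<close>

lemma has_sum_swap_family:
  fixes g :: "'i \<Rightarrow> 'j \<Rightarrow> 'b::banach"
  assumes "(\<lambda>(i, j). g i j) summable_on I \<times> J"
    and "\<And>i. i \<in> I \<Longrightarrow> (g i has_sum r i) J" "\<And>j. j \<in> J \<Longrightarrow> ((\<lambda>i. g i j) has_sum c j) I"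
    and "(r has_sum s) I"
  shows "(c has_sum s) J"
proof -
  have "((\<lambda>(i, j). g i j) has_sum s) (I \<times> J)"
    by (rule has_sum_SigmaI[where g = r]) (use assms in auto)
  then have "((\<lambda>(j, i). g i j) has_sum s) (J \<times> I)"
    by (subst (asm) has_sum_swap) (simp add: case_prod_unfold)
  then show ?thesis
    by (rule has_sum_SigmaD) (use assms in auto)
qed

lemma has_sum_finite_sum:
  fixes f :: "'e \<Rightarrow> 'i \<Rightarrow> 'b::topological_comm_monoid_add"
  assumes "\<And>e. e \<in> F \<Longrightarrow> (f e has_sum s e) I"
  shows "((\<lambda>i. \<Sum>e\<in>F. f e i) has_sum (\<Sum>e\<in>F. s e)) I"
  using assms by (induction F rule: infinite_finite_induct) (auto intro: has_sum_add)

lemma Cauchy_Schwarz_has_sum: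
  fixes f g :: "'i \<Rightarrow> real"
  assumes f: "((\<lambda>i. (f i)\<^sup>2) has_sum a) I" and g: "((\<lambda>i. (g i)\<^sup>2) has_sum b) I"
  shows "(\<lambda>i. \<bar>f i\<bar> * \<bar>g i\<bar>) summable_on I" "(\<Sum>\<^sub>\<infinity>i\<in>I. \<bar>f i\<bar> * \<bar>g i\<bar>) \<le> sqrt a * sqrt b"
proof -
  have le: "(\<Sum>i\<in>F. \<bar>f i\<bar> * \<bar>g i\<bar>) \<le> sqrt a * sqrt b" if F: "finite F" "F \<subseteq> I" for F
  proof -
    have "(\<Sum>i\<in>F. \<bar>f i\<bar> * \<bar>g i\<bar>) \<le> L2_set f F * L2_set g F" by (rule L2_set_mult_ineq)
    also have "\<dots> \<le> sqrt a * sqrt b"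
    proof (rule mult_mono)
      show "L2_set f F \<le> sqrt a" unfolding L2_set_def
        using F f by (intro real_sqrt_le_mono finite_sum_le_has_sum[OF f]) auto
      show "L2_set g F \<le> sqrt b" unfolding L2_set_def
        using F g by (intro real_sqrt_le_mono finite_sum_le_has_sum[OF g]) auto
      have "a \<ge> 0" by (rule has_sum_nonneg[OF f]) simp
      then show "0 \<le> sqrt a" by simp
    qed (simp add: L2_set_nonneg)
    finally show ?thesis .
  qed
  then show s: "(\<lambda>i. \<bar>f i\<bar> * \<bar>g i\<bar>) summable_on I"
    by (intro nonneg_bdd_above_summable_on bdd_aboveI[of _ "sqrt a * sqrt b"]) auto
  show "(\<Sum>\<^sub>\<infinity>i\<in>I. \<bar>f i\<bar> * \<bar>g i\<bar>) \<le> sqrt a * sqrt b"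
    by (rule infsum_le_finite_sums[OF s]) (use le in blast)
qed

text \<open>The families need not be orthogonal and the index type is free, so adjoints,
  compositions and products keep the format, unlike singular systems. Convergence is asked for at
  each vector only; boundedness of \<open>T\<close> follows.\<close>

definition nuclear_rep ::
    "'i set \<Rightarrow> ('i \<Rightarrow> 'a::chilbert_space) \<Rightarrow> ('i \<Rightarrow> 'a) \<Rightarrow> ('a \<Rightarrow> 'a) \<Rightarrow> bool" where
  "nuclear_rep I a b T \<longleftrightarrow> (\<lambda>i. norm (a i) * norm (b i)) summable_on I \<and>
     (\<forall>v. ((\<lambda>i. cinner (b i) v *\<^sub>C a i) has_sum T v) I)"

lemma nuclear_rep_sum_le:
  assumes "nuclear_rep I a b T" "finite F" "F \<subseteq> I"
  shows "(\<Sum>i\<in>F. norm (a i) * norm (b i)) \<le> (\<Sum>\<^sub>\<infinity>i\<in>I. norm (a i) * norm (b i))"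
  using assms by (intro finite_sum_le_infsum) (auto simp: nuclear_rep_def)

lemma norm_rank_one_sum_le:
  fixes a b :: "'i \<Rightarrow> 'a::chilbert_space"
  shows "norm (\<Sum>i\<in>F. cinner (b i) v *\<^sub>C a i) \<le> (\<Sum>i\<in>F. norm (a i) * norm (b i)) * norm v"
proof -
  have "norm (\<Sum>i\<in>F. cinner (b i) v *\<^sub>C a i) \<le> (\<Sum>i\<in>F. (norm (a i) * norm (b i)) * norm v)"
  proof (rule sum_norm_le)
    fix i
    show "norm (cinner (b i) v *\<^sub>C a i) \<le> (norm (a i) * norm (b i)) * norm v"
      using mult_right_mono[OF Cauchy_Schwarz_cinner[of "b i" v] norm_ge_zero[of "a i"]]
      by (simp add: norm_scaleC ac_simps)
  qed
  then show ?thesis by (simp add: sum_distrib_right)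
qed

lemma nuclear_rep_bounded:
  assumes "nuclear_rep I a b T"
  shows "T \<in> bounded_ops"
proof (rule bounded_opsI)
  have T: "((\<lambda>i. cinner (b i) v *\<^sub>C a i) has_sum T v) I" for v
    using assms by (simp add: nuclear_rep_def)
  show "T (u + v) = T u + T v" for u v
    using has_sum_add[OF T[of u] T[of v]] T[of "u + v"]
    by (simp add: cinner_add_right scaleC_add_left has_sum_unique)
  show "T (c *\<^sub>C v) = c *\<^sub>C T v" for c v
    using has_sum_bounded_linear[OF scaleC.bounded_linear_right T[of v], of c] T[of "c *\<^sub>C v"]
    by (simp add: o_def cinner_scaleC_right has_sum_unique)
  show "norm (T v) \<le> (\<Sum>\<^sub>\<infinity>i\<in>I. norm (a i) * norm (b i)) * norm v" for v
  proof (rule has_sum_norm_le[OF T])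
    fix F assume "finite F" "F \<subseteq> I"
    then show "norm (\<Sum>i\<in>F. cinner (b i) v *\<^sub>C a i) \<le> (\<Sum>\<^sub>\<infinity>i\<in>I. norm (a i) * norm (b i)) * norm v"
      using norm_rank_one_sum_le[of b v a F] mult_right_mono[OF nuclear_rep_sum_le[OF assms] norm_ge_zero[of v]]
      by (meson order_trans)
  qed
qed

lemma nuclear_rep_compact:
  assumes T: "nuclear_rep I a b T"
  shows "T \<in> compact_ops"
proof (rule compact_ops_rank_one_sum[OF nuclear_rep_bounded[OF T]])
  fix \<epsilon> :: real assume "\<epsilon> > 0"
  have s: "(\<lambda>i. norm (a i) * norm (b i)) summable_on I" using T by (simp add: nuclear_rep_def)
  obtain F where F: "finite F" "F \<subseteq> I"
    "\<And>G. finite G \<Longrightarrow> G \<subseteq> I \<Longrightarrow> G \<inter> F = {} \<Longrightarrow> (\<Sum>i\<in>G. norm (a i) * norm (b i)) < \<epsilon>"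
    using summable_on_tail[OF s _ \<open>\<epsilon> > 0\<close>] by (metis mult_nonneg_nonneg norm_ge_zero)
  have "norm (\<Sum>i\<in>G. cinner (b i) v *\<^sub>C a i) \<le> \<epsilon> * norm v" if G: "finite G" "G \<subseteq> I - F" for G v
  proof -
    have "(\<Sum>i\<in>G. norm (a i) * norm (b i)) \<le> \<epsilon>" using F(3)[of G] G by fastforce
    then show ?thesis
      using norm_rank_one_sum_le[of b v a G] mult_right_mono[OF _ norm_ge_zero[of v]] by (meson order_trans)
  qed
  then show "\<exists>F. finite F \<and> F \<subseteq> I \<and> (\<forall>G v. finite G \<and> G \<subseteq> I - F \<longrightarrow>
      norm (\<Sum>i\<in>G. cinner (b i) v *\<^sub>C a i) \<le> \<epsilon> * norm v)"
    using F(1,2) by (intro exI[of _ F]) simp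
qed (use T in \<open>simp add: nuclear_rep_def\<close>)

text \<open>The sum of \<open>norm (T e)\<close> is the sum of
  \<open>cinner (\<phi> e) (T e)\<close> with the left singular vectors \<open>\<phi> e\<close>.
  After inserting the representation, Cauchy-Schwarz over \<open>e\<close> and Bessel for the two
  orthonormal systems bound the contribution of each \<open>i\<close> by
  \<open>norm (a i) * norm (b i)\<close>.\<close>

lemma nuclear_rep_schatten_1:
  assumes T: "nuclear_rep I a b T"
  shows "T \<in> schatten 1" "schatten_norm 1 T \<le> (\<Sum>\<^sub>\<infinity>i\<in>I. norm (a i) * norm (b i))"
proof -
  define S where "S = (\<Sum>\<^sub>\<infinity>i\<in>I. norm (a i) * norm (b i))"
  note bT = nuclear_rep_bounded[OF T]
  obtain E where E: "sv_system T E" using sv_system_exists[OF nuclear_rep_compact[OF T]] by blast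
  note oE = sv_system_orthonormal[OF E]
  define \<phi> where "\<phi> e = complex_of_real (inverse (norm (T e))) *\<^sub>C T e" for e
  note sv = sv_system_cadjoint[OF bT E, folded \<phi>_def]
  have le: "(\<Sum>e\<in>F. norm (T e)) \<le> S" if F: "finite F" "F \<subseteq> E" for F
  proof -
    have "((\<lambda>i. \<Sum>e\<in>F. cinner (\<phi> e) (cinner (b i) e *\<^sub>C a i)) has_sum (\<Sum>e\<in>F. cinner (\<phi> e) (T e))) I"
      using T by (intro has_sum_finite_sum has_sum_cinner_right) (simp add: nuclear_rep_def)
    moreover have "cinner (\<phi> e) (T e) = complex_of_real (norm (T e))" if "e \<in> F" for e
      using sv_system_nonzero[OF E, of e] that F
      by (auto simp: \<phi>_def cinner_scaleC_left cinner_self power2_eq_square)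
    ultimately have hs: "((\<lambda>i. \<Sum>e\<in>F. cinner (\<phi> e) (cinner (b i) e *\<^sub>C a i)) has_sum
        complex_of_real (\<Sum>e\<in>F. norm (T e))) I" by simp
    have "norm (complex_of_real (\<Sum>e\<in>F. norm (T e))) \<le> S"
    proof (rule has_sum_norm_le[OF hs])
      fix G assume G: "finite G" "G \<subseteq> I"
      have "cmod (\<Sum>e\<in>F. cinner (\<phi> e) (cinner (b i) e *\<^sub>C a i)) \<le> norm (a i) * norm (b i)" for i
      proof -
        have "cmod (\<Sum>e\<in>F. cinner (\<phi> e) (cinner (b i) e *\<^sub>C a i)) \<le>
            (\<Sum>e\<in>F. \<bar>cmod (cinner (\<phi> e) (a i))\<bar> * \<bar>cmod (cinner e (b i))\<bar>)"
        proof (rule sum_norm_le)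
          fix e
          show "cmod (cinner (\<phi> e) (cinner (b i) e *\<^sub>C a i)) \<le> \<bar>cmod (cinner (\<phi> e) (a i))\<bar> * \<bar>cmod (cinner e (b i))\<bar>"
            by (subst cinner_commute[of e]) (simp add: cinner_scaleC_right norm_mult)
        qed
        also have "\<dots> \<le> L2_set (\<lambda>e. cmod (cinner (\<phi> e) (a i))) F * L2_set (\<lambda>e. cmod (cinner e (b i))) F"
          by (rule L2_set_mult_ineq)
        also have "\<dots> \<le> norm (a i) * norm (b i)"
        proof (rule mult_mono)
          have "(\<Sum>e\<in>F. (cmod (cinner (\<phi> e) (a i)))\<^sup>2) = (\<Sum>f\<in>\<phi> ` F. (cmod (cinner f (a i)))\<^sup>2)"
            using F sv(2) by (subst sum.reindex) (auto simp: inj_on_subset)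
          also have "\<dots> \<le> (norm (a i))\<^sup>2"
            using F by (intro bessel_finite(1)[OF sv_system_orthonormal[OF sv(1)]]) auto
          finally show "L2_set (\<lambda>e. cmod (cinner (\<phi> e) (a i))) F \<le> norm (a i)"
            unfolding L2_set_def by (intro real_le_lsqrt) (auto simp: sum_nonneg)
          show "L2_set (\<lambda>e. cmod (cinner e (b i))) F \<le> norm (b i)"
            unfolding L2_set_def using bessel_finite(1)[OF oE F, of "b i"]
            by (intro real_le_lsqrt) (auto simp: sum_nonneg)
        qed (auto simp: L2_set_nonneg)
        finally show ?thesis .
      qed
      then have "norm (\<Sum>i\<in>G. \<Sum>e\<in>F. cinner (\<phi> e) (cinner (b i) e *\<^sub>C a i)) \<le> (\<Sum>i\<in>G. norm (a i) * norm (b i))"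
        by (intro sum_norm_le)
      also have "\<dots> \<le> S" unfolding S_def by (rule nuclear_rep_sum_le[OF T G])
      finally show "norm (\<Sum>i\<in>G. \<Sum>e\<in>F. cinner (\<phi> e) (cinner (b i) e *\<^sub>C a i)) \<le> S" .
    qed
    moreover have "0 \<le> (\<Sum>e\<in>F. norm (T e))" by (simp add: sum_nonneg)
    ultimately show ?thesis by (simp only: norm_of_real abs_of_nonneg)
  qed
  then have summable: "(\<lambda>e. norm (T e)) summable_on E"
    by (intro nonneg_bdd_above_summable_on bdd_aboveI[of _ S]) auto
  then have hs: "((\<lambda>e. norm (T e) powr 1) has_sum (\<Sum>\<^sub>\<infinity>e\<in>E. norm (T e))) E" by simp
  have "(\<Sum>\<^sub>\<infinity>e\<in>E. norm (T e)) \<le> S" by (rule infsum_le_finite_sums[OF summable]) (use le in blast)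
  moreover have "(\<Sum>\<^sub>\<infinity>e\<in>E. norm (T e)) \<ge> 0" by (rule infsum_nonneg) simp
  ultimately show "T \<in> schatten 1" "schatten_norm 1 T \<le> (\<Sum>\<^sub>\<infinity>i\<in>I. norm (a i) * norm (b i))"
    using schattenI[OF bT E _ hs] by (simp_all add: S_def)
qed

text \<open>The second vectors of the singular value expansion are the unit vectors \<open>e\<close>
  themselves, so the norm sum of this representation is exactly the trace norm.\<close>

lemma schatten_1E:
  fixes X :: "'a::chilbert_space \<Rightarrow> 'a"
  assumes "X \<in> schatten 1"
  obtains E where "orthonormal E" "nuclear_rep E X (\<lambda>e. e) X"
    "((\<lambda>e. norm (X e)) has_sum schatten_norm 1 X) E"
proof -
  obtain E c where E: "sv_system X E" "((\<lambda>e. norm (X e) powr 1) has_sum c) E"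
    "schatten_norm 1 X = c powr (1 / 1)" "c \<ge> 0"
    using schattenE[OF assms] by auto
  note oE = sv_system_orthonormal[OF E(1)]
  have hs: "((\<lambda>e. norm (X e)) has_sum schatten_norm 1 X) E"
    using E by simp
  have "(\<lambda>e. norm (X e) * norm e) summable_on E"
    by (rule summable_on_cong[THEN iffD1, OF _ has_sum_imp_summable[OF hs]]) (simp add: orthonormal_norm[OF oE])
  then show ?thesis
    using that[OF oE _ hs] sv_system_expansion[OF schatten_bounded[OF assms] E(1)]
    by (simp add: nuclear_rep_def)
qed

section \<open>The trace\<close>

lemma op_trace_eqI:
  fixes X :: "'a::chilbert_space \<Rightarrow> 'a"
  assumes "\<And>E. orthonormal_basis E \<Longrightarrow> ((\<lambda>e. cinner e (X e)) has_sum t) E"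
  shows "op_trace X = t"
  unfolding op_trace_def
proof (rule the_equality)
  fix s assume s: "\<forall>E. orthonormal_basis E \<longrightarrow> ((\<lambda>e. cinner e (X e)) has_sum s) E"
  obtain E where "orthonormal_basis (E :: 'a set)" by (rule orthonormal_basis_exists)
  then show "s = t" using s assms has_sum_unique by blast
qed (use assms in blast)

text \<open>The family \<open>cinner (b i) e * cinner e (a i)\<close> sums over \<open>e\<close> to
  \<open>cinner (b i) (a i)\<close> and over \<open>i\<close> to \<open>cinner e (T e)\<close>.
  Exchanging the sums shows at once that the trace exists, is independent of the basis, and can be
  read off any representation.\<close>

lemma op_trace_nuclear_rep:
  assumes T: "nuclear_rep I a b T"
  shows "((\<lambda>i. cinner (b i) (a i)) has_sum op_trace T) I"
proof -
  have s: "(\<lambda>i. norm (a i) * norm (b i)) summable_on I" using T by (simp add: nuclear_rep_def)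
  have "(\<lambda>i. norm (cinner (b i) (a i))) summable_on I"
    by (rule summable_on_comparison_test[OF s])
       (use Cauchy_Schwarz_cinner[of "b _" "a _"] in \<open>auto simp: mult.commute\<close>)
  then have "(\<lambda>i. cinner (b i) (a i)) summable_on I" by (rule abs_summable_summable)
  then obtain t where t: "((\<lambda>i. cinner (b i) (a i)) has_sum t) I" by (auto simp: summable_on_def)
  have "((\<lambda>e. cinner e (T e)) has_sum t) E" if E: "orthonormal_basis E" for E
  proof (rule has_sum_swap_family[OF _ _ _ t])
    define g where "g i e = cinner (b i) e * cinner e (a i)" for i e
    show "(g i has_sum cinner (b i) (a i)) E" for i
      using has_sum_cinner_right[OF basis_expansion[OF E, of "a i"], of "b i"]
      by (simp add: cinner_scaleC_right g_def[abs_def] mult.commute)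
    show "((\<lambda>i. g i e) has_sum cinner e (T e)) I" for e
      using has_sum_cinner_right[of "\<lambda>i. cinner (b i) e *\<^sub>C a i" I "T e" e] T
      by (simp add: nuclear_rep_def cinner_scaleC_right g_def)
    have row: "(\<lambda>e. norm (g i e)) summable_on E" "(\<Sum>\<^sub>\<infinity>e\<in>E. norm (g i e)) \<le> norm (b i) * norm (a i)" for i
    proof -
      have "norm (g i e) = \<bar>cmod (cinner e (b i))\<bar> * \<bar>cmod (cinner e (a i))\<bar>" for e
        unfolding g_def by (subst cinner_commute) (simp add: norm_mult)
      then show "(\<lambda>e. norm (g i e)) summable_on E" "(\<Sum>\<^sub>\<infinity>e\<in>E. norm (g i e)) \<le> norm (b i) * norm (a i)"
        using Cauchy_Schwarz_has_sum[OF basis_parseval[OF E, of "b i"] basis_parseval[OF E, of "a i"]] by simp_all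
    qed
    have "(\<lambda>i. \<Sum>\<^sub>\<infinity>e\<in>E. norm (g i e)) summable_on I"
      by (rule summable_on_comparison_test[OF s]) (use row(2) in \<open>auto simp: mult.commute intro!: infsum_nonneg\<close>)
    then have "(\<lambda>(i, e). norm (g i e)) summable_on I \<times> E"
      using row(1) by (intro summable_on_SigmaI[where g = "\<lambda>i. \<Sum>\<^sub>\<infinity>e\<in>E. norm (g i e)"]) auto
    then show "(\<lambda>(i, e). g i e) summable_on I \<times> E"
      by (rule abs_summable_summable[OF summable_on_cong[THEN iffD1, rotated]]) auto
  qed
  then show ?thesis using t op_trace_eqI by metis
qed


section \<open>Hilbert-Schmidt operators\<close>

text \<open>Both sums add up the squared moduli of the matrix entries \<open>cinner f (X e)\<close>,
  once by rows and once by columns. Two bases are allowed so that applying the lemma twice changes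
  the basis for \<open>X\<close> itself.\<close>

lemma hs_sum_cadjoint:
  fixes X :: "'a::chilbert_space \<Rightarrow> 'a"
  assumes X: "X \<in> bounded_ops" and E: "orthonormal_basis E" and F: "orthonormal_basis F"
    and c: "((\<lambda>e. (norm (X e))\<^sup>2) has_sum c) E"
  shows "((\<lambda>f. (norm (cadjoint X f))\<^sup>2) has_sum c) F"
proof (rule has_sum_swap_family[OF _ _ _ c])
  show row: "((\<lambda>f. (cmod (cinner f (X e)))\<^sup>2) has_sum (norm (X e))\<^sup>2) F" for e
    by (rule basis_parseval[OF F])
  show "((\<lambda>e. (cmod (cinner f (X e)))\<^sup>2) has_sum (norm (cadjoint X f))\<^sup>2) E" for f
  proof -
    have "cmod (cinner f (X e)) = cmod (cinner e (cadjoint X f))" for e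
      unfolding cinner_cadjoint_right[OF X] by (subst cinner_commute) simp
    then show ?thesis using basis_parseval[OF E, of "cadjoint X f"] by simp
  qed
  show "(\<lambda>(e, f). (cmod (cinner f (X e)))\<^sup>2) summable_on E \<times> F"
    using row has_sum_imp_summable[OF c]
    by (intro summable_on_SigmaI[where g = "\<lambda>e. (norm (X e))\<^sup>2"]) auto
qed

lemma hs_sum_basis_indep:
  fixes X :: "'a::chilbert_space \<Rightarrow> 'a"
  assumes X: "X \<in> bounded_ops" and E: "orthonormal_basis E" and F: "orthonormal_basis F"
    and c: "((\<lambda>e. (norm (X e))\<^sup>2) has_sum c) E"
  shows "((\<lambda>f. (norm (X f))\<^sup>2) has_sum c) F"
  using hs_sum_cadjoint[OF cadjoint_bounded[OF X] F F hs_sum_cadjoint[OF X E F c]] X by simp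

text \<open>A singular system is enlarged to a basis. The added vectors are killed by
  \<open>X\<close>, so the sum over the given basis equals the one over the system.\<close>

lemma schatten_2I:
  fixes X :: "'a::chilbert_space \<Rightarrow> 'a"
  assumes X: "X \<in> bounded_ops" and E: "orthonormal_basis E"
    and c: "((\<lambda>e. (norm (X e))\<^sup>2) has_sum c) E"
  shows "X \<in> schatten 2" "schatten_norm 2 X = sqrt c"
proof -
  have "X \<in> compact_ops" by (rule compact_ops_square_summable[OF X E has_sum_imp_summable[OF c]])
  then obtain E0 where E0: "sv_system X E0" using sv_system_exists by blast
  obtain M where M: "orthonormal_basis M" "E0 \<subseteq> M"
    using orthonormal_basis_extend[OF sv_system_orthonormal[OF E0]] by blast
  have "X e = 0" if "e \<in> M - E0" for e
    using that M orthonormal_neq[OF orthonormal_basisD[OF M(1)]]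
    by (intro sv_system_vanish[OF E0]) blast
  then have "((\<lambda>e. norm (X e) powr 2) has_sum c) E0"
    by (intro has_sum_cong_neutral[THEN iffD1, OF _ _ _ hs_sum_basis_indep[OF X E M(1) c]])
       (use M in auto)
  moreover have "c \<ge> 0" by (rule has_sum_nonneg[OF c]) simp
  ultimately show "X \<in> schatten 2" "schatten_norm 2 X = sqrt c"
    using schattenI[OF X E0, of 2 c] by (simp_all add: powr_half_sqrt)
qed

lemma schatten_2_has_sum:
  fixes X :: "'a::chilbert_space \<Rightarrow> 'a"
  assumes X: "X \<in> schatten 2" and E: "orthonormal_basis E"
  shows "((\<lambda>e. (norm (X e))\<^sup>2) has_sum (schatten_norm 2 X)\<^sup>2) E"
proof -
  have bX: "X \<in> bounded_ops" by (rule schatten_bounded[OF X])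
  obtain E0 c where E0: "sv_system X E0" "((\<lambda>e. norm (X e) powr 2) has_sum c) E0"
    using schattenE[OF X] by (metis zero_less_numeral)
  obtain M where M: "orthonormal_basis M" "E0 \<subseteq> M"
    using orthonormal_basis_extend[OF sv_system_orthonormal[OF E0(1)]] by blast
  have "X e = 0" if "e \<in> M - E0" for e
    using that M orthonormal_neq[OF orthonormal_basisD[OF M(1)]]
    by (intro sv_system_vanish[OF E0(1)]) blast
  then have c: "((\<lambda>e. (norm (X e))\<^sup>2) has_sum c) M"
    by (intro has_sum_cong_neutral[THEN iffD1, OF _ _ _ E0(2)]) (use M in auto)
  have "c \<ge> 0" by (rule has_sum_nonneg[OF c]) simp
  then show ?thesis using schatten_2I(2)[OF bX M(1) c] hs_sum_basis_indep[OF bX M(1) E c] by simp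
qed

lemma schatten_norm_nonneg: "schatten_norm p X \<ge> 0"
  by (simp add: schatten_norm_def)

section \<open>Algebra of the Hilbert-Schmidt class\<close>

lemma schatten_2_summableI:
  fixes X :: "'a::chilbert_space \<Rightarrow> 'a"
  assumes "X \<in> bounded_ops" "orthonormal_basis E" "(\<lambda>e. (norm (X e))\<^sup>2) summable_on E"
  shows "X \<in> schatten 2"
  using assms schatten_2I(1) by (auto simp: summable_on_def)

lemma schatten_2_add:
  fixes X Y :: "'a::chilbert_space \<Rightarrow> 'a"
  assumes X: "X \<in> schatten 2" and Y: "Y \<in> schatten 2"
  shows "(\<lambda>v. X v + Y v) \<in> schatten 2"
proof -
  obtain E where E: "orthonormal_basis (E :: 'a set)" by (rule orthonormal_basis_exists)
  have "(\<lambda>e. 2 * (norm (X e))\<^sup>2 + 2 * (norm (Y e))\<^sup>2) summable_on E"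
    using schatten_2_has_sum[OF X E] schatten_2_has_sum[OF Y E]
    by (intro summable_on_add summable_on_cmult_right) (auto simp: summable_on_def)
  then have "(\<lambda>e. (norm (X e + Y e))\<^sup>2) summable_on E"
  proof (rule summable_on_comparison_test)
    fix e
    have "(norm (X e + Y e))\<^sup>2 \<le> (norm (X e) + norm (Y e))\<^sup>2"
      by (intro power_mono norm_triangle_ineq) simp
    also have "\<dots> \<le> 2 * (norm (X e))\<^sup>2 + 2 * (norm (Y e))\<^sup>2"
      using sum_squares_bound[of "norm (X e)" "norm (Y e)"] by (simp add: power2_sum)
    finally show "(norm (X e + Y e))\<^sup>2 \<le> 2 * (norm (X e))\<^sup>2 + 2 * (norm (Y e))\<^sup>2" .
  qed simp
  then show ?thesis
    using X Y E by (intro schatten_2_summableI bounded_ops_add schatten_bounded)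
qed

lemma schatten_2_comp_left:
  fixes X K :: "'a::chilbert_space \<Rightarrow> 'a"
  assumes K: "K \<in> bounded_ops" and C: "\<And>v. norm (K v) \<le> C * norm v" and X: "X \<in> schatten 2"
  shows "K \<circ> X \<in> schatten 2" "schatten_norm 2 (K \<circ> X) \<le> C * schatten_norm 2 X"
proof -
  obtain E where E: "orthonormal_basis (E :: 'a set)" by (rule orthonormal_basis_exists)
  note hX = schatten_2_has_sum[OF X E]
  have C0: "0 \<le> C * norm v" for v :: 'a using C[of v] norm_ge_zero[of "K v"] by linarith
  have bd: "(norm ((K \<circ> X) e))\<^sup>2 \<le> C\<^sup>2 * (norm (X e))\<^sup>2" for e
    using power_mono[OF C[of "X e"], of 2] by (simp add: power_mult_distrib)
  have hC: "((\<lambda>e. C\<^sup>2 * (norm (X e))\<^sup>2) has_sum (C\<^sup>2 * (schatten_norm 2 X)\<^sup>2)) E"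
    by (rule has_sum_cmult_right[OF hX])
  then have "(\<lambda>e. (norm ((K \<circ> X) e))\<^sup>2) summable_on E"
    by (intro summable_on_comparison_test[OF has_sum_imp_summable[OF hC]]) (use bd in auto)
  then show KX: "K \<circ> X \<in> schatten 2"
    by (intro schatten_2_summableI[OF _ E] bounded_ops_comp K schatten_bounded[OF X])
  have "(schatten_norm 2 (K \<circ> X))\<^sup>2 \<le> C\<^sup>2 * (schatten_norm 2 X)\<^sup>2"
    by (rule has_sum_mono[OF schatten_2_has_sum[OF KX E] hC]) (use bd in auto)
  then have *: "schatten_norm 2 (K \<circ> X) \<le> \<bar>C * schatten_norm 2 X\<bar>"
    using power2_le_iff_abs_le[of "\<bar>C * schatten_norm 2 X\<bar>" "schatten_norm 2 (K \<circ> X)"]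
    by (simp add: power_mult_distrib)
  show "schatten_norm 2 (K \<circ> X) \<le> C * schatten_norm 2 X"
  proof (cases "C \<ge> 0")
    case True
    then show ?thesis using * schatten_norm_nonneg[of 2 X] by simp
  next
    \<comment> \<open>A negative \<open>C\<close> can occur only on the trivial space, where both
      sides are 0.\<close>
    case False
    then have "v = 0" for v :: 'a using C0[of v] by (simp add: zero_le_mult_iff)
    then have "X e = 0" "(K \<circ> X) e = 0" for e by blast+
    then have "schatten_norm 2 X = 0" "schatten_norm 2 (K \<circ> X) = 0"
      using schatten_2_has_sum[OF X E] schatten_2_has_sum[OF KX E] has_sum_0
      by (auto simp: has_sum_iff)
    then show ?thesis by simp
  qed
qed

text \<open>Adjoints turn multiplication on the right into multiplication on the left.\<close>

lemma schatten_2_comp_right: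
  fixes X K :: "'a::chilbert_space \<Rightarrow> 'a"
  assumes X: "X \<in> schatten 2" and K: "K \<in> bounded_ops"
  shows "X \<circ> K \<in> schatten 2"
proof -
  have bX: "X \<in> bounded_ops" by (rule schatten_bounded[OF X])
  note cK = cadjoint_bounded[OF K] and cX = cadjoint_bounded[OF bX]
  obtain C where C: "C > 0" "\<And>v. norm (cadjoint K v) \<le> C * norm v" using bounded_ops_norm[OF cK] by blast
  have "cadjoint K \<circ> cadjoint X \<in> schatten 2"
    by (rule schatten_2_comp_left(1)[OF cK C(2) schatten_cadjoint(1)[OF X]]) simp
  then have "cadjoint (cadjoint K \<circ> cadjoint X) \<in> schatten 2" by (rule schatten_cadjoint) simp
  then show ?thesis by (simp add: cadjoint_comp[OF cK cX] bX K)
qed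

lemma schatten_2_scaleC:
  fixes X :: "'a::chilbert_space \<Rightarrow> 'a"
  assumes "X \<in> schatten 2"
  shows "(\<lambda>v. c *\<^sub>C X v) \<in> schatten 2"
proof -
  have K: "(\<lambda>v::'a. c *\<^sub>C v) \<in> bounded_ops"
    by (rule bounded_opsI[where C = "cmod c"]) (auto simp: scaleC_add_right mult.commute norm_scaleC)
  show ?thesis
    using schatten_2_comp_left(1)[OF K _ assms, of "cmod c"] by (simp add: norm_scaleC o_def)
qed

lemma schatten_2_diff:
  fixes X Y :: "'a::chilbert_space \<Rightarrow> 'a"
  assumes "X \<in> schatten 2" "Y \<in> schatten 2"
  shows "(\<lambda>v. X v - Y v) \<in> schatten 2"
  using schatten_2_add[OF assms(1) schatten_2_scaleC[OF assms(2), of "-1"]] by (simp add: scaleC.minus_left)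

text \<open>A unit vector is a member of some basis, and one term of the sum over that basis is at
  most the whole.\<close>

lemma norm_le_schatten_2:
  fixes X :: "'a::chilbert_space \<Rightarrow> 'a"
  assumes X: "X \<in> schatten 2"
  shows "norm (X v) \<le> schatten_norm 2 X * norm v"
proof (cases "v = 0")
  case True
  then show ?thesis using bounded_opsD_zero[OF schatten_bounded[OF X]] by simp
next
  case False
  define u where "u = complex_of_real (inverse (norm v)) *\<^sub>C v"
  have u: "norm u = 1" unfolding u_def by (rule unit_vector[OF False])
  have "orthonormal {u}" using orthonormal_insert[OF orthonormal_empty u] by simp
  then obtain M where M: "orthonormal_basis M" "{u} \<subseteq> M" using orthonormal_basis_extend by blast
  have "(norm (X u))\<^sup>2 \<le> (schatten_norm 2 X)\<^sup>2"
    using finite_sum_le_has_sum[OF schatten_2_has_sum[OF X M(1)], of "{u}"] M by auto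
  then have "norm (X u) \<le> schatten_norm 2 X"
    using schatten_norm_nonneg power2_le_imp_le by blast
  also have "norm (X u) = inverse (norm v) * norm (X v)"
    by (simp add: u_def bounded_opsD_scaleC[OF schatten_bounded[OF X]] norm_scaleC norm_inverse)
  finally show ?thesis using False by (simp add: field_simps)
qed

text \<open>Polarization expresses the terms by squared norms of
  \<open>X e + c *\<^sub>C Y e\<close>, whose sums are squared Hilbert-Schmidt norms. So the limit
  \<open>t\<close> is the same for every basis, as the description in \<open>op_trace\<close>
  demands.\<close>

lemma op_trace_cadjoint_comp:
  fixes X Y :: "'a::chilbert_space \<Rightarrow> 'a"
  assumes X: "X \<in> schatten 2" and Y: "Y \<in> schatten 2" and E: "orthonormal_basis E"
  shows "((\<lambda>e. cinner (X e) (Y e)) has_sum op_trace (cadjoint X \<circ> Y)) E"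
proof -
  define n where "n c = complex_of_real ((schatten_norm 2 (\<lambda>v. X v + c *\<^sub>C Y v))\<^sup>2)" for c
  define t where "t = (n 1 - n (-1) - \<i> * n \<i> + \<i> * n (-\<i>)) / 4"
  have t: "((\<lambda>e. cinner (X e) (Y e)) has_sum t) F" if F: "orthonormal_basis F" for F
  proof -
    have n: "((\<lambda>e. complex_of_real ((norm (X e + c *\<^sub>C Y e))\<^sup>2)) has_sum n c) F" for c
      unfolding n_def
      by (intro has_sum_of_real schatten_2_has_sum[OF _ F] schatten_2_add schatten_2_scaleC X Y)
    have "((\<lambda>e. (complex_of_real ((norm (X e + 1 *\<^sub>C Y e))\<^sup>2) +
        (- complex_of_real ((norm (X e + (-1) *\<^sub>C Y e))\<^sup>2)) +
        (- (\<i> * complex_of_real ((norm (X e + \<i> *\<^sub>C Y e))\<^sup>2))) +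
        \<i> * complex_of_real ((norm (X e + (-\<i>) *\<^sub>C Y e))\<^sup>2)) / 4) has_sum
        (n 1 + (- n (-1)) + (- (\<i> * n \<i>)) + \<i> * n (-\<i>)) / 4) F"
      by (intro has_sum_divide_const has_sum_add has_sum_uminusI has_sum_cmult_right n)
    moreover have "cinner (X e) (Y e) = (complex_of_real ((norm (X e + 1 *\<^sub>C Y e))\<^sup>2) +
        (- complex_of_real ((norm (X e + (-1) *\<^sub>C Y e))\<^sup>2)) +
        (- (\<i> * complex_of_real ((norm (X e + \<i> *\<^sub>C Y e))\<^sup>2))) +
        \<i> * complex_of_real ((norm (X e + (-\<i>) *\<^sub>C Y e))\<^sup>2)) / 4" for e
      using polarization[of "X e" "Y e"] by (simp add: mult.commute)
    ultimately show ?thesis by (simp only: t_def diff_conv_add_uminus)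
  qed
  have "op_trace (cadjoint X \<circ> Y) = t"
  proof (rule op_trace_eqI)
    fix F :: "'a set" assume "orthonormal_basis F"
    then show "((\<lambda>e. cinner e ((cadjoint X \<circ> Y) e)) has_sum t) F"
      using t by (simp add: cinner_cadjoint_right[OF schatten_bounded[OF X]])
  qed
  then show ?thesis using t[OF E] by simp
qed

lemma schatten_1_subset_2:
  fixes X :: "'a::chilbert_space \<Rightarrow> 'a"
  assumes X: "X \<in> schatten 1"
  shows "X \<in> schatten 2" "schatten_norm 2 X \<le> schatten_norm 1 X"
proof -
  note bX = schatten_bounded[OF X]
  obtain E c where E: "sv_system X E" "((\<lambda>e. norm (X e) powr 1) has_sum c) E"
    "schatten_norm 1 X = c powr (1 / 1)" "c \<ge> 0"
    using schattenE[OF X] by auto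
  have c: "((\<lambda>e. norm (X e)) has_sum c) E" "schatten_norm 1 X = c" using E by auto
  have le: "(\<Sum>e\<in>F. (norm (X e))\<^sup>2) \<le> c\<^sup>2" if F: "finite F" "F \<subseteq> E" for F
  proof -
    have "L2_set (\<lambda>e. norm (X e)) F \<le> (\<Sum>e\<in>F. norm (X e))" by (rule L2_set_le_sum) simp
    also have "\<dots> \<le> c" by (rule finite_sum_le_has_sum[OF c(1)]) (use F in auto)
    finally have "(L2_set (\<lambda>e. norm (X e)) F)\<^sup>2 \<le> c\<^sup>2" by (intro power_mono) (auto simp: L2_set_nonneg)
    then show ?thesis by (simp add: L2_set_def sum_nonneg)
  qed
  then have s: "(\<lambda>e. (norm (X e))\<^sup>2) summable_on E"
    by (intro nonneg_bdd_above_summable_on bdd_aboveI[of _ "c\<^sup>2"]) auto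
  define d where "d = (\<Sum>\<^sub>\<infinity>e\<in>E. (norm (X e))\<^sup>2)"
  have d: "((\<lambda>e. norm (X e) powr 2) has_sum d) E" using s by (simp add: d_def)
  have "d \<ge> 0" unfolding d_def by (rule infsum_nonneg) simp
  have "d \<le> c\<^sup>2" unfolding d_def by (rule infsum_le_finite_sums[OF s]) (use le in blast)
  then have "sqrt d \<le> c" using E(4) by (simp add: real_le_lsqrt \<open>d \<ge> 0\<close>)
  then show "X \<in> schatten 2" "schatten_norm 2 X \<le> schatten_norm 1 X"
    using schattenI[OF bX E(1) _ d] c(2) \<open>d \<ge> 0\<close> by (simp_all add: powr_half_sqrt)
qed

text \<open>Expanding \<open>Y v\<close> in a basis writes the product as the sum of the rank one
  operators \<open>|X e><cadjoint Y e|\<close>, and Cauchy-Schwarz bounds the sum of their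
  norms.\<close>

lemma schatten_2_mult:
  fixes X Y :: "'a::chilbert_space \<Rightarrow> 'a"
  assumes X: "X \<in> schatten 2" and Y: "Y \<in> schatten 2"
  shows "X \<circ> Y \<in> schatten 1" "schatten_norm 1 (X \<circ> Y) \<le> schatten_norm 2 X * schatten_norm 2 Y"
proof -
  note bX = schatten_bounded[OF X] and bY = schatten_bounded[OF Y]
  obtain E where E: "orthonormal_basis (E :: 'a set)" by (rule orthonormal_basis_exists)
  have cs: "(\<lambda>e. norm (X e) * norm (cadjoint Y e)) summable_on E"
    "(\<Sum>\<^sub>\<infinity>e\<in>E. norm (X e) * norm (cadjoint Y e)) \<le> schatten_norm 2 X * schatten_norm 2 Y"
    using Cauchy_Schwarz_has_sum[OF schatten_2_has_sum[OF X E] schatten_2_has_sum[OF schatten_cadjoint(1)[OF Y] E]]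
    by (simp_all add: schatten_cadjoint(2)[OF Y] schatten_norm_nonneg)
  have "((\<lambda>e. cinner (cadjoint Y e) v *\<^sub>C X e) has_sum (X \<circ> Y) v) E" for v
    using has_sum_bounded_ops[OF bX basis_expansion[OF E, of "Y v"]]
    by (simp add: bounded_opsD_scaleC[OF bX] cinner_cadjoint_left[OF bY])
  then have "nuclear_rep E X (cadjoint Y) (X \<circ> Y)" using cs(1) by (simp add: nuclear_rep_def)
  from nuclear_rep_schatten_1[OF this] cs(2)
  show "X \<circ> Y \<in> schatten 1" "schatten_norm 1 (X \<circ> Y) \<le> schatten_norm 2 X * schatten_norm 2 Y" by auto
qed

section \<open>The Hilbert space of Hilbert-Schmidt operators\<close>

lemma schatten_2_triangle:
  fixes X Y :: "'a::chilbert_space \<Rightarrow> 'a"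
  assumes X: "X \<in> schatten 2" and Y: "Y \<in> schatten 2"
  shows "schatten_norm 2 (\<lambda>v. X v + Y v) \<le> schatten_norm 2 X + schatten_norm 2 Y"
proof -
  obtain E where E: "orthonormal_basis (E :: 'a set)" by (rule orthonormal_basis_exists)
  define a b where "a = schatten_norm 2 X" and "b = schatten_norm 2 Y"
  have ab: "a \<ge> 0" "b \<ge> 0" by (simp_all add: a_def b_def schatten_norm_nonneg)
  have "(schatten_norm 2 (\<lambda>v. X v + Y v))\<^sup>2 \<le> (a + b)\<^sup>2"
  proof (rule has_sum_le_finite_sums[OF schatten_2_has_sum[OF schatten_2_add[OF X Y] E]])
    fix F assume F: "finite F" "F \<subseteq> E"
    have part: "L2_set (\<lambda>e. norm (Z e)) F \<le> schatten_norm 2 Z" if Z: "Z \<in> schatten 2" for Z :: "'a \<Rightarrow> 'a"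
      unfolding L2_set_def
      using F finite_sum_le_has_sum[OF schatten_2_has_sum[OF Z E]] schatten_norm_nonneg[of 2 Z]
      by (intro real_le_lsqrt) (auto simp: sum_nonneg)
    have "L2_set (\<lambda>e. norm (X e + Y e)) F \<le> L2_set (\<lambda>e. norm (X e) + norm (Y e)) F"
      by (intro L2_set_mono norm_triangle_ineq) simp
    also have "\<dots> \<le> L2_set (\<lambda>e. norm (X e)) F + L2_set (\<lambda>e. norm (Y e)) F" by (rule L2_set_triangle_ineq)
    also have "\<dots> \<le> a + b" unfolding a_def b_def by (intro add_mono part X Y)
    finally have "(L2_set (\<lambda>e. norm (X e + Y e)) F)\<^sup>2 \<le> (a + b)\<^sup>2"
      by (intro power_mono) (auto simp: L2_set_nonneg)
    then show "(\<Sum>e\<in>F. (norm (X e + Y e))\<^sup>2) \<le> (a + b)\<^sup>2" by (simp add: L2_set_def sum_nonneg)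
  qed
  then show ?thesis using ab power2_le_imp_le[OF _ add_nonneg_nonneg[OF ab]] unfolding a_def b_def by blast
qed

lemma schatten_norm_2_scaleC:
  fixes X :: "'a::chilbert_space \<Rightarrow> 'a"
  assumes X: "X \<in> schatten 2"
  shows "schatten_norm 2 (\<lambda>v. c *\<^sub>C X v) = cmod c * schatten_norm 2 X"
proof -
  obtain E where E: "orthonormal_basis (E :: 'a set)" by (rule orthonormal_basis_exists)
  have "((\<lambda>e. (norm (c *\<^sub>C X e))\<^sup>2) has_sum ((cmod c)\<^sup>2 * (schatten_norm 2 X)\<^sup>2)) E"
    using has_sum_cmult_right[OF schatten_2_has_sum[OF X E], of "(cmod c)\<^sup>2"]
    by (simp add: norm_scaleC power_mult_distrib)
  then have "(schatten_norm 2 (\<lambda>v. c *\<^sub>C X v))\<^sup>2 = (cmod c * schatten_norm 2 X)\<^sup>2"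
    using schatten_2_has_sum[OF schatten_2_scaleC[OF X] E] has_sum_unique
    by (metis (mono_tags, lifting) power_mult_distrib)
  then show ?thesis by (simp add: power2_eq_iff_nonneg schatten_norm_nonneg)
qed

section \<open>Linear, normed and complete structure of the type \<open>hs\<close>\<close>

lemma Rep_hs_zero: "Rep_hs (0 :: 'a::chilbert_space hs) = (\<lambda>_. 0)"
  unfolding zero_hs_def by (rule Abs_hs_inverse[OF zero_in_schatten])

lemma Rep_hs_plus: "Rep_hs (X + Y) = (\<lambda>v. Rep_hs X v + Rep_hs Y v)"
  unfolding plus_hs_def by (rule Abs_hs_inverse[OF schatten_2_add[OF Rep_hs Rep_hs]])

lemma Rep_hs_minus: "Rep_hs (X - Y) = (\<lambda>v. Rep_hs X v - Rep_hs Y v)"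
  unfolding minus_hs_def by (rule Abs_hs_inverse[OF schatten_2_diff[OF Rep_hs Rep_hs]])

lemma Rep_hs_scaleC: "Rep_hs (c *\<^sub>C X) = (\<lambda>v. c *\<^sub>C Rep_hs X v)"
  unfolding scaleC_hs_def by (rule Abs_hs_inverse[OF schatten_2_scaleC[OF Rep_hs]])

lemma hs_eqI: "(\<And>v. Rep_hs X v = Rep_hs Y v) \<Longrightarrow> X = Y"
  by (rule Rep_hs_inject[THEN iffD1]) (rule ext)

lemma cinner_hs_has_sum:
  "orthonormal_basis E \<Longrightarrow> ((\<lambda>e. cinner (Rep_hs X e) (Rep_hs Y e)) has_sum cinner X Y) E"
  unfolding cinner_hs_def by (rule op_trace_cadjoint_comp[OF Rep_hs Rep_hs])

text \<open>\<open>chilbert_space\<close> extends \<open>banach\<close>, so the real structure is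
  built first. Real scaling is defined through complex scaling, which turns
  \<open>scaleR_scaleC\<close> into a definition.\<close>

instantiation hs :: (chilbert_space) real_vector
begin

definition "uminus X = (-1) *\<^sub>C (X :: 'a hs)"
definition "scaleR r X = complex_of_real r *\<^sub>C (X :: 'a hs)"

instance
  by standard
    (rule hs_eqI; simp add: Rep_hs_zero Rep_hs_plus Rep_hs_minus Rep_hs_scaleC uminus_hs_def
      scaleR_hs_def scaleC_add_left scaleC_add_right scaleC.minus_left algebra_simps)+

end

instantiation hs :: (chilbert_space) real_normed_vector
begin

definition "norm X = schatten_norm 2 (Rep_hs X)"
definition "sgn X = inverse (norm X) *\<^sub>R (X :: 'a hs)"
definition "dist X Y = norm (X - Y :: 'a hs)"
definition "(uniformity :: ('a hs \<times> 'a hs) filter) = (INF e\<in>{0<..}. principal {(X, Y). dist X Y < e})"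
definition "open (U :: 'a hs set) \<longleftrightarrow> (\<forall>X\<in>U. \<forall>\<^sub>F (X', Y) in uniformity. X' = X \<longrightarrow> Y \<in> U)"

instance
proof
  fix X Y :: "'a hs" and r :: real and U :: "'a hs set"
  show "dist X Y = norm (X - Y)" by (rule dist_hs_def)
  show "sgn X = inverse (norm X) *\<^sub>R X" by (rule sgn_hs_def)
  show "uniformity = (INF e\<in>{0<..}. principal {(X :: 'a hs, Y). dist X Y < e})" by (rule uniformity_hs_def)
  show "open U \<longleftrightarrow> (\<forall>X\<in>U. \<forall>\<^sub>F (X', Y) in uniformity. X' = X \<longrightarrow> Y \<in> U)" by (rule open_hs_def)
  show "norm (X + Y) \<le> norm X + norm Y"
    by (simp add: norm_hs_def Rep_hs_plus schatten_2_triangle[OF Rep_hs Rep_hs])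
  have scale: "norm (c *\<^sub>C X) = cmod c * norm X" for c
    by (simp add: norm_hs_def Rep_hs_scaleC schatten_norm_2_scaleC[OF Rep_hs])
  then show "norm (r *\<^sub>R X) = \<bar>r\<bar> * norm X" by (simp add: scaleR_hs_def)
  show "norm X = 0 \<longleftrightarrow> X = 0"
  proof
    assume "norm X = 0"
    then have "Rep_hs X v = 0" for v
      using norm_le_schatten_2[OF Rep_hs[of X], of v] by (simp add: norm_hs_def)
    then show "X = 0" by (intro hs_eqI) (simp add: Rep_hs_zero)
  next
    have "0 *\<^sub>C X = 0" by (rule hs_eqI) (simp add: Rep_hs_scaleC Rep_hs_zero)
    moreover assume "X = 0"
    ultimately show "norm X = 0" using scale[of 0] by simp
  qed
qed

end

lemma norm_Rep_hs_le: "norm (Rep_hs X v) \<le> norm X * norm v"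
  unfolding norm_hs_def by (rule norm_le_schatten_2[OF Rep_hs])

text \<open>A Cauchy sequence converges at each vector because the Hilbert-Schmidt norm dominates
  the operator norm. That the pointwise limit \<open>L\<close> is also the limit in norm follows as
  in Fatou's lemma, by bounding finite partial sums before letting \<open>m\<close> tend to
  infinity.\<close>

instance hs :: (chilbert_space) banach
proof
  fix X :: "nat \<Rightarrow> 'a hs" assume X: "Cauchy X"
  define L where "L v = lim (\<lambda>n. Rep_hs (X n) v)" for v
  have L: "(\<lambda>n. Rep_hs (X n) v) \<longlonglongrightarrow> L v" for v
  proof -
    have "Cauchy (\<lambda>n. Rep_hs (X n) v)"
      unfolding Cauchy_iff
    proof (intro allI impI)
      fix \<epsilon> :: real assume "\<epsilon> > 0"
      then obtain N where N: "\<And>m n. m \<ge> N \<Longrightarrow> n \<ge> N \<Longrightarrow> norm (X m - X n) < \<epsilon> / (norm v + 1)"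
        using X unfolding Cauchy_iff by (metis add_nonneg_pos divide_pos_pos norm_ge_zero zero_less_one)
      have "norm (Rep_hs (X m) v - Rep_hs (X n) v) < \<epsilon>" if "m \<ge> N" "n \<ge> N" for m n
      proof -
        have "norm (Rep_hs (X m - X n) v) \<le> norm (X m - X n) * norm v" by (rule norm_Rep_hs_le)
        also have "\<dots> \<le> \<epsilon> / (norm v + 1) * norm v"
          using N[OF that] by (intro mult_right_mono) auto
        also have "\<dots> < \<epsilon>" using \<open>\<epsilon> > 0\<close>
          by (simp add: divide_simps) (smt (verit) norm_ge_zero)
        finally show ?thesis by (simp add: Rep_hs_minus)
      qed
      then show "\<exists>M. \<forall>m\<ge>M. \<forall>n\<ge>M. norm (Rep_hs (X m) v - Rep_hs (X n) v) < \<epsilon>" by blast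
    qed
    then show ?thesis unfolding L_def by (simp add: Cauchy_convergent_iff convergent_LIMSEQ_iff)
  qed
  have bX: "Rep_hs (X n) \<in> bounded_ops" for n by (rule schatten_bounded[OF Rep_hs])
  obtain K where K: "\<And>n. norm (X n) \<le> K"
    using Cauchy_Bseq[OF X] unfolding Bseq_def by blast
  have bL: "L \<in> bounded_ops"
  proof (rule bounded_opsI)
    show "L (u + v) = L u + L v" for u v
      using tendsto_add[OF L[of u] L[of v]] L[of "u + v"] bounded_opsD[OF bX]
      by (simp add: linear_simps LIMSEQ_unique)
    show "L (c *\<^sub>C v) = c *\<^sub>C L v" for c v
      using scaleC.tendsto[OF tendsto_const L[of v], of c] L[of "c *\<^sub>C v"] bounded_opsD_scaleC[OF bX]
      by (simp add: LIMSEQ_unique)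
    show "norm (L v) \<le> K * norm v" for v
    proof (rule tendsto_upperbound[OF tendsto_norm[OF L]])
      show "\<forall>\<^sub>F n in sequentially. norm (Rep_hs (X n) v) \<le> K * norm v"
        by (intro always_eventually allI order_trans[OF norm_Rep_hs_le] mult_right_mono[OF K norm_ge_zero])
    qed simp
  qed
  obtain E where E: "orthonormal_basis (E :: 'a set)" by (rule orthonormal_basis_exists)
  \<comment> \<open>Membership is part of the claim: from the difference to \<open>L\<close> being
    Hilbert-Schmidt, \<open>L2\<close> recovers \<open>L\<close> itself as
    \<open>Rep_hs (X N)\<close> minus that difference.\<close>
  have close: "(\<lambda>v. Rep_hs (X n) v - L v) \<in> schatten 2 \<and> schatten_norm 2 (\<lambda>v. Rep_hs (X n) v - L v) \<le> \<epsilon>"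
    if n: "n \<ge> N" and N: "\<And>m n. m \<ge> N \<Longrightarrow> n \<ge> N \<Longrightarrow> norm (X m - X n) < \<epsilon>" for n N \<epsilon>
  proof -
    have \<epsilon>: "\<epsilon> > 0" using N[OF n n] by simp
    define D where "D v = Rep_hs (X n) v - L v" for v
    have le: "(\<Sum>e\<in>F. (norm (D e))\<^sup>2) \<le> \<epsilon>\<^sup>2" if F: "finite F" "F \<subseteq> E" for F
    proof (rule tendsto_upperbound)
      show "(\<lambda>m. \<Sum>e\<in>F. (norm (Rep_hs (X n) e - Rep_hs (X m) e))\<^sup>2) \<longlonglongrightarrow> (\<Sum>e\<in>F. (norm (D e))\<^sup>2)"
        unfolding D_def by (intro tendsto_intros L)
      have "(\<Sum>e\<in>F. (norm (Rep_hs (X n) e - Rep_hs (X m) e))\<^sup>2) \<le> \<epsilon>\<^sup>2" if "m \<ge> N" for m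
      proof -
        have "(\<Sum>e\<in>F. (norm (Rep_hs (X n - X m) e))\<^sup>2) \<le> (norm (X n - X m))\<^sup>2"
          unfolding norm_hs_def
          using F by (intro finite_sum_le_has_sum[OF schatten_2_has_sum[OF Rep_hs E]]) auto
        also have "\<dots> \<le> \<epsilon>\<^sup>2" using N[OF n that] by (intro power_mono) auto
        finally show ?thesis by (simp add: Rep_hs_minus)
      qed
      then show "\<forall>\<^sub>F m in sequentially. (\<Sum>e\<in>F. (norm (Rep_hs (X n) e - Rep_hs (X m) e))\<^sup>2) \<le> \<epsilon>\<^sup>2"
        using eventually_sequentially by blast
    qed simp
    have bD: "D \<in> bounded_ops" unfolding D_def[abs_def] by (rule bounded_ops_diff[OF bX bL])
    have "(\<lambda>e. (norm (D e))\<^sup>2) summable_on E"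
      using le by (intro nonneg_bdd_above_summable_on bdd_aboveI[of _ "\<epsilon>\<^sup>2"]) auto
    then have D: "D \<in> schatten 2" by (rule schatten_2_summableI[OF bD E])
    have "(schatten_norm 2 D)\<^sup>2 \<le> \<epsilon>\<^sup>2"
      by (rule has_sum_le_finite_sums[OF schatten_2_has_sum[OF D E]]) (use le in blast)
    then have "schatten_norm 2 D \<le> \<epsilon>" using \<epsilon> by (simp add: power2_le_iff_abs_le)
    then show ?thesis using D by (simp add: D_def[abs_def])
  qed
  have L2: "L \<in> schatten 2"
  proof -
    obtain N where N: "\<And>m n. m \<ge> N \<Longrightarrow> n \<ge> N \<Longrightarrow> norm (X m - X n) < 1"
      using X[unfolded Cauchy_iff, rule_format, OF zero_less_one] by blast
    have "(\<lambda>v. Rep_hs (X N) v - (Rep_hs (X N) v - L v)) \<in> schatten 2"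
      by (rule schatten_2_diff[OF Rep_hs conjunct1[OF close[OF order_refl N]]])
    then show ?thesis by simp
  qed
  have "X \<longlonglongrightarrow> Abs_hs L"
    unfolding lim_sequentially
  proof (intro allI impI)
    fix \<epsilon> :: real assume "\<epsilon> > 0"
    then obtain N where N: "\<And>m n. m \<ge> N \<Longrightarrow> n \<ge> N \<Longrightarrow> norm (X m - X n) < \<epsilon> / 2"
      using X unfolding Cauchy_iff by (metis half_gt_zero)
    have "dist (X n) (Abs_hs L) < \<epsilon>" if "n \<ge> N" for n
    proof -
      have "dist (X n) (Abs_hs L) = schatten_norm 2 (\<lambda>v. Rep_hs (X n) v - L v)"
        by (simp add: dist_norm norm_hs_def Rep_hs_minus Abs_hs_inverse[OF L2])
      also have "\<dots> \<le> \<epsilon> / 2" using close[OF that N] by blast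
      finally show ?thesis using \<open>\<epsilon> > 0\<close> by simp
    qed
    then show "\<exists>N. \<forall>n\<ge>N. dist (X n) (Abs_hs L) < \<epsilon>" by blast
  qed
  then show "convergent X" by (auto simp: convergent_def)
qed

text \<open>From here on everything proved for an arbitrary \<open>chilbert_space\<close> holds for
  operators on \<open>hs\<close>. Each axiom on \<open>cinner\<close> is read off termwise from the
  sum over one fixed basis.\<close>

instance hs :: (chilbert_space) chilbert_space
proof
  fix X Y Z :: "'a hs" and c d :: complex and r :: real
  obtain E where E: "orthonormal_basis (E :: 'a set)" by (rule orthonormal_basis_exists)
  note hs = cinner_hs_has_sum[OF E]
  show "c *\<^sub>C (X + Y) = c *\<^sub>C X + c *\<^sub>C Y"
    by (rule hs_eqI) (simp add: Rep_hs_plus Rep_hs_scaleC scaleC_add_right)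
  show "(c + d) *\<^sub>C X = c *\<^sub>C X + d *\<^sub>C X"
    by (rule hs_eqI) (simp add: Rep_hs_plus Rep_hs_scaleC scaleC_add_left)
  show "c *\<^sub>C d *\<^sub>C X = (c * d) *\<^sub>C X"
    by (rule hs_eqI) (simp add: Rep_hs_scaleC)
  show "r *\<^sub>R X = complex_of_real r *\<^sub>C X" by (rule scaleR_hs_def)
  have "((\<lambda>e. cnj (cinner (Rep_hs Y e) (Rep_hs X e))) has_sum cnj (cinner Y X)) E"
    unfolding has_sum_cnj_iff by (rule hs)
  then have "((\<lambda>e. cinner (Rep_hs X e) (Rep_hs Y e)) has_sum cnj (cinner Y X)) E"
    by (rule has_sum_cong[THEN iffD1, rotated]) (rule cinner_commute[symmetric])
  then show "cinner X Y = cnj (cinner Y X)" using hs has_sum_unique by blast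
  show "cinner X (Y + Z) = cinner X Y + cinner X Z"
    using has_sum_add[OF hs[of X Y] hs[of X Z]] hs[of X "Y + Z"]
    by (simp add: Rep_hs_plus cinner_add_right has_sum_unique)
  show "cinner X (c *\<^sub>C Y) = c * cinner X Y"
    using has_sum_cmult_right[OF hs[of X Y], of c] hs[of X "c *\<^sub>C Y"]
    by (simp add: Rep_hs_scaleC cinner_scaleC_right has_sum_unique)
  have "((\<lambda>e. complex_of_real ((norm (Rep_hs X e))\<^sup>2)) has_sum complex_of_real ((norm X)\<^sup>2)) E"
    unfolding norm_hs_def by (intro has_sum_of_real schatten_2_has_sum[OF Rep_hs E])
  then show "cinner X X = complex_of_real ((norm X)\<^sup>2)"
    using hs[of X X] by (simp add: cinner_self has_sum_unique)
qed

section \<open>Rank one elements of \<open>hs\<close>\<close>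

definition rank_one :: "'a::chilbert_space \<Rightarrow> 'a \<Rightarrow> 'a \<Rightarrow> 'a" where
  "rank_one a b v = cinner b v *\<^sub>C a"

definition hs_rank_one :: "'a::chilbert_space \<Rightarrow> 'a \<Rightarrow> 'a hs" where
  "hs_rank_one a b = Abs_hs (rank_one a b)"

lemma rank_one_schatten_1: "rank_one a b \<in> schatten 1" "schatten_norm 1 (rank_one a b) \<le> norm a * norm b"
proof -
  have "nuclear_rep {()} (\<lambda>_. a) (\<lambda>_. b) (rank_one a b)"
    by (auto simp: nuclear_rep_def rank_one_def intro!: has_sum_finiteI)
  from nuclear_rep_schatten_1[OF this]
  show "rank_one a b \<in> schatten 1" "schatten_norm 1 (rank_one a b) \<le> norm a * norm b" by simp_all
qed

lemma Rep_hs_rank_one: "Rep_hs (hs_rank_one a b) = rank_one a b"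
  unfolding hs_rank_one_def by (rule Abs_hs_inverse[OF schatten_1_subset_2(1)[OF rank_one_schatten_1(1)]])

text \<open>Inner products with rank one elements are thus the matrix entries of \<open>Z\<close>.
  Expanding \<open>b\<close> in a basis produces the terms of the sum that computes the inner
  product of \<open>hs\<close>.\<close>

lemma cinner_hs_rank_one: "cinner (hs_rank_one a b) Z = cinner a (Rep_hs Z (b :: 'a::chilbert_space))"
proof -
  obtain E where E: "orthonormal_basis (E :: 'a set)" by (rule orthonormal_basis_exists)
  note bZ = schatten_bounded[OF Rep_hs[of Z]]
  have "((\<lambda>e. cinner a (Rep_hs Z (cinner e b *\<^sub>C e))) has_sum cinner a (Rep_hs Z b)) E"
    by (intro has_sum_cinner_right has_sum_bounded_ops[OF bZ] basis_expansion[OF E])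
  moreover have "cinner a (Rep_hs Z (cinner e b *\<^sub>C e)) = cinner (Rep_hs (hs_rank_one a b) e) (Rep_hs Z e)" for e
    by (simp add: Rep_hs_rank_one rank_one_def bounded_opsD_scaleC[OF bZ] cinner_scaleC_left
        cinner_scaleC_right cinner_commute[of e b])
  ultimately show ?thesis
    using cinner_hs_has_sum[OF E, of "hs_rank_one a b" Z] has_sum_unique by auto
qed

lemma cinner_hs_rank_one_rank_one:
  "cinner (hs_rank_one a b) (hs_rank_one c d) = cinner a c * cinner d b"
  by (simp add: cinner_hs_rank_one Rep_hs_rank_one rank_one_def cinner_scaleC_right)

lemma norm_hs_rank_one: "norm (hs_rank_one a b) = norm a * norm b"
proof -
  have "complex_of_real ((norm (hs_rank_one a b))\<^sup>2) = complex_of_real ((norm a * norm b)\<^sup>2)"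
    by (simp add: cinner_self[symmetric] cinner_hs_rank_one_rank_one del: of_real_power)
       (simp add: cinner_self power_mult_distrib)
  then have "(norm (hs_rank_one a b))\<^sup>2 = (norm a * norm b)\<^sup>2"
    using of_real_eq_iff by blast
  then show ?thesis by (simp add: power2_eq_iff_nonneg)
qed

text \<open>Inner products of rank one elements factor, with the second pair in reversed order.
  Injectivity is recorded because sums over this image are reindexed by
  \<open>E \<times> F\<close>.\<close>

lemma hs_rank_one_orthonormal:
  fixes E F :: "'a::chilbert_space set"
  assumes E: "orthonormal E" and F: "orthonormal F"
  shows "orthonormal ((\<lambda>(e, f). hs_rank_one e f) ` (E \<times> F))"
    and "inj_on (\<lambda>(e, f). hs_rank_one e f) (E \<times> F)"
proof -
  have ip: "cinner (hs_rank_one e f) (hs_rank_one e' f') = (if e = e' \<and> f = f' then 1 else 0)"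
    if "e \<in> E" "e' \<in> E" "f \<in> F" "f' \<in> F" for e e' f f'
  proof -
    have "cinner e e' = (if e = e' then 1 else 0)" "cinner f' f = (if f' = f then 1 else 0)"
      by (rule E[unfolded orthonormal_def, rule_format, OF that(1,2)],
          rule F[unfolded orthonormal_def, rule_format, OF that(4,3)])
    then show ?thesis by (simp add: cinner_hs_rank_one_rank_one)
  qed
  have inj: "e = e' \<and> f = f'" if "e \<in> E" "e' \<in> E" "f \<in> F" "f' \<in> F"
    "hs_rank_one e f = hs_rank_one e' f'" for e e' f f'
  proof -
    have "cinner (hs_rank_one e f) (hs_rank_one e' f') = 1"
      using ip[OF that(1,1,3,3)] unfolding that(5)[symmetric] by simp
    then show ?thesis unfolding ip[OF that(1-4)] by (metis zero_neq_one)
  qed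
  then show "inj_on (\<lambda>(e, f). hs_rank_one e f) (E \<times> F)" by (auto simp: inj_on_def)
  show "orthonormal ((\<lambda>(e, f). hs_rank_one e f) ` (E \<times> F))"
    unfolding orthonormal_def
  proof (intro ballI)
    fix U V assume "U \<in> (\<lambda>(e, f). hs_rank_one e f) ` (E \<times> F)" "V \<in> (\<lambda>(e, f). hs_rank_one e f) ` (E \<times> F)"
    then obtain e f e' f' where *: "e \<in> E" "e' \<in> E" "f \<in> F" "f' \<in> F"
      and UV: "U = hs_rank_one e f" "V = hs_rank_one e' f'" by auto
    have "U = V \<longleftrightarrow> e = e' \<and> f = f'" unfolding UV using inj[OF *] by auto
    then show "cinner U V = (if U = V then 1 else 0)" unfolding UV by (simp only: ip[OF *])
  qed
qed

lemma hs_rank_one_basis: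
  fixes E F :: "'a::chilbert_space set"
  assumes E: "orthonormal_basis E" and F: "orthonormal_basis F"
  shows "orthonormal_basis ((\<lambda>(e, f). hs_rank_one e f) ` (E \<times> F))"
proof -
  have "Z = 0" if Z: "\<And>e f. e \<in> E \<Longrightarrow> f \<in> F \<Longrightarrow> cinner (hs_rank_one e f) Z = 0" for Z
  proof (rule hs_eqI)
    fix v
    note bZ = schatten_bounded[OF Rep_hs[of Z]]
    have "Rep_hs Z f = 0" if "f \<in> F" for f
      using E Z that by (simp add: cinner_hs_rank_one orthonormal_basis_def)
    moreover have "((\<lambda>f. cinner f v *\<^sub>C Rep_hs Z f) has_sum Rep_hs Z v) F"
      using has_sum_bounded_ops[OF bZ basis_expansion[OF F, of v]] by (simp add: bounded_opsD_scaleC[OF bZ])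
    ultimately have "Rep_hs Z v = 0"
      by (metis (no_types, lifting) has_sum_0 has_sum_unique scaleC_zero_right)
    then show "Rep_hs Z v = Rep_hs 0 v" by (simp add: Rep_hs_zero)
  qed
  then show ?thesis
    using hs_rank_one_orthonormal(1)[OF orthonormal_basisD[OF E] orthonormal_basisD[OF F]]
    unfolding orthonormal_basis_def by blast
qed

section \<open>Operators on the Hilbert-Schmidt operators\<close>

lemma schatten_2_comp_right_norm:
  fixes X K :: "'a::chilbert_space \<Rightarrow> 'a"
  assumes X: "X \<in> schatten 2" and K: "K \<in> bounded_ops"
    and C: "\<And>v. norm (cadjoint K v) \<le> C * norm v"
  shows "schatten_norm 2 (X \<circ> K) \<le> C * schatten_norm 2 X"
proof -
  have "schatten_norm 2 (X \<circ> K) = schatten_norm 2 (cadjoint (X \<circ> K))"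
    by (rule schatten_cadjoint(2)[symmetric, OF schatten_2_comp_right[OF X K]]) simp
  also have "\<dots> = schatten_norm 2 (cadjoint K \<circ> cadjoint X)"
    by (simp add: cadjoint_comp[OF schatten_bounded[OF X] K])
  also have "\<dots> \<le> C * schatten_norm 2 (cadjoint X)"
    by (rule schatten_2_comp_left(2)[OF cadjoint_bounded[OF K] C schatten_cadjoint(1)[OF X]]) simp
  also have "schatten_norm 2 (cadjoint X) = schatten_norm 2 X"
    by (rule schatten_cadjoint(2)[OF X]) simp
  finally show ?thesis .
qed

section \<open>The map sending \<open>Z\<close> to \<open>A \<circ> Z \<circ> C\<close> and its
  singular system\<close>

lemma sandwich_schatten_2:
  fixes A C Z :: "'a::chilbert_space \<Rightarrow> 'a"
  assumes A: "A \<in> bounded_ops" and C: "C \<in> bounded_ops" and Z: "Z \<in> schatten 2"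
  shows "A \<circ> Z \<circ> C \<in> schatten 2"
proof -
  obtain K where "\<And>v. norm (A v) \<le> K * norm v" using bounded_ops_norm[OF A] by blast
  then show ?thesis by (intro schatten_2_comp_right schatten_2_comp_left(1) A C Z)
qed

lemma Rep_hs_sandwich:
  assumes "A \<in> bounded_ops" "C \<in> bounded_ops"
  shows "Rep_hs (on_hs (\<lambda>Z. A \<circ> Z \<circ> C) W) = A \<circ> Rep_hs W \<circ> C"
  unfolding on_hs_def by (rule Abs_hs_inverse[OF sandwich_schatten_2[OF assms Rep_hs]])

lemma hs_sandwich_bounded:
  fixes A C :: "'a::chilbert_space \<Rightarrow> 'a"
  assumes A: "A \<in> bounded_ops" and C: "C \<in> bounded_ops"
  shows "on_hs (\<lambda>Z. A \<circ> Z \<circ> C) \<in> bounded_ops"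
proof -
  obtain K where K: "K > 0" "\<And>v. norm (A v) \<le> K * norm v" using bounded_ops_norm[OF A] by blast
  obtain L where L: "L > 0" "\<And>v. norm (cadjoint C v) \<le> L * norm v"
    using bounded_ops_norm[OF cadjoint_bounded[OF C]] by blast
  note lin = bounded_opsD[OF A]
  show ?thesis
  proof (rule bounded_opsI[where C = "K * L"])
    show "on_hs (\<lambda>Z. A \<circ> Z \<circ> C) (U + V) = on_hs (\<lambda>Z. A \<circ> Z \<circ> C) U + on_hs (\<lambda>Z. A \<circ> Z \<circ> C) V" for U V
      by (rule hs_eqI) (simp add: Rep_hs_sandwich[OF A C] Rep_hs_plus linear_simps[OF lin])
    show "on_hs (\<lambda>Z. A \<circ> Z \<circ> C) (c *\<^sub>C U) = c *\<^sub>C on_hs (\<lambda>Z. A \<circ> Z \<circ> C) U" for c U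
      by (rule hs_eqI) (simp add: Rep_hs_sandwich[OF A C] Rep_hs_scaleC bounded_opsD_scaleC[OF A])
    show "norm (on_hs (\<lambda>Z. A \<circ> Z \<circ> C) U) \<le> K * L * norm U" for U
    proof -
      have "norm (on_hs (\<lambda>Z. A \<circ> Z \<circ> C) U) = schatten_norm 2 (A \<circ> Rep_hs U \<circ> C)"
        by (simp add: norm_hs_def Rep_hs_sandwich[OF A C])
      also have "\<dots> \<le> L * schatten_norm 2 (A \<circ> Rep_hs U)"
        by (rule schatten_2_comp_right_norm[OF schatten_2_comp_left(1)[OF A K(2) Rep_hs] C L(2)])
      also have "\<dots> \<le> L * (K * schatten_norm 2 (Rep_hs U))"
        using L(1) by (intro mult_left_mono schatten_2_comp_left(2)[OF A K(2) Rep_hs]) auto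
      finally show ?thesis by (simp add: norm_hs_def ac_simps)
    qed
  qed
qed

lemma sandwich_rank_one:
  fixes A C :: "'a::chilbert_space \<Rightarrow> 'a"
  assumes "A \<in> bounded_ops" "C \<in> bounded_ops"
  shows "A \<circ> rank_one a b \<circ> C = rank_one (A a) (cadjoint C b)"
  by (rule ext) (simp add: rank_one_def bounded_opsD_scaleC[OF assms(1)] cinner_cadjoint_left[OF assms(2)])

lemma hs_sandwich_rank_one:
  fixes A C :: "'a::chilbert_space \<Rightarrow> 'a"
  assumes "A \<in> bounded_ops" "C \<in> bounded_ops"
  shows "on_hs (\<lambda>Z. A \<circ> Z \<circ> C) (hs_rank_one a b) = hs_rank_one (A a) (cadjoint C b)"
  by (rule hs_eqI) (simp add: Rep_hs_sandwich[OF assms] Rep_hs_rank_one sandwich_rank_one[OF assms])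

text \<open>The second vector of a rank one element is moved by \<open>cadjoint C\<close>, which is
  why a system of \<open>cadjoint C\<close>, not of \<open>C\<close>, enters. Eigenvalues multiply
  because the norm of a rank one element is a product.\<close>

lemma hs_sandwich_sv_system:
  fixes A C :: "'a::chilbert_space \<Rightarrow> 'a"
  assumes A: "A \<in> bounded_ops" and C: "C \<in> bounded_ops"
    and F: "sv_system A F" and G: "sv_system (cadjoint C) G"
  shows "sv_system (on_hs (\<lambda>Z. A \<circ> Z \<circ> C)) ((\<lambda>(f, g). hs_rank_one f g) ` (F \<times> G))"
proof -
  define T where "T = on_hs (\<lambda>Z. A \<circ> Z \<circ> C)"
  have bT: "T \<in> bounded_ops" unfolding T_def by (rule hs_sandwich_bounded[OF A C])
  note cC = cadjoint_bounded[OF C]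
  have T_R: "T (hs_rank_one a b) = hs_rank_one (A a) (cadjoint C b)" for a b
    unfolding T_def by (rule hs_sandwich_rank_one[OF A C])
  have nz: "T (hs_rank_one f g) \<noteq> 0" if "f \<in> F" "g \<in> G" for f g
  proof -
    have "norm (T (hs_rank_one f g)) \<noteq> 0"
      unfolding T_R norm_hs_rank_one
      using sv_system_nonzero[OF F that(1)] sv_system_nonzero[OF G that(2)] by simp
    then show ?thesis by auto
  qed
  \<comment> \<open>The adjoint of \<open>T\<close> is known through its pairing only, so the
    eigenvalue equation is tested against an arbitrary \<open>V\<close>. The squared singular values
    for \<open>f\<close> and \<open>g\<close> come out one after the other.\<close>
  have eigen: "cadjoint T (T (hs_rank_one f g)) =
      complex_of_real ((norm (T (hs_rank_one f g)))\<^sup>2) *\<^sub>C hs_rank_one f g" if f: "f \<in> F" and g: "g \<in> G" for f g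
  proof (rule cinner_ext)
    fix V
    have "cinner (T (hs_rank_one f g)) (T V) = cinner (A f) (A (Rep_hs V (C (cadjoint C g))))"
      unfolding T_R cinner_hs_rank_one by (simp add: T_def Rep_hs_sandwich[OF A C])
    also have "\<dots> = complex_of_real ((norm (A f))\<^sup>2) * cinner f (Rep_hs V (C (cadjoint C g)))"
      by (rule sv_system_cinner_image[OF A F f])
    also have "C (cadjoint C g) = complex_of_real ((norm (cadjoint C g))\<^sup>2) *\<^sub>C g"
      using sv_system_eigen[OF G g] C by simp
    also have "Rep_hs V \<dots> = complex_of_real ((norm (cadjoint C g))\<^sup>2) *\<^sub>C Rep_hs V g"
      by (rule bounded_opsD_scaleC[OF schatten_bounded[OF Rep_hs]])
    finally have "cinner (T (hs_rank_one f g)) (T V) =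
        complex_of_real ((norm (T (hs_rank_one f g)))\<^sup>2) * cinner (hs_rank_one f g) V"
      unfolding T_R norm_hs_rank_one cinner_hs_rank_one
      by (simp add: cinner_scaleC_right power_mult_distrib)
    then have "cinner (cadjoint T (T (hs_rank_one f g))) V =
        cinner (complex_of_real ((norm (T (hs_rank_one f g)))\<^sup>2) *\<^sub>C hs_rank_one f g) V"
      by (simp add: cinner_cadjoint_left[OF bT] cinner_scaleC_left)
    then show "cinner V (cadjoint T (T (hs_rank_one f g))) =
        cinner V (complex_of_real ((norm (T (hs_rank_one f g)))\<^sup>2) *\<^sub>C hs_rank_one f g)"
      using cinner_commute by metis
  qed
  have vanish: "T W = 0" if W: "\<And>f g. f \<in> F \<Longrightarrow> g \<in> G \<Longrightarrow> cinner (hs_rank_one f g) W = 0" for W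
  proof (rule hs_eqI)
    fix v
    define L where "L = A \<circ> Rep_hs W"
    have bL: "L \<in> bounded_ops" unfolding L_def by (rule bounded_ops_comp[OF A schatten_bounded[OF Rep_hs]])
    \<comment> \<open>One side at a time: the system of \<open>A\<close> shows that \<open>L\<close>
      kills \<open>G\<close>, and then the system of \<open>cadjoint C\<close>, applied to values of
      the adjoint of \<open>L\<close>, shows that \<open>L \<circ> C\<close> is zero.\<close>
    have Lg: "L g = 0" if "g \<in> G" for g
      unfolding L_def o_def using W that by (intro sv_system_vanish[OF F]) (simp add: cinner_hs_rank_one)
    have "cadjoint C (cadjoint L u) = 0" for u
    proof (rule sv_system_vanish[OF G])
      show "cinner g (cadjoint L u) = 0" if "g \<in> G" for g
        using Lg[OF that] by (simp add: cinner_cadjoint_right[OF bL])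
    qed
    then have "cinner u (L (C v)) = cinner u 0" for u
      using cinner_cadjoint_left[OF bL, of u "C v"] cinner_cadjoint_left[OF C, of "cadjoint L u" v] by simp
    then have "L (C v) = 0" by (rule cinner_ext)
    then show "Rep_hs (T W) v = Rep_hs 0 v"
      by (simp add: T_def Rep_hs_sandwich[OF A C] Rep_hs_zero L_def)
  qed
  show ?thesis
    unfolding sv_system_def T_def[symmetric]
  proof (intro conjI allI impI)
    show "orthonormal ((\<lambda>(f, g). hs_rank_one f g) ` (F \<times> G))"
      by (rule hs_rank_one_orthonormal(1)[OF sv_system_orthonormal[OF F] sv_system_orthonormal[OF G]])
    show "\<forall>e\<in>(\<lambda>(f, g). hs_rank_one f g) ` (F \<times> G).
        T e \<noteq> 0 \<and> cadjoint T (T e) = complex_of_real ((norm (T e))\<^sup>2) *\<^sub>C e"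
      using nz eigen by auto
    show "T W = 0" if "\<forall>e\<in>(\<lambda>(f, g). hs_rank_one f g) ` (F \<times> G). cinner e W = 0" for W
      using that by (intro vanish) auto
  qed
qed

lemma has_sum_product:
  fixes f :: "'i \<Rightarrow> 'b::{banach, real_normed_algebra}" and g :: "'j \<Rightarrow> 'b"
  assumes f: "(f has_sum a) I" and g: "(g has_sum b) J"
    and s: "(\<lambda>(i, j). f i * g j) summable_on I \<times> J"
  shows "((\<lambda>(i, j). f i * g j) has_sum a * b) (I \<times> J)"
  by (rule has_sum_SigmaI[where g = "\<lambda>i. f i * b"])
     (auto intro: has_sum_cmult_right g has_sum_cmult_left f s)

lemma summable_on_product:
  fixes f :: "'i \<Rightarrow> real" and g :: "'j \<Rightarrow> real"
  assumes f: "f summable_on I" and g: "g summable_on J"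
    and nonneg: "\<And>i. i \<in> I \<Longrightarrow> f i \<ge> 0" "\<And>j. j \<in> J \<Longrightarrow> g j \<ge> 0"
  shows "(\<lambda>(i, j). f i * g j) summable_on I \<times> J"
  by (rule summable_on_SigmaI[where g = "\<lambda>i. f i * infsum g J"])
     (use nonneg in \<open>auto intro!: has_sum_cmult_right has_sum_infsum summable_on_cmult_left g f
       mult_nonneg_nonneg\<close>)

text \<open>Systems are taken for \<open>cadjoint X\<close> and \<open>cadjoint Y\<close>, the
  operators acting on the two vectors of a rank one element; passing between an operator and its
  adjoint changes no Schatten norm. The sum of the powers is then a product of two sums, for every
  \<open>p > 0\<close>.\<close>

lemma schatten_hs_sandwich:
  fixes X Y :: "'a::chilbert_space \<Rightarrow> 'a"
  assumes p: "p > 0" and X: "X \<in> schatten p" and Y: "Y \<in> schatten p"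
  shows "(\<lambda>Z. cadjoint X \<circ> Z \<circ> Y) \<in> schatten_on_hs p"
    and "schatten_norm p (on_hs (\<lambda>Z. cadjoint X \<circ> Z \<circ> Y)) = schatten_norm p X * schatten_norm p Y"
proof -
  note cX = schatten_cadjoint[OF X p] and cY = schatten_cadjoint[OF Y p]
  note bA = schatten_bounded[OF cX(1)] and bY = schatten_bounded[OF Y]
  define T where "T = on_hs (\<lambda>Z. cadjoint X \<circ> Z \<circ> Y)"
  obtain F c where F: "sv_system (cadjoint X) F" "((\<lambda>f. norm (cadjoint X f) powr p) has_sum c) F"
    "schatten_norm p (cadjoint X) = c powr (1 / p)" "c \<ge> 0" using schattenE[OF cX(1) p] by blast
  obtain G d where G: "sv_system (cadjoint Y) G" "((\<lambda>g. norm (cadjoint Y g) powr p) has_sum d) G"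
    "schatten_norm p (cadjoint Y) = d powr (1 / p)" "d \<ge> 0" using schattenE[OF cY(1) p] by blast
  have sv: "sv_system T ((\<lambda>(f, g). hs_rank_one f g) ` (F \<times> G))"
    unfolding T_def by (rule hs_sandwich_sv_system[OF bA bY F(1) G(1)])
  have inj: "inj_on (\<lambda>(f, g). hs_rank_one f g) (F \<times> G)"
    by (rule hs_rank_one_orthonormal(2)[OF sv_system_orthonormal[OF F(1)] sv_system_orthonormal[OF G(1)]])
  have "((\<lambda>(f, g). norm (cadjoint X f) powr p * norm (cadjoint Y g) powr p) has_sum c * d) (F \<times> G)"
    using F(2) G(2) by (intro has_sum_product summable_on_product) (auto simp: has_sum_imp_summable)
  then have "((\<lambda>e. norm (T e) powr p) has_sum c * d) ((\<lambda>(f, g). hs_rank_one f g) ` (F \<times> G))"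
    unfolding has_sum_reindex[OF inj] T_def
    by (rule has_sum_cong[THEN iffD1, rotated])
       (auto simp: hs_sandwich_rank_one[OF bA bY] norm_hs_rank_one powr_mult)
  from schattenI[OF _ sv p this]
  have T: "T \<in> schatten p" "schatten_norm p T = (c * d) powr (1 / p)"
    using hs_sandwich_bounded[OF bA bY] by (simp_all add: T_def)
  show "(\<lambda>Z. cadjoint X \<circ> Z \<circ> Y) \<in> schatten_on_hs p"
    using T(1) sandwich_schatten_2[OF bA bY] by (simp add: schatten_on_hs_def T_def)
  show "schatten_norm p (on_hs (\<lambda>Z. cadjoint X \<circ> Z \<circ> Y)) = schatten_norm p X * schatten_norm p Y"
    using T(2) F(3,4) G(3,4) cX(2) cY(2) by (simp add: T_def powr_mult)
qed

section \<open>Adjoints, compositions and sandwiches of nuclear representations\<close>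

lemma nuclear_rep_norm_summable:
  assumes "nuclear_rep I a b T"
  shows "(\<lambda>i. norm (a i) * norm (b i)) summable_on I"
  using assms by (simp add: nuclear_rep_def)

text \<open>The adjoint series converges absolutely to some \<open>S\<close>, and pairing with every
  \<open>u\<close> identifies \<open>S\<close>.\<close>

lemma nuclear_rep_cadjoint:
  assumes T: "nuclear_rep I a b T"
  shows "nuclear_rep I b a (cadjoint T)"
proof -
  note s = nuclear_rep_norm_summable[OF T] and bT = nuclear_rep_bounded[OF T]
  have "((\<lambda>i. cinner (a i) v *\<^sub>C b i) has_sum cadjoint T v) I" for v
  proof -
    have "(\<lambda>i. norm (cinner (a i) v *\<^sub>C b i)) summable_on I"
    proof (rule summable_on_comparison_test)
      show "(\<lambda>i. norm v * (norm (a i) * norm (b i))) summable_on I" by (rule summable_on_cmult_right[OF s])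
      show "norm (cinner (a i) v *\<^sub>C b i) \<le> norm v * (norm (a i) * norm (b i))" for i
        using mult_right_mono[OF Cauchy_Schwarz_cinner[of "a i" v] norm_ge_zero[of "b i"]]
        by (simp add: norm_scaleC ac_simps)
    qed simp
    from abs_summable_summable[OF this] obtain S where S: "((\<lambda>i. cinner (a i) v *\<^sub>C b i) has_sum S) I"
      unfolding summable_on_def by blast
    have "cinner u S = cinner u (cadjoint T v)" for u
    proof -
      have "((\<lambda>i. cinner (cinner (b i) u *\<^sub>C a i) v) has_sum cinner (T u) v) I"
        using T by (intro has_sum_cinner_left) (simp add: nuclear_rep_def)
      moreover have "cinner (cinner (b i) u *\<^sub>C a i) v = cinner u (cinner (a i) v *\<^sub>C b i)" for i
        by (simp add: cinner_scaleC_left cinner_scaleC_right cinner_commute[of u "b i"])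
      ultimately have "((\<lambda>i. cinner u (cinner (a i) v *\<^sub>C b i)) has_sum cinner (T u) v) I" by simp
      then show ?thesis
        using has_sum_cinner_right[OF S, of u] has_sum_unique by (simp add: cinner_cadjoint_right[OF bT]) blast
    qed
    then have "S = cadjoint T v" by (rule cinner_ext)
    then show ?thesis using S by simp
  qed
  then show ?thesis using s by (simp add: nuclear_rep_def mult.commute)
qed

lemma nuclear_rep_comp_left:
  fixes K :: "'a::chilbert_space \<Rightarrow> 'a"
  assumes K: "K \<in> bounded_ops" and T: "nuclear_rep I a b T"
  shows "nuclear_rep I (\<lambda>i. K (a i)) b (K \<circ> T)"
proof -
  obtain C where C: "C > 0" "\<And>v. norm (K v) \<le> C * norm v" using bounded_ops_norm[OF K] by blast
  have "(\<lambda>i. norm (K (a i)) * norm (b i)) summable_on I"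
  proof (rule summable_on_comparison_test)
    show "(\<lambda>i. C * (norm (a i) * norm (b i))) summable_on I"
      by (rule summable_on_cmult_right[OF nuclear_rep_norm_summable[OF T]])
    show "norm (K (a i)) * norm (b i) \<le> C * (norm (a i) * norm (b i))" for i
      using mult_right_mono[OF C(2)[of "a i"] norm_ge_zero[of "b i"]] by (simp add: ac_simps)
  qed simp
  moreover have "((\<lambda>i. cinner (b i) v *\<^sub>C K (a i)) has_sum K (T v)) I" for v
    using has_sum_bounded_ops[OF K, of "\<lambda>i. cinner (b i) v *\<^sub>C a i" I "T v"] T
    by (simp add: nuclear_rep_def bounded_opsD_scaleC[OF K])
  ultimately show ?thesis by (simp add: nuclear_rep_def)
qed

lemma nuclear_rep_comp_right:
  fixes K :: "'a::chilbert_space \<Rightarrow> 'a"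
  assumes K: "K \<in> bounded_ops" and T: "nuclear_rep I a b T"
  shows "nuclear_rep I a (\<lambda>i. cadjoint K (b i)) (T \<circ> K)"
proof -
  have "cadjoint (cadjoint K \<circ> cadjoint T) = T \<circ> K"
    using nuclear_rep_bounded[OF T] K
    by (simp add: cadjoint_comp[OF cadjoint_bounded cadjoint_bounded])
  then show ?thesis
    using nuclear_rep_cadjoint[OF nuclear_rep_comp_left[OF cadjoint_bounded[OF K] nuclear_rep_cadjoint[OF T]]]
    by simp
qed

text \<open>Both outer operators are expanded around \<open>Z\<close>. A bound \<open>K\<close> of
  \<open>Z\<close> dominates the norms of the double family by \<open>K\<close> times the product of
  the two summable families.\<close>

lemma nuclear_rep_sandwich:
  fixes A C Z :: "'a::chilbert_space \<Rightarrow> 'a"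
  assumes A: "nuclear_rep I a b A" and C: "nuclear_rep J c d C" and Z: "Z \<in> bounded_ops"
  shows "nuclear_rep (I \<times> J) (\<lambda>(i, j). cinner (b i) (Z (c j)) *\<^sub>C a i) (\<lambda>(i, j). d j) (A \<circ> Z \<circ> C)"
proof -
  note bA = nuclear_rep_bounded[OF A] and bC = nuclear_rep_bounded[OF C]
  obtain K where K: "K > 0" "\<And>v. norm (Z v) \<le> K * norm v" using bounded_ops_norm[OF Z] by blast
  define f where "f i j v = cinner (d j) v *\<^sub>C cinner (b i) (Z (c j)) *\<^sub>C a i" for i j v
  have s: "(\<lambda>(i, j). K * ((norm (a i) * norm (b i)) * (norm (c j) * norm (d j)))) summable_on I \<times> J"
    using summable_on_cmult_right[OF summable_on_product[OF nuclear_rep_norm_summable[OF A] nuclear_rep_norm_summable[OF C]], of K]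
    by (simp add: case_prod_unfold)
  have le: "norm (cinner (b i) (Z (c j)) *\<^sub>C a i) * norm (d j) \<le>
      K * ((norm (a i) * norm (b i)) * (norm (c j) * norm (d j)))" for i j
  proof -
    have "cmod (cinner (b i) (Z (c j))) \<le> norm (b i) * (K * norm (c j))"
      using Cauchy_Schwarz_cinner[of "b i" "Z (c j)"] mult_left_mono[OF K(2)[of "c j"] norm_ge_zero[of "b i"]]
      by linarith
    then have "cmod (cinner (b i) (Z (c j))) * (norm (a i) * norm (d j)) \<le>
        (norm (b i) * (K * norm (c j))) * (norm (a i) * norm (d j))"
      by (rule mult_right_mono) simp
    then show ?thesis by (simp add: norm_scaleC ac_simps)
  qed
  have sn: "(\<lambda>(i, j). norm (cinner (b i) (Z (c j)) *\<^sub>C a i) * norm (d j)) summable_on I \<times> J"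
    by (rule summable_on_comparison_test[OF s]) (use le in auto)
  have "((\<lambda>(i, j). f i j v) has_sum A (Z (C v))) (I \<times> J)" for v
  proof (rule has_sum_SigmaI)
    show "((\<lambda>j. case (i, j) of (i, j) \<Rightarrow> f i j v) has_sum cinner (b i) (Z (C v)) *\<^sub>C a i) J" for i
    proof -
      have "((\<lambda>j. cinner (b i) (Z (cinner (d j) v *\<^sub>C c j))) has_sum cinner (b i) (Z (C v))) J"
        using C by (intro has_sum_cinner_right has_sum_bounded_ops[OF Z]) (simp add: nuclear_rep_def)
      then have "((\<lambda>j. cinner (b i) (Z (cinner (d j) v *\<^sub>C c j)) *\<^sub>C a i) has_sum cinner (b i) (Z (C v)) *\<^sub>C a i) J"
        by (rule has_sum_bounded_linear[OF scaleC.bounded_linear_left, unfolded o_def])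
      then show ?thesis by (simp add: f_def bounded_opsD_scaleC[OF Z] cinner_scaleC_right)
    qed
    show "((\<lambda>i. cinner (b i) (Z (C v)) *\<^sub>C a i) has_sum A (Z (C v))) I"
      using A by (simp add: nuclear_rep_def)
    have "(\<lambda>(i, j). norm (f i j v)) summable_on I \<times> J"
    proof (rule summable_on_comparison_test)
      show "(\<lambda>x. norm v * (case x of (i, j) \<Rightarrow> norm (cinner (b i) (Z (c j)) *\<^sub>C a i) * norm (d j))) summable_on I \<times> J"
        by (rule summable_on_cmult_right[OF sn])
      fix x assume "x \<in> I \<times> J"
      then obtain i j where x: "x = (i, j)" by (cases x)
      show "(case x of (i, j) \<Rightarrow> norm (f i j v)) \<le>
          norm v * (case x of (i, j) \<Rightarrow> norm (cinner (b i) (Z (c j)) *\<^sub>C a i) * norm (d j))"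
        using mult_right_mono[OF Cauchy_Schwarz_cinner[of "d j" v] norm_ge_zero[of "cinner (b i) (Z (c j)) *\<^sub>C a i"]]
        unfolding x f_def prod.case norm_scaleC[of "cinner (d j) v"] by (simp add: ac_simps)
    qed auto
    then show "(\<lambda>(i, j). f i j v) summable_on I \<times> J"
      by (rule abs_summable_summable[OF summable_on_cong[THEN iffD1, rotated]]) auto
  qed
  then show ?thesis using sn unfolding nuclear_rep_def f_def by (simp add: case_prod_unfold)
qed

text \<open>Continuity of evaluation lets a limit in \<open>hs\<close> be identified
  pointwise.\<close>

lemma bounded_linear_Rep_hs: "bounded_linear (\<lambda>Z. Rep_hs Z v)"
  by (rule bounded_linear_intro[where K = "norm v"])
     (simp_all add: Rep_hs_plus scaleR_hs_def Rep_hs_scaleC norm_Rep_hs_le scaleR_scaleC)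

text \<open>The coefficient \<open>cinner (b i) (Rep_hs Z (c j))\<close> is itself an inner product
  of \<open>Z\<close> with a rank one element, so the double expansion is a representation on
  \<open>hs\<close>. It converges absolutely there, and \<open>nuclear_rep_sandwich\<close>
  identifies the limit at each vector.\<close>

lemma nuclear_rep_hs_sandwich:
  fixes A C :: "'a::chilbert_space \<Rightarrow> 'a"
  assumes A: "nuclear_rep I a b A" and C: "nuclear_rep J c d C"
  shows "nuclear_rep (I \<times> J) (\<lambda>(i, j). hs_rank_one (a i) (d j)) (\<lambda>(i, j). hs_rank_one (b i) (c j))
    (on_hs (\<lambda>Z. A \<circ> Z \<circ> C))"
proof -
  note bA = nuclear_rep_bounded[OF A] and bC = nuclear_rep_bounded[OF C]
  have sn: "(\<lambda>(i, j). norm (hs_rank_one (a i) (d j)) * norm (hs_rank_one (b i) (c j))) summable_on I \<times> J"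
    using summable_on_product[OF nuclear_rep_norm_summable[OF A] nuclear_rep_norm_summable[OF C]]
    by (simp add: norm_hs_rank_one case_prod_unfold ac_simps)
  have "((\<lambda>(i, j). cinner (hs_rank_one (b i) (c j)) Z *\<^sub>C hs_rank_one (a i) (d j)) has_sum
      on_hs (\<lambda>Z. A \<circ> Z \<circ> C) Z) (I \<times> J)" for Z
  proof -
    have "(\<lambda>x. norm (case x of (i, j) \<Rightarrow> cinner (hs_rank_one (b i) (c j)) Z *\<^sub>C hs_rank_one (a i) (d j))) summable_on I \<times> J"
    proof (rule summable_on_comparison_test)
      show "(\<lambda>x. norm Z * (case x of (i, j) \<Rightarrow> norm (hs_rank_one (a i) (d j)) * norm (hs_rank_one (b i) (c j)))) summable_on I \<times> J"
        by (rule summable_on_cmult_right[OF sn])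
      fix x assume "x \<in> I \<times> J"
      then obtain i j where x: "x = (i, j)" by (cases x)
      show "norm (case x of (i, j) \<Rightarrow> cinner (hs_rank_one (b i) (c j)) Z *\<^sub>C hs_rank_one (a i) (d j)) \<le>
          norm Z * (case x of (i, j) \<Rightarrow> norm (hs_rank_one (a i) (d j)) * norm (hs_rank_one (b i) (c j)))"
        using mult_right_mono[OF Cauchy_Schwarz_cinner[of "hs_rank_one (b i) (c j)" Z] norm_ge_zero[of "hs_rank_one (a i) (d j)"]]
        unfolding x prod.case norm_scaleC by (simp add: ac_simps)
    qed auto
    from abs_summable_summable[OF this] obtain S where S: "((\<lambda>(i, j). cinner (hs_rank_one (b i) (c j)) Z *\<^sub>C hs_rank_one (a i) (d j)) has_sum S) (I \<times> J)"
      unfolding summable_on_def by blast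
    have "S = on_hs (\<lambda>Z. A \<circ> Z \<circ> C) Z"
    proof (rule hs_eqI)
      fix v
      have "((\<lambda>(i, j). cinner (d j) v *\<^sub>C cinner (b i) (Rep_hs Z (c j)) *\<^sub>C a i) has_sum Rep_hs S v) (I \<times> J)"
        using has_sum_bounded_linear[OF bounded_linear_Rep_hs S, of v]
        by (simp add: o_def case_prod_unfold Rep_hs_scaleC Rep_hs_rank_one rank_one_def cinner_hs_rank_one mult.commute)
      moreover have "((\<lambda>(i, j). cinner (d j) v *\<^sub>C cinner (b i) (Rep_hs Z (c j)) *\<^sub>C a i) has_sum (A \<circ> Rep_hs Z \<circ> C) v) (I \<times> J)"
        using nuclear_rep_sandwich[OF A C schatten_bounded[OF Rep_hs[of Z]]]
        by (simp add: nuclear_rep_def case_prod_unfold)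
      ultimately show "Rep_hs S v = Rep_hs (on_hs (\<lambda>Z. A \<circ> Z \<circ> C) Z) v"
        unfolding Rep_hs_sandwich[OF bA bC] by (rule has_sum_unique)
    qed
    then show ?thesis using S by simp
  qed
  then show ?thesis using sn by (simp add: nuclear_rep_def case_prod_unfold)
qed

text \<open>The inner product of \<open>|b i><c j|\<close> and \<open>|a i><d j|\<close> factors
  into a term of the trace of \<open>A\<close> and a term of the trace of \<open>C\<close>.\<close>

lemma op_trace_hs_sandwich:
  fixes A C :: "'a::chilbert_space \<Rightarrow> 'a"
  assumes A: "nuclear_rep I a b A" and C: "nuclear_rep J c d C"
  shows "op_trace (on_hs (\<lambda>Z. A \<circ> Z \<circ> C)) = op_trace A * op_trace C"
proof -
  have T: "((\<lambda>(i, j). cinner (b i) (a i) * cinner (d j) (c j)) has_sum op_trace (on_hs (\<lambda>Z. A \<circ> Z \<circ> C))) (I \<times> J)"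
    using op_trace_nuclear_rep[OF nuclear_rep_hs_sandwich[OF A C]]
    by (simp add: case_prod_unfold cinner_hs_rank_one_rank_one)
  moreover have "((\<lambda>(i, j). cinner (b i) (a i) * cinner (d j) (c j)) has_sum op_trace A * op_trace C) (I \<times> J)"
    by (rule has_sum_product[OF op_trace_nuclear_rep[OF A] op_trace_nuclear_rep[OF C] has_sum_imp_summable[OF T]])
  ultimately show ?thesis by (rule has_sum_unique)
qed

lemma trace_class_hs_sandwich:
  fixes A C :: "'a::chilbert_space \<Rightarrow> 'a"
  assumes A: "nuclear_rep I a b A" and C: "nuclear_rep J c d C"
  shows "(\<lambda>Z. A \<circ> Z \<circ> C) \<in> schatten_on_hs 1"
  using nuclear_rep_schatten_1(1)[OF nuclear_rep_hs_sandwich[OF A C]]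
    sandwich_schatten_2[OF nuclear_rep_bounded[OF A] nuclear_rep_bounded[OF C]]
  by (simp add: schatten_on_hs_def)

section \<open>Bounded maps on the trace class\<close>

lemma bounded_maps_trace_class_norm:
  fixes \<Phi> :: "('a::chilbert_space \<Rightarrow> 'a) \<Rightarrow> ('a \<Rightarrow> 'a)"
  assumes "\<Phi> \<in> bounded_maps_trace_class"
  obtains C where "C \<ge> 0"
    "\<And>X. X \<in> schatten 1 \<Longrightarrow> schatten_norm 1 (\<Phi> X) \<le> C * schatten_norm 1 X"
proof -
  obtain C where C: "\<forall>X\<in>schatten 1. schatten_norm 1 (\<Phi> X) \<le> C * schatten_norm 1 X"
    using assms by (auto simp: bounded_maps_trace_class_def)
  have "schatten_norm 1 (\<Phi> X) \<le> \<bar>C\<bar> * schatten_norm 1 X" if "X \<in> schatten 1" for X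
    using C that mult_right_mono[OF abs_ge_self[of C] schatten_norm_nonneg[of 1 X]] by force
  then show ?thesis using that[of "\<bar>C\<bar>"] by simp
qed

lemma trace_class_sandwich:
  fixes B Z :: "'a::chilbert_space \<Rightarrow> 'a"
  assumes B: "B \<in> schatten 2" and Z: "Z \<in> schatten 2"
  shows "cadjoint B \<circ> Z \<circ> B \<in> schatten 1"
proof -
  have "cadjoint B \<in> bounded_ops" by (rule cadjoint_bounded[OF schatten_bounded[OF B]])
  then obtain K where "\<And>v. norm (cadjoint B v) \<le> K * norm v" using bounded_ops_norm by blast
  then show ?thesis
    by (intro schatten_2_mult(1)[OF schatten_2_comp_left(1) B] Z cadjoint_bounded[OF schatten_bounded[OF B]])
qed

text \<open>The tails of a summable real family tend to 0 along the finite subsets, so an error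
  bounded by them does too.\<close>

lemma has_sum_from_tail:
  fixes f :: "'i \<Rightarrow> real" and g :: "'i \<Rightarrow> 'b::real_normed_vector"
  assumes f: "f summable_on A"
    and le: "\<And>G. finite G \<Longrightarrow> G \<subseteq> A \<Longrightarrow> norm (s - sum g G) \<le> C * infsum f (A - G)"
  shows "(g has_sum s) A"
proof -
  have "((\<lambda>G. C * (infsum f A - sum f G)) \<longlongrightarrow> C * (infsum f A - infsum f A)) (finite_subsets_at_top A)"
    using has_sum_infsum[OF f] unfolding has_sum_def by (intro tendsto_intros)
  then have lim: "((\<lambda>G. C * (infsum f A - sum f G)) \<longlongrightarrow> 0) (finite_subsets_at_top A)" by simp
  have "((\<lambda>G. sum g G - s) \<longlongrightarrow> 0) (finite_subsets_at_top A)"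
  proof (rule Lim_null_comparison[OF _ lim])
    show "\<forall>\<^sub>F G in finite_subsets_at_top A. norm (sum g G - s) \<le> C * (infsum f A - sum f G)"
    proof (rule eventually_finite_subsets_at_top_weakI)
      fix G assume G: "finite G" "G \<subseteq> A"
      have "f summable_on (A - G)" using f by (rule summable_on_subset_banach) auto
      then have "infsum f A = infsum f G + infsum f (A - G)"
        using G by (subst infsum_Un_disjoint[symmetric]) (auto simp: Un_absorb1)
      then show "norm (sum g G - s) \<le> C * (infsum f A - sum f G)"
        using le[OF G] G by (simp add: norm_minus_commute)
    qed
  qed
  then show ?thesis unfolding has_sum_def using Lim_null by blast
qed

text \<open>With the remainder again nuclear, its trace norm is bounded by the tail of the norm sum.
  This is the convergence in trace norm on which passing \<open>\<Phi>\<close> through a series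
  rests.\<close>

lemma nuclear_rep_subset:
  assumes T: "nuclear_rep I a b T" and G: "finite G" "G \<subseteq> I"
  shows "nuclear_rep (I - G) a b (\<lambda>v. T v - (\<Sum>i\<in>G. cinner (b i) v *\<^sub>C a i))"
  unfolding nuclear_rep_def
proof (intro conjI allI)
  show "(\<lambda>i. norm (a i) * norm (b i)) summable_on (I - G)"
    using nuclear_rep_norm_summable[OF T] by (rule summable_on_subset_banach) auto
  show "((\<lambda>i. cinner (b i) v *\<^sub>C a i) has_sum T v - (\<Sum>i\<in>G. cinner (b i) v *\<^sub>C a i)) (I - G)" for v
    using T G by (intro has_sum_Diff has_sum_finite) (auto simp: nuclear_rep_def)
qed

lemma trace_class_finite_rank:
  fixes a b :: "'i \<Rightarrow> 'a::chilbert_space"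
  assumes "finite G"
  shows "(\<lambda>v. \<Sum>i\<in>G. cinner (b i) v *\<^sub>C a i) \<in> schatten 1"
proof -
  have "nuclear_rep G a b (\<lambda>v. \<Sum>i\<in>G. cinner (b i) v *\<^sub>C a i)"
    using assms by (simp add: nuclear_rep_def)
  then show ?thesis by (rule nuclear_rep_schatten_1(1))
qed

context
  fixes \<Phi> :: "('a::chilbert_space \<Rightarrow> 'a) \<Rightarrow> ('a \<Rightarrow> 'a)" and C :: real
  assumes \<Phi>: "\<Phi> \<in> bounded_maps_trace_class" and C: "C \<ge> 0"
    and trace_map_norm: "\<And>X. X \<in> schatten 1 \<Longrightarrow> schatten_norm 1 (\<Phi> X) \<le> C * schatten_norm 1 X"
begin

lemma trace_map_schatten: "X \<in> schatten 1 \<Longrightarrow> \<Phi> X \<in> schatten 1"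
  using \<Phi> by (simp add: bounded_maps_trace_class_def)

lemma trace_map_add: "X \<in> schatten 1 \<Longrightarrow> Y \<in> schatten 1 \<Longrightarrow> \<Phi> (\<lambda>v. X v + Y v) = (\<lambda>v. \<Phi> X v + \<Phi> Y v)"
  using \<Phi> by (simp add: bounded_maps_trace_class_def)

lemma trace_map_scaleC: "X \<in> schatten 1 \<Longrightarrow> \<Phi> (\<lambda>v. c *\<^sub>C X v) = (\<lambda>v. c *\<^sub>C \<Phi> X v)"
  using \<Phi> by (simp add: bounded_maps_trace_class_def)

lemma trace_map_schatten_2: "X \<in> schatten 1 \<Longrightarrow> \<Phi> X \<in> schatten 2"
  by (rule schatten_1_subset_2(1)[OF trace_map_schatten])

lemma trace_map_norm_2: "X \<in> schatten 1 \<Longrightarrow> schatten_norm 2 (\<Phi> X) \<le> C * schatten_norm 1 X"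
  using schatten_1_subset_2(2)[OF trace_map_schatten] trace_map_norm order_trans by blast

lemma norm_trace_map_rank_one: "schatten_norm 2 (\<Phi> (rank_one a b)) \<le> C * (norm a * norm b)"
  using trace_map_norm_2[OF rank_one_schatten_1(1)[of a b]] mult_left_mono[OF rank_one_schatten_1(2)[of a b] C] by linarith

lemma trace_map_sum:
  assumes "finite G"
  shows "\<Phi> (\<lambda>v. \<Sum>i\<in>G. c i *\<^sub>C rank_one (a i) (b i) v) = (\<lambda>v. \<Sum>i\<in>G. c i *\<^sub>C \<Phi> (rank_one (a i) (b i)) v)"
  using assms
proof (induction G rule: finite_induct)
  case empty
  \<comment> \<open>The empty sum is 0 times a rank one operator, so homogeneity gives its
    image.\<close>
  show ?case using trace_map_scaleC[OF rank_one_schatten_1(1)[of 0 0], of 0] by simp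
next
  case (insert x G)
  have fin: "(\<lambda>v. \<Sum>i\<in>F. c i *\<^sub>C rank_one (a i) (b i) v) \<in> schatten 1" if "finite F" for F
    using trace_class_finite_rank[OF that, of b "\<lambda>i. c i *\<^sub>C a i"] by (simp add: rank_one_def mult.commute)
  have x: "(\<lambda>v. c x *\<^sub>C rank_one (a x) (b x) v) \<in> schatten 1"
    using fin[of "{x}"] insert(1,2) trace_class_finite_rank[of "{x}" b "\<lambda>i. c i *\<^sub>C a i"]
    by (simp add: rank_one_def mult.commute)
  show ?case
    using trace_map_add[OF x fin[OF insert(1)]] trace_map_scaleC[OF rank_one_schatten_1(1)[of "a x" "b x"], of "c x"] insert
    by simp
qed

context
  fixes B :: "'a \<Rightarrow> 'a"
  assumes B: "B \<in> schatten 2"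
begin

lemma Rep_hs_trace_map: "Rep_hs (on_hs (\<lambda>Z. \<Phi> (cadjoint B \<circ> Z \<circ> B)) W) = \<Phi> (cadjoint B \<circ> Rep_hs W \<circ> B)"
  unfolding on_hs_def by (rule Abs_hs_inverse[OF trace_map_schatten_2[OF trace_class_sandwich[OF B Rep_hs]]])

lemma norm_trace_map_hs_rank_one:
  "norm (on_hs (\<lambda>Z. \<Phi> (cadjoint B \<circ> Z \<circ> B)) (hs_rank_one a b)) \<le> C * (norm (cadjoint B a) * norm (cadjoint B b))"
proof -
  have "cadjoint B \<circ> rank_one a b \<circ> B = rank_one (cadjoint B a) (cadjoint B b)"
    by (rule sandwich_rank_one[OF cadjoint_bounded]) (rule schatten_bounded[OF B])+
  then show ?thesis by (simp add: norm_hs_def Rep_hs_trace_map Rep_hs_rank_one norm_trace_map_rank_one)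
qed

lemma trace_map_sandwich_bounded: "on_hs (\<lambda>Z. \<Phi> (cadjoint B \<circ> Z \<circ> B)) \<in> bounded_ops"
proof -
  have bB: "cadjoint B \<in> bounded_ops" by (rule cadjoint_bounded[OF schatten_bounded[OF B]])
  obtain K where K: "K > 0" "\<And>v. norm (cadjoint B v) \<le> K * norm v" using bounded_ops_norm[OF bB] by blast
  note sw = trace_class_sandwich[OF B Rep_hs]
  show ?thesis
  \<comment> \<open>\<open>C\<close> comes from \<open>\<Phi>\<close> and \<open>K\<close> from left
    multiplication by the adjoint of \<open>B\<close>. The factor \<open>schatten_norm 2 B\<close>
    appears because the trace norm of a product is bounded by the two Hilbert-Schmidt norms.\<close>
  proof (rule bounded_opsI[where C = "C * K * schatten_norm 2 B"])
    fix U V and c :: complex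
    have "cadjoint B \<circ> Rep_hs (U + V) \<circ> B =
        (\<lambda>v. (cadjoint B \<circ> Rep_hs U \<circ> B) v + (cadjoint B \<circ> Rep_hs V \<circ> B) v)"
      by (simp add: o_def Rep_hs_plus linear_simps[OF bounded_opsD[OF bB]])
    then show "on_hs (\<lambda>Z. \<Phi> (cadjoint B \<circ> Z \<circ> B)) (U + V) =
        on_hs (\<lambda>Z. \<Phi> (cadjoint B \<circ> Z \<circ> B)) U + on_hs (\<lambda>Z. \<Phi> (cadjoint B \<circ> Z \<circ> B)) V"
      by (intro hs_eqI) (simp only: Rep_hs_trace_map trace_map_add[OF sw sw] Rep_hs_plus[of "on_hs _ U"])
    have "cadjoint B \<circ> Rep_hs (c *\<^sub>C U) \<circ> B = (\<lambda>v. c *\<^sub>C (cadjoint B \<circ> Rep_hs U \<circ> B) v)"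
      by (simp add: o_def Rep_hs_scaleC bounded_opsD_scaleC[OF bB])
    then show "on_hs (\<lambda>Z. \<Phi> (cadjoint B \<circ> Z \<circ> B)) (c *\<^sub>C U) = c *\<^sub>C on_hs (\<lambda>Z. \<Phi> (cadjoint B \<circ> Z \<circ> B)) U"
      by (intro hs_eqI) (simp only: Rep_hs_trace_map trace_map_scaleC[OF sw] Rep_hs_scaleC[of c "on_hs _ U"])
    have "norm (on_hs (\<lambda>Z. \<Phi> (cadjoint B \<circ> Z \<circ> B)) U) \<le> C * schatten_norm 1 (cadjoint B \<circ> Rep_hs U \<circ> B)"
      unfolding norm_hs_def Rep_hs_trace_map by (rule trace_map_norm_2[OF sw])
    also have "\<dots> \<le> C * (K * schatten_norm 2 (Rep_hs U) * schatten_norm 2 B)"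
    proof (intro mult_left_mono C)
      have "schatten_norm 1 (cadjoint B \<circ> Rep_hs U \<circ> B) \<le> schatten_norm 2 (cadjoint B \<circ> Rep_hs U) * schatten_norm 2 B"
        by (rule schatten_2_mult(2)[OF schatten_2_comp_left(1)[OF bB K(2) Rep_hs] B])
      also have "\<dots> \<le> K * schatten_norm 2 (Rep_hs U) * schatten_norm 2 B"
        by (rule mult_right_mono[OF schatten_2_comp_left(2)[OF bB K(2) Rep_hs] schatten_norm_nonneg])
      finally show "schatten_norm 1 (cadjoint B \<circ> Rep_hs U \<circ> B) \<le> K * schatten_norm 2 (Rep_hs U) * schatten_norm 2 B" .
    qed
    finally show "norm (on_hs (\<lambda>Z. \<Phi> (cadjoint B \<circ> Z \<circ> B)) U) \<le> C * K * schatten_norm 2 B * norm U"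
      by (simp add: norm_hs_def ac_simps)
  qed
qed

lemma trace_map_sandwich_schatten_2: "(\<lambda>Z. \<Phi> (cadjoint B \<circ> Z \<circ> B)) \<in> schatten_on_hs 2"
proof -
  define T where "T = on_hs (\<lambda>Z. \<Phi> (cadjoint B \<circ> Z \<circ> B))"
  obtain E where E: "orthonormal_basis (E :: 'a set)" by (rule orthonormal_basis_exists)
  have inj: "inj_on (\<lambda>(e, f). hs_rank_one e f) (E \<times> E)"
    by (rule hs_rank_one_orthonormal(2)[OF orthonormal_basisD[OF E] orthonormal_basisD[OF E]])
  have "cadjoint B \<in> schatten 2" by (rule schatten_cadjoint(1)[OF B]) simp
  from has_sum_imp_summable[OF schatten_2_has_sum[OF this E]]
  have "(\<lambda>(e, f). (norm (cadjoint B e))\<^sup>2 * (norm (cadjoint B f))\<^sup>2) summable_on E \<times> E"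
    by (intro summable_on_product) auto
  from summable_on_cmult_right[OF this, of "C\<^sup>2"]
  have "(\<lambda>x. (norm (T (case x of (e, f) \<Rightarrow> hs_rank_one e f)))\<^sup>2) summable_on E \<times> E"
  proof (rule summable_on_comparison_test)
    fix x assume "x \<in> E \<times> E"
    then obtain e f where x: "x = (e, f)" by (cases x)
    show "(norm (T (case x of (e, f) \<Rightarrow> hs_rank_one e f)))\<^sup>2 \<le>
        C\<^sup>2 * (case x of (e, f) \<Rightarrow> (norm (cadjoint B e))\<^sup>2 * (norm (cadjoint B f))\<^sup>2)"
      using power_mono[OF norm_trace_map_hs_rank_one[of e f] norm_ge_zero, of 2]
      by (simp add: x T_def power_mult_distrib)
  qed simp
  then have "(\<lambda>e. (norm (T e))\<^sup>2) summable_on (\<lambda>(e, f). hs_rank_one e f) ` (E \<times> E)"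
    unfolding summable_on_reindex[OF inj] by (simp add: o_def)
  moreover have "T \<in> bounded_ops" unfolding T_def by (rule trace_map_sandwich_bounded)
  ultimately have "T \<in> schatten 2" by (rule schatten_2_summableI[OF _ hs_rank_one_basis[OF E E], rotated])
  then show ?thesis
    by (simp add: schatten_on_hs_def T_def trace_map_schatten_2[OF trace_class_sandwich[OF B]])
qed

end

lemma trace_map_sandwich_schatten_1:
  assumes B: "B \<in> schatten 1"
  shows "(\<lambda>Z. \<Phi> (cadjoint B \<circ> Z \<circ> B)) \<in> schatten_on_hs 1"
proof -
  have B2: "B \<in> schatten 2" by (rule schatten_1_subset_2(1)[OF B])
  define T where "T = on_hs (\<lambda>Z. \<Phi> (cadjoint B \<circ> Z \<circ> B))"
  obtain E where oE: "orthonormal E" and nB: "nuclear_rep E B (\<lambda>e. e) B"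
    and sB: "((\<lambda>e. norm (B e)) has_sum schatten_norm 1 B) E" using schatten_1E[OF B] by blast
  note R1 = rank_one_schatten_1(1)
  have Rep_a: "Rep_hs (Abs_hs (\<Phi> (rank_one a b))) = \<Phi> (rank_one a b)" for a b
    by (rule Abs_hs_inverse[OF trace_map_schatten_2[OF R1]])
  have sBB: "(\<lambda>(k, l). norm (B k) * norm (B l)) summable_on E \<times> E"
    using has_sum_imp_summable[OF sB] by (intro summable_on_product) auto
  \<comment> \<open>The first vectors are bounded by \<open>C\<close>, because \<open>k\<close> and
    \<open>l\<close> are unit vectors; all the summability sits in the second ones, of norm
    \<open>norm (B k) * norm (B l)\<close>.\<close>
  have "nuclear_rep (E \<times> E) (\<lambda>(k, l). Abs_hs (\<Phi> (rank_one k l))) (\<lambda>(k, l). hs_rank_one (B k) (B l)) T"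
    unfolding nuclear_rep_def
  proof (intro conjI allI)
    show "(\<lambda>x. norm (case x of (k, l) \<Rightarrow> Abs_hs (\<Phi> (rank_one k l))) *
        norm (case x of (k, l) \<Rightarrow> hs_rank_one (B k) (B l))) summable_on E \<times> E"
    proof (rule summable_on_comparison_test[OF summable_on_cmult_right[OF sBB, of C]])
      fix x assume "x \<in> E \<times> E"
      then obtain k l where x: "x = (k, l)" "k \<in> E" "l \<in> E" by auto
      have "norm (Abs_hs (\<Phi> (rank_one k l))) \<le> C"
        using norm_trace_map_rank_one[of k l] orthonormal_norm[OF oE] x by (simp add: norm_hs_def Rep_a)
      then have "norm (Abs_hs (\<Phi> (rank_one k l))) * (norm (B k) * norm (B l)) \<le> C * (norm (B k) * norm (B l))"
        by (rule mult_right_mono) simp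
      then show "norm (case x of (k, l) \<Rightarrow> Abs_hs (\<Phi> (rank_one k l))) *
        norm (case x of (k, l) \<Rightarrow> hs_rank_one (B k) (B l)) \<le> C * (case x of (k, l) \<Rightarrow> norm (B k) * norm (B l))"
        by (simp add: x norm_hs_rank_one)
    qed simp
  next
    fix Z
    define c where "c = (\<lambda>(k, l). cinner (B k) (Rep_hs Z (B l)))"
    \<comment> \<open>\<open>D G\<close> is the remainder of the expansion after the terms in
      \<open>G\<close>. It is trace class with norm at most the tail of \<open>cmod (c x)\<close>,
      so \<open>\<Phi>\<close> may be applied to it.\<close>
    define D where "D G v = (cadjoint B \<circ> Rep_hs Z \<circ> B) v - (\<Sum>x\<in>G. c x *\<^sub>C rank_one (fst x) (snd x) v)" for G v
    have bZ: "Rep_hs Z \<in> bounded_ops" by (rule schatten_bounded[OF Rep_hs])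
    have N: "nuclear_rep (E \<times> E) (\<lambda>x. c x *\<^sub>C fst x) snd (cadjoint B \<circ> Rep_hs Z \<circ> B)"
      using nuclear_rep_sandwich[OF nuclear_rep_cadjoint[OF nB] nB bZ] by (simp add: c_def case_prod_unfold)
    have ND: "nuclear_rep (E \<times> E - G) (\<lambda>x. c x *\<^sub>C fst x) snd (D G)" if "finite G" "G \<subseteq> E \<times> E" for G
      using nuclear_rep_subset[OF N that] by (simp add: D_def[abs_def] rank_one_def mult.commute)
    have cn: "norm (c x *\<^sub>C fst x) * norm (snd x) = cmod (c x)" if "x \<in> E \<times> E" for x
      using that orthonormal_norm[OF oE] by (auto simp: norm_scaleC)
    have sc: "(\<lambda>x. cmod (c x)) summable_on E \<times> E"
      using nuclear_rep_norm_summable[OF N] by (rule summable_on_cong[THEN iffD1, rotated]) (rule cn)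
    have "((\<lambda>x. c x *\<^sub>C Abs_hs (\<Phi> (rank_one (fst x) (snd x)))) has_sum T Z) (E \<times> E)"
    proof (rule has_sum_from_tail[OF sc])
      fix G :: "('a \<times> 'a) set" assume G: "finite G" "G \<subseteq> E \<times> E"
      have D1: "D G \<in> schatten 1" "schatten_norm 1 (D G) \<le> (\<Sum>\<^sub>\<infinity>x\<in>E \<times> E - G. cmod (c x))"
        using nuclear_rep_schatten_1[OF ND[OF G]] infsum_cong[of "E \<times> E - G", OF cn] by simp_all
      have S1: "(\<lambda>v. \<Sum>x\<in>G. c x *\<^sub>C rank_one (fst x) (snd x) v) \<in> schatten 1"
        using trace_class_finite_rank[OF G(1), of snd "\<lambda>x. c x *\<^sub>C fst x"] by (simp add: rank_one_def mult.commute)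
      have "cadjoint B \<circ> Rep_hs Z \<circ> B = (\<lambda>v. D G v + (\<Sum>x\<in>G. c x *\<^sub>C rank_one (fst x) (snd x) v))"
        by (simp add: D_def fun_eq_iff)
      \<comment> \<open>Here \<open>\<Phi>\<close> is split over a finite sum and one remainder
        only; the series for \<open>T Z\<close> arises because the remainder tends to zero.\<close>
      then have "\<Phi> (cadjoint B \<circ> Rep_hs Z \<circ> B) v = \<Phi> (D G) v + (\<Sum>x\<in>G. c x *\<^sub>C \<Phi> (rank_one (fst x) (snd x)) v)" for v
        by (simp only: trace_map_add[OF D1(1) S1] trace_map_sum[OF G(1)])
      moreover have "Rep_hs (\<Sum>x\<in>G. c x *\<^sub>C Abs_hs (\<Phi> (rank_one (fst x) (snd x)))) v =
          (\<Sum>x\<in>G. c x *\<^sub>C \<Phi> (rank_one (fst x) (snd x)) v)" for v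
        by (simp add: linear_sum[OF bounded_linear.linear[OF bounded_linear_Rep_hs]] Rep_hs_scaleC Rep_a)
      ultimately have "Rep_hs (T Z - (\<Sum>x\<in>G. c x *\<^sub>C Abs_hs (\<Phi> (rank_one (fst x) (snd x))))) = \<Phi> (D G)"
        by (simp add: fun_eq_iff Rep_hs_minus T_def Rep_hs_trace_map[OF B2])
      then have "norm (T Z - (\<Sum>x\<in>G. c x *\<^sub>C Abs_hs (\<Phi> (rank_one (fst x) (snd x))))) = schatten_norm 2 (\<Phi> (D G))"
        by (simp add: norm_hs_def)
      also have "\<dots> \<le> C * schatten_norm 1 (D G)" by (rule trace_map_norm_2[OF D1(1)])
      also have "\<dots> \<le> C * (\<Sum>\<^sub>\<infinity>x\<in>E \<times> E - G. cmod (c x))" by (rule mult_left_mono[OF D1(2) C])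
      finally show "norm (T Z - (\<Sum>x\<in>G. c x *\<^sub>C Abs_hs (\<Phi> (rank_one (fst x) (snd x))))) \<le>
          C * (\<Sum>\<^sub>\<infinity>x\<in>E \<times> E - G. cmod (c x))" .
    qed
    then show "((\<lambda>x. cinner (case x of (k, l) \<Rightarrow> hs_rank_one (B k) (B l)) Z *\<^sub>C
        (case x of (k, l) \<Rightarrow> Abs_hs (\<Phi> (rank_one k l)))) has_sum T Z) (E \<times> E)"
      by (simp add: c_def case_prod_unfold cinner_hs_rank_one)
  qed
  then have "T \<in> schatten 1" by (rule nuclear_rep_schatten_1(1))
  then show ?thesis
    by (simp add: schatten_on_hs_def T_def trace_map_schatten_2[OF trace_class_sandwich[OF B2]])
qed

end

theorem lemma4p3:
  shows
    "(\<forall>p>0. \<forall>X\<in>schatten p. \<forall>Y\<in>(schatten p :: ('a::chilbert_space \<Rightarrow> 'a) set).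
        (\<lambda>Z. cadjoint X \<circ> Z \<circ> Y) \<in> schatten_on_hs p \<and>
        schatten_norm p (on_hs (\<lambda>Z. cadjoint X \<circ> Z \<circ> Y)) = schatten_norm p X * schatten_norm p Y) \<and>
     (\<forall>\<Phi>\<in>bounded_maps_trace_class. \<forall>B\<in>(schatten 2 :: ('a \<Rightarrow> 'a) set).
        (\<lambda>Z. \<Phi> (cadjoint B \<circ> Z \<circ> B)) \<in> schatten_on_hs 2) \<and>
     (\<forall>\<Phi>\<in>bounded_maps_trace_class. \<forall>B\<in>(schatten 1 :: ('a \<Rightarrow> 'a) set).
        (\<lambda>Z. \<Phi> (cadjoint B \<circ> Z \<circ> B)) \<in> schatten_on_hs 1) \<and>
     (\<forall>K\<^sub>1\<in>bounded_ops. \<forall>K\<^sub>2\<in>bounded_ops. \<forall>B\<in>(schatten 1 :: ('a \<Rightarrow> 'a) set).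
        (\<lambda>X. K\<^sub>1 \<circ> cadjoint B \<circ> X \<circ> B \<circ> K\<^sub>2) \<in> schatten_on_hs 1 \<and>
        op_trace (on_hs (\<lambda>X. K\<^sub>1 \<circ> cadjoint B \<circ> X \<circ> B \<circ> K\<^sub>2)) =
          op_trace (K\<^sub>1 \<circ> cadjoint B) * op_trace (B \<circ> K\<^sub>2))"
proof (intro conjI ballI allI impI)
  fix p :: real and X Y :: "'a \<Rightarrow> 'a" assume "p > 0" "X \<in> schatten p" "Y \<in> schatten p"
  then show "(\<lambda>Z. cadjoint X \<circ> Z \<circ> Y) \<in> schatten_on_hs p"
    "schatten_norm p (on_hs (\<lambda>Z. cadjoint X \<circ> Z \<circ> Y)) = schatten_norm p X * schatten_norm p Y"
    by (rule schatten_hs_sandwich)+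
next
  fix \<Phi> :: "('a \<Rightarrow> 'a) \<Rightarrow> ('a \<Rightarrow> 'a)" and B :: "'a \<Rightarrow> 'a"
  assume \<Phi>: "\<Phi> \<in> bounded_maps_trace_class"
  then obtain C where C: "C \<ge> 0" "\<And>X. X \<in> schatten 1 \<Longrightarrow> schatten_norm 1 (\<Phi> X) \<le> C * schatten_norm 1 X"
    using bounded_maps_trace_class_norm by blast
  show "(\<lambda>Z. \<Phi> (cadjoint B \<circ> Z \<circ> B)) \<in> schatten_on_hs 2" if "B \<in> schatten 2"
    by (rule trace_map_sandwich_schatten_2[OF \<Phi> C that])
  show "(\<lambda>Z. \<Phi> (cadjoint B \<circ> Z \<circ> B)) \<in> schatten_on_hs 1" if "B \<in> schatten 1"
    by (rule trace_map_sandwich_schatten_1[OF \<Phi> C that])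
next
  fix K\<^sub>1 K\<^sub>2 B :: "'a \<Rightarrow> 'a"
  assume K: "K\<^sub>1 \<in> bounded_ops" "K\<^sub>2 \<in> bounded_ops" and "B \<in> schatten 1"
  then obtain E where B: "nuclear_rep E B (\<lambda>e. e) B" using schatten_1E by blast
  \<comment> \<open>The product is grouped as \<open>K\<^sub>1 \<circ> cadjoint B\<close>,
    \<open>X\<close> and \<open>B \<circ> K\<^sub>2\<close>, so that both outer factors are
    nuclear.\<close>
  note A = nuclear_rep_comp_left[OF K(1) nuclear_rep_cadjoint[OF B]]
    and C = nuclear_rep_comp_right[OF K(2) B]
  show "(\<lambda>X. K\<^sub>1 \<circ> cadjoint B \<circ> X \<circ> B \<circ> K\<^sub>2) \<in> schatten_on_hs 1"
    using trace_class_hs_sandwich[OF A C] by (simp add: o_assoc)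
  show "op_trace (on_hs (\<lambda>X. K\<^sub>1 \<circ> cadjoint B \<circ> X \<circ> B \<circ> K\<^sub>2)) =
      op_trace (K\<^sub>1 \<circ> cadjoint B) * op_trace (B \<circ> K\<^sub>2)"
    using op_trace_hs_sandwich[OF A C] by (simp add: o_assoc)
qed

end
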